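(* Let $(H,W,\mu)$ be an abstract Wiener space and let $\{X_n\}_{n\ge1}$ be a sequence of independent and identically distributed random variables defined on a probability space $(\Omega,\mathcal{F},\mathcal{P})$ and taking values in $(W,\mathcal{B}(W))$. Suppose that the common law of the $X_n$'s is absolutely continuous with respect to $\mu$ with density $f$, and that $f\in\mathcal{L}^p(W,\mu)$ for some $p>1$. If the density with respect to $\mu$ of (the law of) $\frac{X_1+\cdots+X_n}{\sqrt n}$ converges to $1$ in $\mathcal{L}^1(W,\mu)$ as $n\to\infty$, then $f$ is orthogonal to the first and second Wiener chaoses, i.e. $J_1f=0$ and $J_2f=0$.
   Context: Abstract Wiener space $(H,W,\mu)$: $(H,\langle\cdot,\cdot\rangle_H)$ is a separable real Hilbert space continuously and densely embedded in the Banach space $(W,\|\cdot\|_W)$, and $\mu$ is a Gaussian probability measure on the Borel sets $\mathcal{B}(W)$ such that $\int_W e^{i\langle w,w^*\rangle}d\mu(w)=e^{-\frac12\|w^*\|_H^2}$ for all $w^*\in W^*$, where $W^*\subset H$ is the dual space of $W$ (dense in $H$) and $\langle\cdot,\cdot\rangle$ is the dual pairing between $W$ and $W^*$. For $p\ge1$, $\mathcal{L}^p(W,\mu)$ is the space of real-valued $f$ with $\|f\|_p=(\int_W|f|^pd\mu)^{1/p}<\infty$. By the Wiener–Itô chaos decomposition every $f\in\mathcal{L}^2(W,\mu)$ has an orthogonal expansion $f=\sum_{n\ge0}\delta^n(\mathfrak{h}_n)$ with $\mathfrak{h}_n\in H^{\hat\otimes n}$ (symmetric elements of $H^{\otimes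 n}$), where $\delta^n(\mathfrak{h}_n)$ is the multiple Wiener–Itô integral of $\mathfrak{h}_n$; $J_n(f)=\delta^n(\mathfrak{h}_n)$ is the orthogonal projection onto the $n$-th Wiener chaos. For every $p>1$, $J_n$ extends to a continuous linear operator from $\mathcal{L}^p(W,\mu)$ into itself, also denoted $J_n$. Under the stated assumptions the law of $\frac{X_1+\cdots+X_n}{\sqrt n}$ is absolutely continuous with respect to $\mu$ for every $n$, so its density is well defined. *)

theory Defs
  imports "HOL-Probability.Probability"
begin

section \<open>Lebesgue spaces of real functions\<close>

text \<open>Elements are functions rather than classes of functions; equality of classes is always
  written as an almost-everywhere equality.\<close>

definition Lp_space :: "'a measure \<Rightarrow> real \<Rightarrow> ('a \<Rightarrow> real) set" where
  "Lp_space M p = {f \<in> borel_measurable M. integrable M (\<lambda>x. \<bar>f x\<bar> powr p)}"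

definition Lp_norm :: "'a measure \<Rightarrow> real \<Rightarrow> ('a \<Rightarrow> real) \<Rightarrow> real" where
  "Lp_norm M p f = (LINT x|M. \<bar>f x\<bar> powr p) powr (1 / p)"

section \<open>Abstract Wiener spaces\<close>

text \<open>The embedding of \<open>W\<^sup>*\<close> into \<open>H\<close> induced by \<open>\<iota> : H \<rightarrow> W\<close>: the Riesz representer in \<open>H\<close> of the
  restricted functional \<open>\<phi> \<circ> \<iota>\<close>.\<close>

definition dual_embedding ::
    "('h::{real_inner, complete_space} \<Rightarrow> 'w::banach) \<Rightarrow> ('w \<Rightarrow>\<^sub>L real) \<Rightarrow> 'h" where
  "dual_embedding \<iota> \<phi> = (THE h. \<forall>k. blinfun_apply \<phi> (\<iota> k) = inner h k)"

text \<open>For metric spaces, \<^class>\<open>second_countable_topology\<close> expresses separability. Separability of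
  \<open>W\<close> is no restriction, since \<open>W\<close> contains the continuous image of \<open>H\<close> as a dense subset.
  That \<open>\<mu>\<close> is Gaussian is contained in the formula for its characteristic functional.\<close>

locale abstract_wiener_space = prob_space \<mu>
  for \<iota> :: "'h::{real_inner, complete_space, second_countable_topology}
              \<Rightarrow> 'w::{banach, second_countable_topology}"
    and \<mu> :: "'w measure" +
  assumes sets_eq_borel: "sets \<mu> = sets borel"
    and embedding_bounded_linear: "bounded_linear \<iota>"
    and embedding_inj: "inj \<iota>"
    and embedding_dense: "closure (range \<iota>) = UNIV"
    and dual_dense: "closure (range (dual_embedding \<iota>)) = UNIV"
    and characteristic_functional:
      "\<And>\<phi> :: 'w \<Rightarrow>\<^sub>L real.
         (LINT w|\<mu>. exp (\<i> * complex_of_real (blinfun_apply \<phi> w)))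
           = complex_of_real (exp (- (norm (dual_embedding \<iota> \<phi>))\<^sup>2 / 2))"

section \<open>Wiener chaos\<close>

text \<open>The Wiener integral \<open>\<delta>(h)\<close>: the extension to \<open>H\<close>, by \<open>L\<^sup>2\<close>-continuity, of the map sending
  (the image in \<open>H\<close> of) \<open>\<phi> \<in> W\<^sup>*\<close> to the random variable \<open>w \<mapsto> \<langle>w, \<phi>\<rangle>\<close>.\<close>

definition wiener_integral ::
    "('h::{real_inner, complete_space} \<Rightarrow> 'w::banach) \<Rightarrow> 'w measure \<Rightarrow> 'h \<Rightarrow> 'w \<Rightarrow> real" where
  "wiener_integral \<iota> \<mu> h =
     (SOME F. F \<in> Lp_space \<mu> 2 \<and>
        (\<forall>\<phi> :: nat \<Rightarrow> 'w \<Rightarrow>\<^sub>L real. (\<lambda>k. dual_embedding \<iota> (\<phi> k)) \<longlonglongrightarrow> h \<longrightarrow>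
           (\<lambda>k. Lp_norm \<mu> 2 (\<lambda>w. F w - blinfun_apply (\<phi> k) w)) \<longlonglongrightarrow> 0))"

text \<open>Monic (probabilists') Hermite polynomials.\<close>

fun hermite :: "nat \<Rightarrow> real \<Rightarrow> real" where
  "hermite 0 x = 1"
| "hermite (Suc 0) x = x"
| "hermite (Suc (Suc n)) x = x * hermite (Suc n) x - real (Suc n) * hermite n x"

text \<open>The multiple Wiener--Ito integral \<open>\<delta>\<^sup>n(h\<otimes>\<dots>\<otimes>h)\<close> of the \<open>n\<close>-th tensor power of \<open>h\<close>.
  For \<open>h = 0\<close> the conventions \<open>0 / 0 = 0\<close> and \<open>0 ^ 0 = 1\<close> give the right values, \<open>0\<close> for
  \<open>n > 0\<close> and \<open>1\<close> for \<open>n = 0\<close>.\<close>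

definition multiple_integral ::
    "('h::{real_inner, complete_space} \<Rightarrow> 'w::banach) \<Rightarrow> 'w measure \<Rightarrow> nat \<Rightarrow> 'h \<Rightarrow> 'w \<Rightarrow> real" where
  "multiple_integral \<iota> \<mu> n h w = norm h ^ n * hermite n (wiener_integral \<iota> \<mu> h w / norm h)"

text \<open>The tensor powers of the \<open>h \<in> H\<close> span a dense subspace of the \<open>n\<close>-th symmetric tensor power of
  \<open>H\<close>, and \<open>\<delta>\<^sup>n\<close> is isometric on the latter up to the factor \<open>sqrt (n!)\<close>. Hence the range of \<open>\<delta>\<^sup>n\<close>, the
  \<open>n\<close>-th Wiener chaos, is the closed linear span in \<open>L\<^sup>2\<close> of the \<open>\<delta>\<^sup>n(h\<otimes>\<dots>\<otimes>h)\<close>.\<close>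

definition wiener_chaos ::
    "('h::{real_inner, complete_space} \<Rightarrow> 'w::banach) \<Rightarrow> 'w measure \<Rightarrow> nat \<Rightarrow> ('w \<Rightarrow> real) set" where
  "wiener_chaos \<iota> \<mu> n =
     {F \<in> Lp_space \<mu> 2. \<forall>\<epsilon>>0. \<exists>(m::nat) (c :: nat \<Rightarrow> real) (h :: nat \<Rightarrow> 'h).
        Lp_norm \<mu> 2 (\<lambda>w. F w - (\<Sum>j<m. c j * multiple_integral \<iota> \<mu> n (h j) w)) < \<epsilon>}"

definition chaos_projection_L2 ::
    "('h::{real_inner, complete_space} \<Rightarrow> 'w::banach) \<Rightarrow> 'w measure \<Rightarrow> nat
       \<Rightarrow> ('w \<Rightarrow> real) \<Rightarrow> ('w \<Rightarrow> real)" where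
  "chaos_projection_L2 \<iota> \<mu> n f =
     (SOME g. g \<in> wiener_chaos \<iota> \<mu> n \<and>
        (\<forall>F \<in> wiener_chaos \<iota> \<mu> n. (LINT w|\<mu>. (f w - g w) * F w) = 0))"

text \<open>The conditions say that \<open>T\<close> induces a continuous linear operator on the space of classes;
  well-definedness on classes follows from linearity and boundedness.\<close>

definition is_chaos_extension ::
    "('h::{real_inner, complete_space} \<Rightarrow> 'w::banach) \<Rightarrow> 'w measure \<Rightarrow> nat \<Rightarrow> real
       \<Rightarrow> (('w \<Rightarrow> real) \<Rightarrow> ('w \<Rightarrow> real)) \<Rightarrow> bool" where
  "is_chaos_extension \<iota> \<mu> n p T \<longleftrightarrow>
     (\<forall>f \<in> Lp_space \<mu> p. T f \<in> Lp_space \<mu> p) \<and>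
     (\<forall>f \<in> Lp_space \<mu> p. \<forall>g \<in> Lp_space \<mu> p. \<forall>a b.
        AE w in \<mu>. T (\<lambda>x. a * f x + b * g x) w = a * T f w + b * T g w) \<and>
     (\<exists>C. \<forall>f \<in> Lp_space \<mu> p. Lp_norm \<mu> p (T f) \<le> C * Lp_norm \<mu> p f) \<and>
     (\<forall>f \<in> Lp_space \<mu> p \<inter> Lp_space \<mu> 2. AE w in \<mu>. T f w = chaos_projection_L2 \<iota> \<mu> n f w)"

text \<open>The operator \<open>J\<^sub>n\<close> on \<open>L\<^sup>p\<close>, \<open>p > 1\<close>; unique up to almost-everywhere equality of its values,
  because \<open>L\<^sup>p \<inter> L\<^sup>2\<close> is dense in \<open>L\<^sup>p\<close>.\<close>

definition chaos_projection ::
    "('h::{real_inner, complete_space} \<Rightarrow> 'w::banach) \<Rightarrow> 'w measure \<Rightarrow> nat \<Rightarrow> real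
       \<Rightarrow> ('w \<Rightarrow> real) \<Rightarrow> ('w \<Rightarrow> real)" where
  "chaos_projection \<iota> \<mu> n p = (SOME T. is_chaos_extension \<iota> \<mu> n p T)"

end

theory Submission
  imports Defs
begin

text \<open>
  The hypothesis is tested on one continuous functional \<open>\<phi> \<in> W\<^sup>*\<close> at a time. Write \<open>e \<phi> \<in> H\<close> for its
  image in \<open>H\<close>; under \<open>\<mu>\<close>, \<open>\<phi>\<close> is centred normal with variance \<open>\<parallel>e \<phi>\<parallel>\<^sup>2\<close>. Convergence of the
  densities to \<open>1\<close> in \<open>L\<^sup>1\<close> is convergence in total variation, so the characteristic functions of
  \<open>(\<phi>(X\<^sub>1) + \<dots> + \<phi>(X\<^sub>n)) / \<surd>n\<close> converge to the one of \<open>\<phi>\<close> under \<open>\<mu>\<close>. Since \<open>f \<in> L\<^sup>p\<close> and \<open>\<phi>\<close> has moments of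
  all orders, \<open>\<phi>(X\<^sub>1)\<close> has a finite variance, and comparison with the central limit theorem
  (\<open>gaussian_limit_moments\<close>) forces it to have mean \<open>0\<close> and variance \<open>\<parallel>e \<phi>\<parallel>\<^sup>2\<close>. In terms of \<open>f\<close> this
  says \<open>\<integral> f \<phi> d\<mu> = 0\<close> and \<open>\<integral> f (\<phi>\<^sup>2 - \<parallel>e \<phi>\<parallel>\<^sup>2) d\<mu> = 0\<close>: \<open>f\<close> is orthogonal to the elements of the first two
  chaoses that are built from continuous functionals.

  To conclude \<open>J\<^sub>1 f = 0\<close> and \<open>J\<^sub>2 f = 0\<close> one needs that these elements are dense in a sense that is
  compatible with the pairing of \<open>L\<^sup>p\<close> with its dual, and that \<open>J\<^sub>1\<close> and \<open>J\<^sub>2\<close> act on \<open>L\<^sup>p\<close> at all. Both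
  follow from hypercontractivity: on each of the two chaoses every even moment is bounded by a multiple of a power of the
  second moment. For the first chaos this is the formula for the moments of a normal law. For the
  second chaos (\<open>quad_moment_le\<close>) it is derived from Gaussian integration by parts
  (\<open>by_parts_mult_functional\<close>), which in turn rests only on the one-dimensional laws of
  functionals. The bounds pass to closures in \<open>L\<^sup>2\<close> by Fatou's lemma, and the locale
  \<open>hypercontractive_subspace\<close> derives the projection on \<open>L\<^sup>p\<close>, its continuity and the uniqueness of the
  extension from them.
\<close>

section \<open>Square-integrable functions\<close>

lemma Lp_space_2_iff:
  "F \<in> Lp_space M 2 \<longleftrightarrow> F \<in> borel_measurable M \<and> integrable M (\<lambda>x. (F x)\<^sup>2)"
  by (simp add: Lp_space_def)

lemma Lp_norm_2: "Lp_norm M 2 F = sqrt (LINT x|M. (F x)\<^sup>2)"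
  by (simp add: Lp_norm_def powr_half_sqrt)

lemma Lp_measurable [measurable_dest]: "F \<in> Lp_space M p \<Longrightarrow> F \<in> borel_measurable M"
  by (simp add: Lp_space_def)

lemma square_sum_le: "(x + y)\<^sup>2 \<le> 2 * x\<^sup>2 + 2 * (y::real)\<^sup>2"
  using zero_le_power2[of "x - y"] by (simp add: power2_eq_square algebra_simps)

lemma L2_mult_integrable:
  assumes "F \<in> Lp_space M 2" "G \<in> Lp_space M 2"
  shows "integrable M (\<lambda>x. F x * G x)"
proof (rule Bochner_Integration.integrable_bound)
  show "integrable M (\<lambda>x. (F x)\<^sup>2 + (G x)\<^sup>2)"
    using assms by (simp add: Lp_space_2_iff)
  show "(\<lambda>x. F x * G x) \<in> borel_measurable M"
    using assms by (auto simp: Lp_space_2_iff)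
  have "\<bar>a * b\<bar> \<le> a\<^sup>2 + b\<^sup>2" for a b :: real
  proof -
    have "2 * \<bar>a * b\<bar> \<le> a\<^sup>2 + b\<^sup>2"
      using sum_squares_bound[of "\<bar>a\<bar>" "\<bar>b\<bar>"] by (simp add: abs_mult)
    then show ?thesis
      using abs_ge_zero[of "a * b"] by linarith
  qed
  then show "AE x in M. norm (F x * G x) \<le> norm ((F x)\<^sup>2 + (G x)\<^sup>2)"
    by simp
qed

lemma L2_lincomb:
  assumes "F \<in> Lp_space M 2" "G \<in> Lp_space M 2"
  shows "(\<lambda>x. a * F x + b * G x) \<in> Lp_space M 2"
proof -
  have "(a * F x + b * G x)\<^sup>2 = a\<^sup>2 * (F x)\<^sup>2 + b\<^sup>2 * (G x)\<^sup>2 + (2 * a * b) * (F x * G x)" for x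
    by (simp add: power2_eq_square algebra_simps)
  then show ?thesis
    using assms L2_mult_integrable[OF assms] by (auto simp: Lp_space_2_iff)
qed

lemma L2_diff:
  "F \<in> Lp_space M 2 \<Longrightarrow> G \<in> Lp_space M 2 \<Longrightarrow> (\<lambda>x. F x - G x) \<in> Lp_space M 2"
  using L2_lincomb[of F M G 1 "-1"] by simp

lemma L2_add:
  "F \<in> Lp_space M 2 \<Longrightarrow> G \<in> Lp_space M 2 \<Longrightarrow> (\<lambda>x. F x + G x) \<in> Lp_space M 2"
  using L2_lincomb[of F M G 1 1] by simp

lemma L2_integral_sum_le:
  assumes "F \<in> Lp_space M 2" "G \<in> Lp_space M 2"
  shows "(LINT x|M. (F x + G x)\<^sup>2) \<le> 2 * (LINT x|M. (F x)\<^sup>2) + 2 * (LINT x|M. (G x)\<^sup>2)"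
proof -
  have "(LINT x|M. (F x + G x)\<^sup>2) \<le> (LINT x|M. 2 * (F x)\<^sup>2 + 2 * (G x)\<^sup>2)"
    using L2_add[OF assms] assms
    by (intro integral_mono square_sum_le) (simp_all add: Lp_space_2_iff)
  then show ?thesis
    using assms by (simp add: Lp_space_2_iff)
qed

lemma L2_integral_triangle_le:
  assumes "F \<in> Lp_space M 2" "G \<in> Lp_space M 2" "H \<in> Lp_space M 2"
  shows "(LINT x|M. (F x - H x)\<^sup>2)
    \<le> 2 * (LINT x|M. (F x - G x)\<^sup>2) + 2 * (LINT x|M. (G x - H x)\<^sup>2)"
  using L2_integral_sum_le[OF L2_diff[OF assms(1,2)] L2_diff[OF assms(2,3)]] by simp

lemma L2_null_AE:
  assumes "F \<in> Lp_space M 2" "(LINT x|M. (F x)\<^sup>2) = 0"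
  shows "AE x in M. F x = 0"
  using assms integral_nonneg_eq_0_iff_AE[of M "\<lambda>x. (F x)\<^sup>2"] by (simp add: Lp_space_2_iff)

lemma L2_tendsto_AE_subseq:
  assumes "\<And>n. F n \<in> Lp_space M 2" "G \<in> Lp_space M 2"
    and "(\<lambda>n. LINT x|M. (F n x - G x)\<^sup>2) \<longlonglongrightarrow> 0"
  shows "\<exists>r. strict_mono (r :: nat \<Rightarrow> nat) \<and> (AE x in M. (\<lambda>n. F (r n) x) \<longlonglongrightarrow> G x)"
proof -
  have "\<exists>r. strict_mono (r :: nat \<Rightarrow> nat) \<and> (AE x in M. (\<lambda>n. (F (r n) x - G x)\<^sup>2) \<longlonglongrightarrow> 0)"
    using assms(3) L2_diff[OF assms(1,2)] by (intro tendsto_L1_AE_subseq) (auto simp: Lp_space_2_iff)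
  then obtain r :: "nat \<Rightarrow> nat"
    where r: "strict_mono r" and lim: "AE x in M. (\<lambda>n. (F (r n) x - G x)\<^sup>2) \<longlonglongrightarrow> 0"
    by blast
  have "AE x in M. (\<lambda>n. F (r n) x) \<longlonglongrightarrow> G x"
    using lim
  proof eventually_elim
    case (elim x)
    then have "(\<lambda>n. sqrt ((F (r n) x - G x)\<^sup>2)) \<longlonglongrightarrow> sqrt 0"
      by (intro tendsto_real_sqrt)
    then show ?case
      by (simp add: LIM_zero_iff tendsto_rabs_zero_iff)
  qed
  then show ?thesis
    using r by blast
qed

text \<open>Fatou's lemma in the form in which it is used below: bounds on integrals pass to
  almost-everywhere limits, and integrability of the limit comes for free.\<close>

lemma integral_le_limit_Fatou:
  fixes g :: "nat \<Rightarrow> 'a \<Rightarrow> real"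
  assumes int: "\<And>n. integrable M (g n)" and nonneg: "\<And>n x. 0 \<le> g n x"
    and meas [measurable]: "G \<in> borel_measurable M"
    and lim: "AE x in M. (\<lambda>n. g n x) \<longlonglongrightarrow> G x"
    and bound: "\<And>n. (LINT x|M. g n x) \<le> a n" "a \<longlonglongrightarrow> c"
  shows "integrable M G" "(LINT x|M. G x) \<le> c"
proof -
  have [measurable]: "\<And>n. g n \<in> borel_measurable M"
    using int by auto
  have G_nonneg: "AE x in M. 0 \<le> G x"
    using lim by eventually_elim (rule LIMSEQ_le_const, auto simp: nonneg)
  have "0 \<le> a n" for n
    using bound(1)[of n] Bochner_Integration.integral_nonneg[of M "g n"] nonneg by (meson order_trans)
  then have c: "0 \<le> c"
    using LIMSEQ_le_const[OF bound(2)] by blast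
  have "(\<integral>\<^sup>+x. ennreal (G x) \<partial>M) = (\<integral>\<^sup>+x. liminf (\<lambda>n. ennreal (g n x)) \<partial>M)"
  proof (rule nn_integral_cong_AE, use lim in eventually_elim)
    case (elim x)
    then have "(\<lambda>n. ennreal (g n x)) \<longlonglongrightarrow> ennreal (G x)"
      by (rule tendsto_ennrealI)
    then show ?case
      by (simp add: lim_imp_Liminf)
  qed
  also have "\<dots> \<le> liminf (\<lambda>n. \<integral>\<^sup>+x. ennreal (g n x) \<partial>M)"
    by (rule nn_integral_liminf) simp
  also have "\<dots> \<le> liminf (\<lambda>n. ennreal (a n))"
    using bound(1) nonneg int
    by (intro Liminf_mono always_eventually allI) (simp add: nn_integral_eq_integral ennreal_leI)
  also have "\<dots> = ennreal c"
    using bound(2) by (intro lim_imp_Liminf tendsto_ennrealI) auto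
  finally have le: "(\<integral>\<^sup>+x. ennreal (G x) \<partial>M) \<le> ennreal c" .
  show int_G: "integrable M G"
    using le G_nonneg by (intro integrableI_nonneg) (auto simp: order.strict_trans1[OF _ ennreal_less_top])
  show "(LINT x|M. G x) \<le> c"
    using le c nn_integral_eq_integral[OF int_G G_nonneg] by (simp add: ennreal_le_iff)
qed

lemma L2_limit_Fatou:
  assumes "\<And>n. F n \<in> Lp_space M 2" "G \<in> borel_measurable M" "H \<in> Lp_space M 2"
    and "AE x in M. (\<lambda>n. F n x) \<longlonglongrightarrow> G x"
    and "\<And>n. (LINT x|M. (F n x - H x)\<^sup>2) \<le> a n" "a \<longlonglongrightarrow> c"
  shows "G \<in> Lp_space M 2" "(LINT x|M. (G x - H x)\<^sup>2) \<le> c"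
proof -
  have lim: "AE x in M. (\<lambda>n. (F n x - H x)\<^sup>2) \<longlonglongrightarrow> (G x - H x)\<^sup>2"
    using assms(4) by eventually_elim (intro tendsto_intros, assumption)
  have [measurable]: "G \<in> borel_measurable M" "H \<in> borel_measurable M"
    using assms(2,3) by (auto simp: Lp_space_2_iff)
  note Fatou = integral_le_limit_Fatou[OF _ _ _ lim assms(5,6)]
  have int: "integrable M (\<lambda>x. (G x - H x)\<^sup>2)"
    by (rule Fatou) (use L2_diff[OF assms(1,3)] in \<open>simp_all add: Lp_space_2_iff\<close>)
  show "(LINT x|M. (G x - H x)\<^sup>2) \<le> c"
    by (rule Fatou) (use L2_diff[OF assms(1,3)] in \<open>simp_all add: Lp_space_2_iff\<close>)
  have "(\<lambda>x. G x - H x) \<in> Lp_space M 2"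
    using int by (simp add: Lp_space_2_iff)
  from L2_add[OF this assms(3)] show "G \<in> Lp_space M 2"
    by simp
qed

lemma (in prob_space) L2_integrable:
  assumes "F \<in> Lp_space M 2"
  shows "integrable M F"
  using L2_mult_integrable[OF assms, of "\<lambda>_. 1"] by (simp add: Lp_space_2_iff)

text \<open>On a probability space a Cauchy sequence in \<open>L\<^sup>2\<close> is Cauchy in \<open>L\<^sup>1\<close>, so it has an
  almost-everywhere convergent subsequence; Fatou's lemma identifies the pointwise limit with the
  limit in \<open>L\<^sup>2\<close>.\<close>

lemma (in prob_space) L2_complete:
  assumes F: "\<And>n. F n \<in> Lp_space M 2"
    and Cauchy: "\<And>e. e > 0 \<Longrightarrow> \<exists>N. \<forall>m\<ge>N. \<forall>n\<ge>N. (LINT x|M. (F m x - F n x)\<^sup>2) < e"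
  shows "\<exists>G\<in>Lp_space M 2. (\<lambda>n. LINT x|M. (F n x - G x)\<^sup>2) \<longlonglongrightarrow> 0"
proof -
  have L1_Cauchy: "\<exists>N. \<forall>m\<ge>N. \<forall>n\<ge>N. (LINT x|M. norm (F m x - F n x)) < e" if "e > 0" for e
  proof -
    from that obtain N where N: "\<And>m n. m \<ge> N \<Longrightarrow> n \<ge> N \<Longrightarrow> (LINT x|M. (F m x - F n x)\<^sup>2) < e\<^sup>2"
      using Cauchy[of "e\<^sup>2"] by auto
    \<comment> \<open>The weight \<open>e\<close> in \<open>2 |y| \<le> e + y\<^sup>2 / e\<close> balances the two terms.\<close>
    have "(LINT x|M. norm (F m x - F n x)) < e" if mn: "m \<ge> N" "n \<ge> N" for m n
    proof -
      note D = L2_diff[OF F[of m] F[of n]]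
      have pt: "\<bar>y\<bar> \<le> e / 2 + y\<^sup>2 / (2 * e)" for y
        using \<open>e > 0\<close> zero_le_power2[of "\<bar>y\<bar> - e"] 
        by (simp add: field_simps power2_eq_square)
      have "(LINT x|M. norm (F m x - F n x)) \<le> (LINT x|M. e / 2 + (F m x - F n x)\<^sup>2 / (2 * e))"
        using D L2_integrable[OF D] pt
        by (intro integral_mono) (simp_all add: Lp_space_2_iff)
      also have "\<dots> = e / 2 + (LINT x|M. (F m x - F n x)\<^sup>2) / (2 * e)"
        using D by (simp add: Lp_space_2_iff prob_space)
      also have "\<dots> < e / 2 + e\<^sup>2 / (2 * e)"
        using N[OF mn] \<open>e > 0\<close> by (intro add_strict_left_mono divide_strict_right_mono) auto
      also have "\<dots> = e"
        using \<open>e > 0\<close> by (simp add: power2_eq_square)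
      finally show ?thesis .
    qed
    then show ?thesis by blast
  qed
  obtain r :: "nat \<Rightarrow> nat" where r: "strict_mono r" and conv: "AE x in M. Cauchy (\<lambda>i. F (r i) x)"
    using cauchy_L1_AE_cauchy_subseq[of M F] L1_Cauchy L2_integrable[OF F] by blast
  define G where "G x = lim (\<lambda>i. F (r i) x)" for x
  have F_meas [measurable]: "\<And>n. F n \<in> borel_measurable M"
    using F by (simp add: Lp_space_2_iff)
  have G_meas: "G \<in> borel_measurable M"
    unfolding G_def by measurable
  have lim: "AE x in M. (\<lambda>i. F (r i) x) \<longlonglongrightarrow> G x"
    using conv by eventually_elim (auto simp: G_def Cauchy_convergent_iff convergent_LIMSEQ_iff)
  have close: "\<exists>N. \<forall>n\<ge>N. G \<in> Lp_space M 2 \<and> (LINT x|M. (G x - F n x)\<^sup>2) \<le> e" if e: "e > 0" for e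
  proof -
    obtain N where N: "\<And>m n. m \<ge> N \<Longrightarrow> n \<ge> N \<Longrightarrow> (LINT x|M. (F m x - F n x)\<^sup>2) < e"
      using Cauchy[OF e] by auto
    have lim': "AE x in M. (\<lambda>i. F (r (i + N)) x) \<longlonglongrightarrow> G x"
      using lim by eventually_elim (rule LIMSEQ_ignore_initial_segment)
    have "i + N \<le> r (i + N)" for i
      using r by (rule seq_suble)
    then have "(LINT x|M. (F (r (i + N)) x - F n x)\<^sup>2) \<le> e" if "n \<ge> N" for i n
      using that N by (meson le_add2 less_imp_le order_trans)
    then show ?thesis
      using L2_limit_Fatou[OF F G_meas F lim' _ tendsto_const] by blast
  qed
  then have "G \<in> Lp_space M 2"
    using zero_less_one by blast
  moreover have "(\<lambda>n. LINT x|M. (F n x - G x)\<^sup>2) \<longlonglongrightarrow> 0"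
  proof (rule LIMSEQ_I)
    fix e :: real assume "e > 0"
    then obtain N where "\<And>n. n \<ge> N \<Longrightarrow> (LINT x|M. (G x - F n x)\<^sup>2) \<le> e / 2"
      using close[of "e / 2"] by auto
    with \<open>e > 0\<close> show "\<exists>N. \<forall>n\<ge>N. norm ((LINT x|M. (F n x - G x)\<^sup>2) - 0) < e"
      by (intro exI[of _ N]) (fastforce simp: power2_commute)
  qed
  ultimately show ?thesis by blast
qed

section \<open>Representation of bounded functionals\<close>

text \<open>The Riesz representation theorem, by minimising \<open>B x x - 2 * L x\<close>. The form \<open>B\<close> is only
  semidefinite and linear combinations are an explicit operation \<open>lc\<close>, so that the same statement
  serves the Hilbert space \<open>H\<close> and spaces of functions in which null functions are not
  identified with \<open>0\<close>.\<close>

lemma riesz_representation_form: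
  fixes V :: "'v set" and B :: "'v \<Rightarrow> 'v \<Rightarrow> real" and L :: "'v \<Rightarrow> real"
    and lc :: "real \<Rightarrow> 'v \<Rightarrow> real \<Rightarrow> 'v \<Rightarrow> 'v"
  assumes nonempty: "V \<noteq> {}"
    and closed: "\<And>a x b y. x \<in> V \<Longrightarrow> y \<in> V \<Longrightarrow> lc a x b y \<in> V"
    and B_lin: "\<And>a x b y z. x \<in> V \<Longrightarrow> y \<in> V \<Longrightarrow> z \<in> V \<Longrightarrow> B (lc a x b y) z = a * B x z + b * B y z"
    and B_sym: "\<And>x y. x \<in> V \<Longrightarrow> y \<in> V \<Longrightarrow> B x y = B y x"
    and B_pos: "\<And>x. x \<in> V \<Longrightarrow> 0 \<le> B x x"
    and L_lin: "\<And>a x b y. x \<in> V \<Longrightarrow> y \<in> V \<Longrightarrow> L (lc a x b y) = a * L x + b * L y"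
    and L_bounded: "\<And>x. x \<in> V \<Longrightarrow> L x \<le> K * sqrt (B x x)"
    and complete: "\<And>x. (\<And>n. x n \<in> V) \<Longrightarrow>
      (\<And>e. e > 0 \<Longrightarrow> \<exists>N. \<forall>m\<ge>N. \<forall>n\<ge>N. B (lc 1 (x m) (-1) (x n)) (lc 1 (x m) (-1) (x n)) < e) \<Longrightarrow>
      \<exists>g\<in>V. (\<lambda>n. B (lc 1 (x n) (-1) g) (lc 1 (x n) (-1) g)) \<longlonglongrightarrow> 0"
  shows "\<exists>g\<in>V. \<forall>v\<in>V. B g v = L v"
proof -
  define J where "J x = B x x - 2 * L x" for x
  have B_lc: "B (lc a x b y) (lc a x b y) = a\<^sup>2 * B x x + 2 * a * b * B x y + b\<^sup>2 * B y y"
    if "x \<in> V" "y \<in> V" for a x b y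
  proof -
    have "B (lc a x b y) (lc a x b y) = a * B x (lc a x b y) + b * B y (lc a x b y)"
      using that closed by (intro B_lin)
    moreover have "B x (lc a x b y) = B (lc a x b y) x" "B y (lc a x b y) = B (lc a x b y) y"
      using that closed by (auto intro: B_sym)
    ultimately have "B (lc a x b y) (lc a x b y) = a * (a * B x x + b * B y x) + b * (a * B x y + b * B y y)"
      using that by (simp add: B_lin)
    then show ?thesis
      using that by (simp add: B_lin B_sym[of y x] power2_eq_square algebra_simps)
  qed
  have J_lc: "J (lc a x b y) = a\<^sup>2 * B x x + 2 * a * b * B x y + b\<^sup>2 * B y y - 2 * a * L x - 2 * b * L y"
    if "x \<in> V" "y \<in> V" for a x b y
    using that by (simp add: J_def B_lc L_lin algebra_simps)
  have J_lower: "- K\<^sup>2 \<le> J x" if "x \<in> V" for x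
    using L_bounded[OF that] B_pos[OF that] zero_le_power2[of "sqrt (B x x) - K"]
    by (simp add: J_def power2_diff algebra_simps)
  define d where "d = Inf (J ` V)"
  have bdd: "bdd_below (J ` V)"
    using J_lower by (rule bdd_belowI2)
  have d_le: "d \<le> J x" if "x \<in> V" for x
    unfolding d_def using bdd that by (rule cINF_lower)
  have "\<exists>x\<in>V. J x < d + 1 / real (Suc n)" for n
    using cInf_lessD[of "J ` V" "d + 1 / real (Suc n)"] nonempty unfolding d_def[symmetric] by auto
  then obtain x where x: "\<And>n. x n \<in> V" and Jx: "\<And>n. J (x n) < d + 1 / real (Suc n)"
    by metis
  \<comment> \<open>The parallelogram identity forces a minimising sequence to be a Cauchy sequence.\<close>
  have dist: "B (lc 1 (x m) (-1) (x n)) (lc 1 (x m) (-1) (x n)) \<le> 2 / real (Suc m) + 2 / real (Suc n)" for m n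
  proof -
    have "d \<le> J (lc (1/2) (x m) (1/2) (x n))"
      using x by (intro d_le closed)
    then have "B (lc 1 (x m) (-1) (x n)) (lc 1 (x m) (-1) (x n)) \<le> 2 * J (x m) + 2 * J (x n) - 4 * d"
      using x by (simp add: J_lc[OF x x] B_lc[OF x x] power_divide J_def[of "x _"] field_simps)
    then show ?thesis
      using Jx[of m] Jx[of n] by simp
  qed
  obtain g where g: "g \<in> V" and lim: "(\<lambda>n. B (lc 1 (x n) (-1) g) (lc 1 (x n) (-1) g)) \<longlonglongrightarrow> 0"
  proof (atomize_elim, unfold Bex_def[symmetric], rule complete[OF x])
    fix e :: real assume "e > 0"
    obtain N where N: "4 / e < real N"
      using reals_Archimedean2[of "4 / e"] by blast
    have "2 / real (Suc m) < e / 2" if "m \<ge> N" for m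
    proof -
      have "4 / e < real (Suc m)"
        using N that by linarith
      then show ?thesis
        using \<open>e > 0\<close> by (simp add: field_simps)
    qed
    then have "2 / real (Suc m) + 2 / real (Suc n) < e" if "m \<ge> N" "n \<ge> N" for m n
      using that by (smt (verit) field_sum_of_halves)
    then show "\<exists>N. \<forall>m\<ge>N. \<forall>n\<ge>N. B (lc 1 (x m) (-1) (x n)) (lc 1 (x m) (-1) (x n)) < e"
      using dist by (meson le_less_trans)
  qed
  have Cauchy_Schwarz: "(B y z)\<^sup>2 \<le> B y y * B z z" if "y \<in> V" "z \<in> V" for y z
  proof -
    have *: "0 \<le> a\<^sup>2 * B y y + 2 * a * b * B y z + b\<^sup>2 * B z z" for a b
      using B_pos[OF closed[OF that, of a b]] B_lc[OF that] by simp
    show ?thesis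
    proof (cases "B z z = 0")
      case True
      have "B y z = 0"
      proof (rule ccontr)
        assume nz: "B y z \<noteq> 0"
        have "0 \<le> B y y + 2 * (- (B y y + 1) / (2 * B y z)) * B y z"
          using *[of 1 "- (B y y + 1) / (2 * B y z)"] True by simp
        moreover have "2 * (- (B y y + 1) / (2 * B y z)) * B y z = - (B y y + 1)"
          using nz by (simp add: field_simps)
        ultimately show False by linarith
      qed
      then show ?thesis using True by simp
    next
      case False
      then have pos: "B z z > 0" using B_pos[OF that(2)] by simp
      have "0 \<le> B z z * (B y y * B z z - (B y z)\<^sup>2)"
        using *[of "B z z" "- B y z"] by (simp add: power2_eq_square algebra_simps)
      then show ?thesis using pos by (simp add: zero_le_mult_iff)
    qed
  qed
  have "B g v = L v" if v: "v \<in> V" for v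
  proof -
    have lim_v: "(\<lambda>n. B (x n) v) \<longlonglongrightarrow> B g v"
    proof -
      have "(\<lambda>n. (B (x n) v - B g v)\<^sup>2) \<longlonglongrightarrow> 0"
      proof (rule tendsto_sandwich[OF always_eventually always_eventually tendsto_const])
        show "(\<lambda>n. B (lc 1 (x n) (-1) g) (lc 1 (x n) (-1) g) * B v v) \<longlonglongrightarrow> 0"
          using tendsto_mult_left_zero[OF lim] .
        show "\<forall>n. (B (x n) v - B g v)\<^sup>2 \<le> B (lc 1 (x n) (-1) g) (lc 1 (x n) (-1) g) * B v v"
        proof
          fix n
          have "B (lc 1 (x n) (-1) g) v = B (x n) v - B g v"
            using x g v by (simp add: B_lin)
          then show "(B (x n) v - B g v)\<^sup>2 \<le> B (lc 1 (x n) (-1) g) (lc 1 (x n) (-1) g) * B v v"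
            using Cauchy_Schwarz[OF closed[OF x[of n] g, of 1 "-1"] v] by simp
        qed
      qed auto
      then show ?thesis
        using tendsto_real_sqrt[of _ 0] by (fastforce simp: LIM_zero_iff tendsto_rabs_zero_iff)
    qed
    \<comment> \<open>The first variation at the minimiser, passed to the limit along the minimising sequence.\<close>
    have quadratic: "0 \<le> 2 * t * (B g v - L v) + t\<^sup>2 * B v v" for t
    proof (rule LIMSEQ_le)
      show "(\<lambda>n. - (1 / real (Suc n))) \<longlonglongrightarrow> 0"
        using tendsto_minus[OF LIMSEQ_inverse_real_of_nat] by (simp add: inverse_eq_divide)
      show "(\<lambda>n. 2 * t * (B (x n) v - L v) + t\<^sup>2 * B v v) \<longlonglongrightarrow> 2 * t * (B g v - L v) + t\<^sup>2 * B v v"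
        by (intro tendsto_intros lim_v)
      have "- (1 / real (Suc n)) \<le> 2 * t * (B (x n) v - L v) + t\<^sup>2 * B v v" for n
        using d_le[OF closed[OF x[of n] v, of 1 t]] Jx[of n] x v
        by (simp add: J_lc) (simp add: J_def algebra_simps)
      then show "\<exists>N. \<forall>n\<ge>N. - (1 / real (Suc n)) \<le> 2 * t * (B (x n) v - L v) + t\<^sup>2 * B v v"
        by blast
    qed
    have "B g v - L v = 0"
    proof (rule ccontr)
      assume nz: "B g v - L v \<noteq> 0"
      define t where "t = - (B g v - L v) / (B v v + 1)"
      have t: "t * (B v v + 1) = - (B g v - L v)"
        using B_pos[OF v] by (simp add: t_def)
      have "t \<noteq> 0"
        using t nz by auto
      have "2 * t * (B g v - L v) + t\<^sup>2 * B v v = - (t\<^sup>2 * (B v v + 2))"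
      proof -
        have "B g v - L v = - (t * (B v v + 1))"
          using t by simp
        then show ?thesis
          by (simp only:) (simp add: power2_eq_square algebra_simps)
      qed
      also have "\<dots> < 0"
        using B_pos[OF v] \<open>t \<noteq> 0\<close> by (simp add: add_nonneg_pos)
      finally show False
        using quadratic[of t] by simp
    qed
    then show ?thesis by simp
  qed
  then show ?thesis
    using g by blast
qed

section \<open>Projection onto a hypercontractive subspace\<close>

lemma Lp_norm_powr:
  assumes "p > 0"
  shows "Lp_norm M p f powr p = (LINT x|M. \<bar>f x\<bar> powr p)"
  using assms by (simp add: Lp_norm_def powr_powr)

lemma Lp_norm_nonneg: "0 \<le> Lp_norm M p f"
  by (simp add: Lp_norm_def)

lemma Lp_norm_eq_0_AE:
  assumes "p > 0" "f \<in> Lp_space M p" "Lp_norm M p f = 0"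
  shows "AE x in M. f x = 0"
  using assms Lp_norm_powr[of p M f] integral_nonneg_eq_0_iff_AE[of M "\<lambda>x. \<bar>f x\<bar> powr p"]
  by (simp add: Lp_space_def)

lemma Lp_norm_scale:
  assumes "p > 0" "a \<ge> 0"
  shows "Lp_norm M p (\<lambda>x. a * f x) = a * Lp_norm M p f"
proof -
  have "(LINT x|M. \<bar>a * f x\<bar> powr p) = a powr p * (LINT x|M. \<bar>f x\<bar> powr p)"
    using assms by (simp add: abs_mult powr_mult)
  then show ?thesis
    using assms by (simp add: Lp_norm_def powr_mult powr_powr)
qed

lemma powr_abs_sum_le:
  fixes x y p :: real
  assumes "p > 0"
  shows "\<bar>x + y\<bar> powr p \<le> 2 powr p * (\<bar>x\<bar> powr p + \<bar>y\<bar> powr p)"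
proof -
  have "\<bar>x + y\<bar> powr p \<le> (2 * max \<bar>x\<bar> \<bar>y\<bar>) powr p"
    using assms by (intro powr_mono2) auto
  also have "\<dots> = 2 powr p * max \<bar>x\<bar> \<bar>y\<bar> powr p"
    by (simp add: powr_mult)
  also have "\<dots> \<le> 2 powr p * (\<bar>x\<bar> powr p + \<bar>y\<bar> powr p)"
    by (intro mult_left_mono) (auto simp: max_def)
  finally show ?thesis .
qed

lemma Lp_add:
  assumes p: "p > 0" and f: "f \<in> Lp_space M p" and g: "g \<in> Lp_space M p"
  shows "(\<lambda>x. f x + g x) \<in> Lp_space M p"
    and "(LINT x|M. \<bar>f x + g x\<bar> powr p)
      \<le> 2 powr p * ((LINT x|M. \<bar>f x\<bar> powr p) + (LINT x|M. \<bar>g x\<bar> powr p))"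
proof -
  have [measurable]: "f \<in> borel_measurable M" "g \<in> borel_measurable M"
    using f g by (auto simp: Lp_space_def)
  have int: "integrable M (\<lambda>x. 2 powr p * (\<bar>f x\<bar> powr p + \<bar>g x\<bar> powr p))"
    using f g by (simp add: Lp_space_def)
  have "integrable M (\<lambda>x. \<bar>f x + g x\<bar> powr p)"
    by (rule Bochner_Integration.integrable_bound[OF int]) (use powr_abs_sum_le[OF p] in auto)
  then show "(\<lambda>x. f x + g x) \<in> Lp_space M p"
    by (simp add: Lp_space_def)
  have "(LINT x|M. \<bar>f x + g x\<bar> powr p) \<le> (LINT x|M. 2 powr p * (\<bar>f x\<bar> powr p + \<bar>g x\<bar> powr p))"
    by (intro integral_mono int powr_abs_sum_le p) fact
  also have "\<dots> = 2 powr p * ((LINT x|M. \<bar>f x\<bar> powr p) + (LINT x|M. \<bar>g x\<bar> powr p))"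
    using f g by (simp add: Lp_space_def)
  finally show "(LINT x|M. \<bar>f x + g x\<bar> powr p)
      \<le> 2 powr p * ((LINT x|M. \<bar>f x\<bar> powr p) + (LINT x|M. \<bar>g x\<bar> powr p))" .
qed

lemma Lp_scale:
  assumes "f \<in> Lp_space M p"
  shows "(\<lambda>x. c * f x) \<in> Lp_space M p"
  using assms by (auto simp: Lp_space_def abs_mult powr_mult)

lemma Lp_lincomb:
  assumes "p > 0" "f \<in> Lp_space M p" "g \<in> Lp_space M p"
  shows "(\<lambda>x. a * f x + b * g x) \<in> Lp_space M p"
  using assms by (intro Lp_add Lp_scale)

text \<open>Young's inequality for the exponent \<open>p\<close> and its conjugate \<open>p / (p - 1)\<close>.\<close>

lemma Lp_mult_integrable:
  assumes p: "p > 1" and f: "f \<in> Lp_space M p" and F: "F \<in> Lp_space M (p / (p - 1))"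
  shows "integrable M (\<lambda>x. f x * F x)"
    and "(LINT x|M. \<bar>f x * F x\<bar>)
      \<le> (LINT x|M. \<bar>f x\<bar> powr p) + (LINT x|M. \<bar>F x\<bar> powr (p / (p - 1)))"
proof -
  define q where "q = p / (p - 1)"
  have q: "q > 1" "1 / p + 1 / q = 1"
    using p by (auto simp: q_def field_simps)
  have [measurable]: "f \<in> borel_measurable M" "F \<in> borel_measurable M"
    using f F by (auto simp: Lp_space_def)
  have Young: "\<bar>f x * F x\<bar> \<le> \<bar>f x\<bar> powr p + \<bar>F x\<bar> powr q" for x
  proof -
    have "\<bar>f x * F x\<bar> \<le> \<bar>f x\<bar> powr p / p + \<bar>F x\<bar> powr q / q"
      using Youngs_inequality[OF p q, of "\<bar>f x\<bar>" "\<bar>F x\<bar>"] by (simp add: abs_mult)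
    also have "\<dots> \<le> \<bar>f x\<bar> powr p / 1 + \<bar>F x\<bar> powr q / 1"
      using p q by (intro add_mono divide_left_mono) auto
    finally show ?thesis by simp
  qed
  have int: "integrable M (\<lambda>x. \<bar>f x\<bar> powr p)" "integrable M (\<lambda>x. \<bar>F x\<bar> powr q)"
    using f F by (auto simp: Lp_space_def q_def)
  show *: "integrable M (\<lambda>x. f x * F x)"
  proof (rule Bochner_Integration.integrable_bound)
    show "integrable M (\<lambda>x. \<bar>f x\<bar> powr p + \<bar>F x\<bar> powr q)"
      using int by simp
    show "AE x in M. norm (f x * F x) \<le> norm (\<bar>f x\<bar> powr p + \<bar>F x\<bar> powr q)"
      using Young by (simp add: abs_mult)
  qed simp
  have "(LINT x|M. \<bar>f x * F x\<bar>) \<le> (LINT x|M. \<bar>f x\<bar> powr p + \<bar>F x\<bar> powr q)"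
    using int * Young by (intro integral_mono) auto
  then show "(LINT x|M. \<bar>f x * F x\<bar>)
      \<le> (LINT x|M. \<bar>f x\<bar> powr p) + (LINT x|M. \<bar>F x\<bar> powr (p / (p - 1)))"
    using int by (simp add: q_def)
qed

lemma powr_abs_le_even_power:
  fixes x :: real
  assumes "0 \<le> p" "p \<le> real (2 * m)"
  shows "\<bar>x\<bar> powr p \<le> 1 + x ^ (2 * m)"
proof (cases "\<bar>x\<bar> \<le> 1")
  case True
  then have "\<bar>x\<bar> powr p \<le> 1"
    using powr_mono2[of p "\<bar>x\<bar>" 1] assms by simp
  then show ?thesis
    by (smt (verit) zero_le_even_power even_mult_iff even_numeral)
next
  case False
  then have "\<bar>x\<bar> powr p \<le> \<bar>x\<bar> powr real (2 * m)"
    using assms by (intro powr_mono) auto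
  also have "\<dots> = x ^ (2 * m)"
    using False by (subst powr_realpow) (auto simp: power_even_abs)
  finally show ?thesis by simp
qed

text \<open>A closed subspace of \<open>L\<^sup>2\<close> in which the second moment controls all even moments, hence all
  norms \<open>L\<^sup>q\<close> with \<open>q < \<infinity>\<close>. Its elements can be paired with any \<open>f \<in> L\<^sup>p\<close>, \<open>p > 1\<close>. For this reason
  the equations \<open>\<integral> (f - g) F = 0\<close> that characterise the orthogonal projection \<open>g\<close> of \<open>f \<in> L\<^sup>2\<close> still
  determine \<open>g\<close> when \<open>f\<close> is merely in \<open>L\<^sup>p\<close>, and they extend the projection to a bounded operator
  on \<open>L\<^sup>p\<close>.\<close>

locale hypercontractive_subspace = prob_space M for M :: "'a measure" +
  fixes V :: "('a \<Rightarrow> real) set" and C :: "nat \<Rightarrow> real"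
  assumes subset_L2: "V \<subseteq> Lp_space M 2"
    and zero: "(\<lambda>_. 0) \<in> V"
    and lincomb: "\<And>F G a b. F \<in> V \<Longrightarrow> G \<in> V \<Longrightarrow> (\<lambda>x. a * F x + b * G x) \<in> V"
    and closed: "\<And>F. F \<in> Lp_space M 2 \<Longrightarrow>
      (\<And>e. e > 0 \<Longrightarrow> \<exists>G\<in>V. (LINT x|M. (F x - G x)\<^sup>2) < e) \<Longrightarrow> F \<in> V"
    and even_moment_integrable: "\<And>F m. F \<in> V \<Longrightarrow> integrable M (\<lambda>x. F x ^ (2 * m))"
    and even_moment_le: "\<And>F m. F \<in> V \<Longrightarrow> (LINT x|M. F x ^ (2 * m)) \<le> C m * (LINT x|M. (F x)\<^sup>2) ^ m"
begin

lemma moment_integrable: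
  assumes "F \<in> V" "0 \<le> p"
  shows "integrable M (\<lambda>x. \<bar>F x\<bar> powr p)"
proof -
  define m where "m = nat \<lceil>p\<rceil>"
  have m: "p \<le> real (2 * m)"
    using assms(2) unfolding m_def by linarith
  have [measurable]: "F \<in> borel_measurable M"
    using assms(1) subset_L2 by (auto simp: Lp_space_def)
  show ?thesis
  proof (rule Bochner_Integration.integrable_bound)
    show "integrable M (\<lambda>x. 1 + F x ^ (2 * m))"
      using even_moment_integrable[OF assms(1)] by simp
    show "AE x in M. norm (\<bar>F x\<bar> powr p) \<le> norm (1 + F x ^ (2 * m))"
      using powr_abs_le_even_power[OF assms(2) m] by (auto intro!: AE_I2 intro: order_trans)
  qed simp
qed

lemma moment_le:
  assumes "0 \<le> p"
  shows "\<exists>D\<ge>1. \<forall>F\<in>V. (LINT x|M. (F x)\<^sup>2) = 1 \<longrightarrow> (LINT x|M. \<bar>F x\<bar> powr p) \<le> D"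
proof -
  define m where "m = nat \<lceil>p\<rceil>"
  have m: "p \<le> real (2 * m)"
    using assms unfolding m_def by linarith
  have "(LINT x|M. \<bar>F x\<bar> powr p) \<le> 1 + \<bar>C m\<bar>" if F: "F \<in> V" "(LINT x|M. (F x)\<^sup>2) = 1" for F
  proof -
    have "(LINT x|M. \<bar>F x\<bar> powr p) \<le> (LINT x|M. 1 + F x ^ (2 * m))"
      using moment_integrable[OF F(1) assms] even_moment_integrable[OF F(1)]
        powr_abs_le_even_power[OF assms m]
      by (intro integral_mono) auto
    also have "\<dots> = 1 + (LINT x|M. F x ^ (2 * m))"
      using even_moment_integrable[OF F(1)] by (simp add: prob_space)
    finally show ?thesis
      using even_moment_le[OF F(1), of m] F(2) by simp
  qed
  then show ?thesis
    by (intro exI[of _ "1 + \<bar>C m\<bar>"]) auto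
qed

lemma normalize:
  assumes "F \<in> V" "Lp_norm M 2 F \<noteq> 0"
  shows "(\<lambda>x. F x / Lp_norm M 2 F) \<in> V" "(LINT x|M. (F x / Lp_norm M 2 F)\<^sup>2) = 1"
proof -
  show "(\<lambda>x. F x / Lp_norm M 2 F) \<in> V"
    using lincomb[OF assms(1) assms(1), of "1 / Lp_norm M 2 F" 0] by simp
  have "(LINT x|M. (F x / Lp_norm M 2 F)\<^sup>2) = (LINT x|M. (F x)\<^sup>2) / (Lp_norm M 2 F)\<^sup>2"
    by (simp add: power_divide)
  also have "\<dots> = 1"
    using assms(2) by (simp add: Lp_norm_2)
  finally show "(LINT x|M. (F x / Lp_norm M 2 F)\<^sup>2) = 1" .
qed

lemma in_Lp: "F \<in> V \<Longrightarrow> 0 \<le> p \<Longrightarrow> F \<in> Lp_space M p"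
  using moment_integrable subset_L2 by (auto simp: Lp_space_def)

lemma Lp_norm_le:
  assumes p: "p \<ge> 1"
  shows "\<exists>D\<ge>0. \<forall>F\<in>V. Lp_norm M p F \<le> D * Lp_norm M 2 F"
proof -
  obtain D where D: "D \<ge> 1" "\<And>F. F \<in> V \<Longrightarrow> (LINT x|M. (F x)\<^sup>2) = 1 \<Longrightarrow> (LINT x|M. \<bar>F x\<bar> powr p) \<le> D"
    using moment_le[of p] p by auto
  have "Lp_norm M p F \<le> D * Lp_norm M 2 F" if F: "F \<in> V" for F
  proof (cases "Lp_norm M 2 F = 0")
    case True
    then have "AE x in M. F x = 0"
      using Lp_norm_eq_0_AE[of 2 F M] subset_L2 F by auto
    then have "(LINT x|M. \<bar>F x\<bar> powr p) = (LINT x|M. 0)"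
      using F subset_L2 by (intro integral_cong_AE) (auto simp: Lp_space_def)
    then show ?thesis
      using True by (simp add: Lp_norm_def)
  next
    case False
    define b where "b = Lp_norm M 2 F"
    have b: "b > 0"
      using False Lp_norm_nonneg[of M 2 F] by (simp add: b_def)
    have "Lp_norm M p (\<lambda>x. F x / b) \<le> D powr (1 / p)"
      using D(2)[OF normalize[OF F False]] p
      unfolding Lp_norm_def[of M p] b_def by (intro powr_mono2) auto
    also have "\<dots> \<le> D powr 1"
      using D(1) p by (intro powr_mono) auto
    finally have "Lp_norm M p (\<lambda>x. F x / b) \<le> D"
      using D(1) by simp
    moreover have "Lp_norm M p F = b * Lp_norm M p (\<lambda>x. F x / b)"
      using Lp_norm_scale[of p b M "\<lambda>x. F x / b"] b p by simp
    ultimately show ?thesis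
      using b by (simp add: b_def mult.commute)
  qed
  then show ?thesis
    using D(1) by (intro exI[of _ D]) auto
qed

lemma pairing_integrable:
  assumes p: "p > 1" and f: "f \<in> Lp_space M p" and F: "F \<in> V"
  shows "integrable M (\<lambda>x. f x * F x)"
    and "(LINT x|M. \<bar>f x * F x\<bar>)
      \<le> (LINT x|M. \<bar>f x\<bar> powr p) + (LINT x|M. \<bar>F x\<bar> powr (p / (p - 1)))"
  using Lp_mult_integrable[OF p f in_Lp[OF F]] p by auto

text \<open>Hoelder's inequality combined with the equivalence of norms on \<open>V\<close>; it follows from Young's
  inequality by normalising both factors.\<close>

lemma pairing_le:
  assumes p: "p > 1"
  shows "\<exists>D\<ge>0. \<forall>f\<in>Lp_space M p. \<forall>F\<in>V. \<bar>LINT x|M. f x * F x\<bar> \<le> D * Lp_norm M p f * Lp_norm M 2 F"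
proof -
  obtain D where D: "D \<ge> 1"
    "\<And>F. F \<in> V \<Longrightarrow> (LINT x|M. (F x)\<^sup>2) = 1 \<Longrightarrow> (LINT x|M. \<bar>F x\<bar> powr (p / (p - 1))) \<le> D"
    using moment_le[of "p / (p - 1)"] p by auto
  have "\<bar>LINT x|M. f x * F x\<bar> \<le> (1 + D) * Lp_norm M p f * Lp_norm M 2 F"
    if f: "f \<in> Lp_space M p" and F: "F \<in> V" for f F
  proof (cases "Lp_norm M p f = 0 \<or> Lp_norm M 2 F = 0")
    case True
    then have "(AE x in M. f x = 0) \<or> (AE x in M. F x = 0)"
      using Lp_norm_eq_0_AE[of p f M] Lp_norm_eq_0_AE[of 2 F M] p f F subset_L2 by auto
    then have "AE x in M. f x * F x = 0"
      by auto
    then have "(LINT x|M. f x * F x) = (LINT x|M. 0)"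
      using f F subset_L2 by (intro integral_cong_AE) (auto simp: Lp_space_def)
    then show ?thesis
      using True by auto
  next
    case False
    define a b where "a = Lp_norm M p f" and "b = Lp_norm M 2 F"
    have pos: "a > 0" "b > 0"
      using False Lp_norm_nonneg[of M 2 F] Lp_norm_nonneg[of M p f] by (auto simp: a_def b_def)
    have f': "(\<lambda>x. f x / a) \<in> Lp_space M p"
      using Lp_scale[OF f, of "1 / a"] by simp
    have "Lp_norm M p (\<lambda>x. f x / a) = 1"
      using Lp_norm_scale[of p "1 / a" M f] pos p by (simp add: a_def)
    then have norm_f: "(LINT x|M. \<bar>f x / a\<bar> powr p) = 1"
      using Lp_norm_powr[of p M "\<lambda>x. f x / a"] p by simp
    have F': "(\<lambda>x. F x / b) \<in> V" "(LINT x|M. (F x / b)\<^sup>2) = 1"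
      using normalize[OF F] False by (auto simp: b_def)
    have "\<bar>LINT x|M. f x / a * (F x / b)\<bar> \<le> (LINT x|M. \<bar>f x / a * (F x / b)\<bar>)"
      using integral_norm_bound[of M "\<lambda>x. f x / a * (F x / b)"] by simp
    also have "\<dots> \<le> 1 + D"
      using pairing_integrable(2)[OF p f' F'(1)] D(2)[OF F'] norm_f by linarith
    also have "(LINT x|M. f x / a * (F x / b)) = (LINT x|M. f x * F x) / (a * b)"
      by simp
    finally have "\<bar>LINT x|M. f x * F x\<bar> / (a * b) \<le> 1 + D"
      using pos by (simp add: abs_mult)
    then show ?thesis
      using pos by (simp add: pos_divide_le_eq a_def[symmetric] b_def[symmetric] mult.assoc)
  qed
  then show ?thesis
    using D(1) by (intro exI[of _ "1 + D"]) auto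
qed

lemma exists_projection:
  assumes p: "p > 1" and f: "f \<in> Lp_space M p"
  shows "\<exists>g\<in>V. \<forall>F\<in>V. (LINT x|M. (f x - g x) * F x) = 0"
proof -
  obtain D where D: "\<And>F. F \<in> V \<Longrightarrow> \<bar>LINT x|M. f x * F x\<bar> \<le> D * Lp_norm M p f * Lp_norm M 2 F"
    using pairing_le[OF p] f by blast
  note int = L2_mult_integrable[OF subsetD[OF subset_L2] subsetD[OF subset_L2]]
  have "\<exists>g\<in>V. \<forall>F\<in>V. (LINT x|M. g x * F x) = (LINT x|M. f x * F x)"
  proof (rule riesz_representation_form[where lc = "\<lambda>a F b G x. a * F x + b * G x"
        and K = "D * Lp_norm M p f"])
    show "V \<noteq> {}"
      using zero by blast
    show "(\<lambda>x. a * F x + b * G x) \<in> V" if "F \<in> V" "G \<in> V" for F G a b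
      using that by (rule lincomb)
    show "(LINT x|M. (a * F x + b * G x) * H x) = a * (LINT x|M. F x * H x) + b * (LINT x|M. G x * H x)"
      if "F \<in> V" "G \<in> V" "H \<in> V" for F G H a b
      using int[of F H] int[of G H] that by (simp add: algebra_simps)
    show "(LINT x|M. F x * G x) = (LINT x|M. G x * F x)" if "F \<in> V" "G \<in> V" for F G
      by (simp add: mult.commute)
    show "0 \<le> (LINT x|M. F x * F x)" if "F \<in> V" for F
      by (intro Bochner_Integration.integral_nonneg) simp
    show "(LINT x|M. f x * (a * F x + b * G x)) = a * (LINT x|M. f x * F x) + b * (LINT x|M. f x * G x)"
      if "F \<in> V" "G \<in> V" for F G a b
      using pairing_integrable(1)[OF p f, of F] pairing_integrable(1)[OF p f, of G] that
      by (simp add: algebra_simps)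
    show "(LINT x|M. f x * F x) \<le> D * Lp_norm M p f * sqrt (LINT x|M. F x * F x)" if "F \<in> V" for F
      using D[OF that] by (simp add: Lp_norm_2 power2_eq_square)
  next
    fix F :: "nat \<Rightarrow> 'a \<Rightarrow> real"
    assume F: "\<And>n. F n \<in> V" and Cauchy: "\<And>e. e > 0 \<Longrightarrow> \<exists>N. \<forall>m\<ge>N. \<forall>n\<ge>N.
      (LINT x|M. (1 * F m x + - 1 * F n x) * (1 * F m x + - 1 * F n x)) < e"
    have "\<exists>G\<in>Lp_space M 2. (\<lambda>n. LINT x|M. (F n x - G x)\<^sup>2) \<longlonglongrightarrow> 0"
      using F Cauchy subset_L2 by (intro L2_complete) (auto simp: power2_eq_square)
    then obtain G where G: "G \<in> Lp_space M 2" and lim: "(\<lambda>n. LINT x|M. (F n x - G x)\<^sup>2) \<longlonglongrightarrow> 0"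
      by blast
    have "G \<in> V"
    proof (rule closed[OF G])
      fix e :: real assume "e > 0"
      then have "\<forall>\<^sub>F n in sequentially. (LINT x|M. (F n x - G x)\<^sup>2) < e"
        by (rule order_tendstoD(2)[OF lim])
      then obtain n where "(LINT x|M. (F n x - G x)\<^sup>2) < e"
        by (meson eventually_sequentially order_refl)
      then show "\<exists>H\<in>V. (LINT x|M. (G x - H x)\<^sup>2) < e"
        using F by (intro bexI[of _ "F n"]) (auto simp: power2_commute)
    qed
    then show "\<exists>g\<in>V. (\<lambda>n. LINT x|M. (1 * F n x + - 1 * g x) * (1 * F n x + - 1 * g x)) \<longlonglongrightarrow> 0"
      using lim by (intro bexI[of _ G]) (simp_all add: power2_eq_square)
  qed
  then obtain g where g: "g \<in> V" "\<And>F. F \<in> V \<Longrightarrow> (LINT x|M. g x * F x) = (LINT x|M. f x * F x)"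
    by blast
  have "(LINT x|M. (f x - g x) * F x) = 0" if "F \<in> V" for F
    using g that pairing_integrable(1)[OF p f that] int[OF g(1) that] by (simp add: left_diff_distrib)
  with g(1) show ?thesis by blast
qed

definition proj :: "('a \<Rightarrow> real) \<Rightarrow> 'a \<Rightarrow> real" where
  "proj f = (SOME g. g \<in> V \<and> (\<forall>F\<in>V. (LINT x|M. (f x - g x) * F x) = 0))"

lemma
  assumes "p > 1" "f \<in> Lp_space M p"
  shows proj_in: "proj f \<in> V"
    and proj_orthogonal: "F \<in> V \<Longrightarrow> (LINT x|M. (f x - proj f x) * F x) = 0"
proof -
  have "\<exists>g. g \<in> V \<and> (\<forall>F\<in>V. (LINT x|M. (f x - g x) * F x) = 0)"
    using exists_projection[OF assms] by blast
  from someI_ex[OF this]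
  show "proj f \<in> V" "F \<in> V \<Longrightarrow> (LINT x|M. (f x - proj f x) * F x) = 0"
    by (auto simp: proj_def)
qed

lemma proj_pairing:
  assumes "p > 1" "f \<in> Lp_space M p" "F \<in> V"
  shows "(LINT x|M. proj f x * F x) = (LINT x|M. f x * F x)"
proof -
  have "integrable M (\<lambda>x. proj f x * F x)"
    using L2_mult_integrable proj_in[OF assms(1,2)] assms(3) subset_L2 by blast
  then show ?thesis
    using proj_orthogonal[OF assms] pairing_integrable(1)[OF assms] by (simp add: left_diff_distrib)
qed

lemma proj_unique:
  assumes p: "p > 1" and f: "f \<in> Lp_space M p" and g: "g \<in> V"
    and eq: "\<And>F. F \<in> V \<Longrightarrow> (LINT x|M. g x * F x) = (LINT x|M. f x * F x)"
  shows "AE x in M. proj f x = g x"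
proof -
  define d where "d x = proj f x - g x" for x
  have d: "d \<in> V"
    using lincomb[OF proj_in[OF p f] g, of 1 "-1"] unfolding d_def by simp
  have L2: "d \<in> Lp_space M 2" "g \<in> Lp_space M 2" "proj f \<in> Lp_space M 2"
    using d g proj_in[OF p f] subset_L2 by auto
  have "(LINT x|M. (d x)\<^sup>2) = (LINT x|M. proj f x * d x - g x * d x)"
    by (simp add: d_def power2_eq_square algebra_simps)
  also have "\<dots> = 0"
    using L2_mult_integrable[OF L2(3,1)] L2_mult_integrable[OF L2(2,1)] eq[OF d]
      proj_pairing[OF p f d] by simp
  finally show ?thesis
    using L2_null_AE[OF L2(1)] by (simp add: d_def)
qed

lemma proj_lincomb:
  assumes p: "p > 1" and f: "f \<in> Lp_space M p" and g: "g \<in> Lp_space M p"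
  shows "AE x in M. proj (\<lambda>x. a * f x + b * g x) x = a * proj f x + b * proj g x"
proof (rule proj_unique[OF p])
  show "(\<lambda>x. a * f x + b * g x) \<in> Lp_space M p"
    using p f g by (intro Lp_lincomb) auto
  show "(\<lambda>x. a * proj f x + b * proj g x) \<in> V"
    using lincomb proj_in[OF p] f g by blast
  fix F assume F: "F \<in> V"
  have int: "integrable M (\<lambda>x. proj f x * F x)" "integrable M (\<lambda>x. proj g x * F x)"
    using L2_mult_integrable proj_in[OF p] f g F subset_L2 by blast+
  have "(LINT x|M. (a * proj f x + b * proj g x) * F x)
      = a * (LINT x|M. proj f x * F x) + b * (LINT x|M. proj g x * F x)"
    using int by (simp add: distrib_right mult.assoc)
  also have "\<dots> = (LINT x|M. (a * f x + b * g x) * F x)"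
    using pairing_integrable(1)[OF p f F] pairing_integrable(1)[OF p g F]
    by (simp add: proj_pairing[OF p _ F] f g distrib_right mult.assoc)
  finally show "(LINT x|M. (a * proj f x + b * proj g x) * F x) = (LINT x|M. (a * f x + b * g x) * F x)" .
qed

text \<open>Testing the projection \<open>g\<close> of \<open>f\<close> against itself gives
  \<open>\<parallel>g\<parallel>\<^sub>2\<^sup>2 = \<integral> f g \<le> D \<parallel>f\<parallel>\<^sub>p \<parallel>g\<parallel>\<^sub>2\<close>; this bounds \<open>\<parallel>g\<parallel>\<^sub>2\<close>, and thereby \<open>\<parallel>g\<parallel>\<^sub>p\<close>, for every \<open>p > 1\<close>, without a
  distinction between \<open>p < 2\<close> and \<open>p \<ge> 2\<close>.\<close>

lemma proj_bounded:
  assumes p: "p > 1"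
  shows "\<exists>D. \<forall>f\<in>Lp_space M p. Lp_norm M p (proj f) \<le> D * Lp_norm M p f"
proof -
  obtain D1 where D1: "D1 \<ge> 0" "\<And>f F. f \<in> Lp_space M p \<Longrightarrow> F \<in> V \<Longrightarrow>
      \<bar>LINT x|M. f x * F x\<bar> \<le> D1 * Lp_norm M p f * Lp_norm M 2 F"
    using pairing_le[OF p] by blast
  obtain D2 where D2: "D2 \<ge> 0" "\<And>F. F \<in> V \<Longrightarrow> Lp_norm M p F \<le> D2 * Lp_norm M 2 F"
    using Lp_norm_le[of p] p by auto
  have "Lp_norm M p (proj f) \<le> D2 * D1 * Lp_norm M p f" if f: "f \<in> Lp_space M p" for f
  proof -
    note g = proj_in[OF p f]
    have "(Lp_norm M 2 (proj f))\<^sup>2 = (LINT x|M. proj f x * proj f x)"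
      by (simp add: Lp_norm_2 power2_eq_square)
    also have "\<dots> \<le> D1 * Lp_norm M p f * Lp_norm M 2 (proj f)"
      using proj_pairing[OF p f g] D1(2)[OF f g] by simp
    finally have "Lp_norm M 2 (proj f) * Lp_norm M 2 (proj f) \<le> (D1 * Lp_norm M p f) * Lp_norm M 2 (proj f)"
      by (simp add: power2_eq_square)
    then have "Lp_norm M 2 (proj f) \<le> D1 * Lp_norm M p f"
      using Lp_norm_nonneg[of M 2 "proj f"] Lp_norm_nonneg[of M p f] D1(1)
      by (cases "Lp_norm M 2 (proj f) = 0") (auto simp: mult_le_cancel_right)
    then show ?thesis
      using D2(2)[OF g] D2(1) by (metis mult.assoc mult_left_mono order_trans)
  qed
  then show ?thesis by blast
qed

text \<open>Truncations of \<open>f\<close> lie in \<open>L\<^sup>p \<inter> L\<^sup>2\<close> and converge to \<open>f\<close> in \<open>L\<^sup>p\<close>. A bounded extension \<open>T\<close> of the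
  projection therefore agrees with \<open>proj\<close>, and \<open>proj f\<close> vanishes when \<open>f\<close> is orthogonal to \<open>V\<close>.\<close>

lemma extension_unique_zero:
  assumes p: "p > 1" and f: "f \<in> Lp_space M p"
    and orth: "\<And>F. F \<in> V \<Longrightarrow> (LINT x|M. f x * F x) = 0"
    and T_Lp: "\<And>f. f \<in> Lp_space M p \<Longrightarrow> T f \<in> Lp_space M p"
    and T_lin: "\<And>f g a b. f \<in> Lp_space M p \<Longrightarrow> g \<in> Lp_space M p \<Longrightarrow>
      AE x in M. T (\<lambda>x. a * f x + b * g x) x = a * T f x + b * T g x"
    and T_bounded: "\<And>f. f \<in> Lp_space M p \<Longrightarrow> Lp_norm M p (T f) \<le> C' * Lp_norm M p f"
    and T_proj: "\<And>f. f \<in> Lp_space M p \<Longrightarrow> f \<in> Lp_space M 2 \<Longrightarrow> AE x in M. T f x = proj f x"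
  shows "AE x in M. T f x = 0"
proof -
  obtain D where D: "\<And>f. f \<in> Lp_space M p \<Longrightarrow> Lp_norm M p (proj f) \<le> D * Lp_norm M p f"
    using proj_bounded[OF p] by blast
  have powr_bound: "(LINT x|M. \<bar>S h x\<bar> powr p) \<le> \<bar>K\<bar> powr p * (LINT x|M. \<bar>h x\<bar> powr p)"
    if "Lp_norm M p (S h) \<le> K * Lp_norm M p h" for S h K
  proof -
    have "Lp_norm M p (S h) powr p \<le> (\<bar>K\<bar> * Lp_norm M p h) powr p"
      using that p mult_right_mono[OF abs_ge_self[of K] Lp_norm_nonneg[of M p h]]
      by (intro powr_mono2) (auto simp: Lp_norm_nonneg)
    then show ?thesis
      using p by (simp add: powr_mult Lp_norm_nonneg Lp_norm_powr)
  qed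
  have [measurable]: "f \<in> borel_measurable M"
    using f by (simp add: Lp_space_def)
  have int_f: "integrable M (\<lambda>x. \<bar>f x\<bar> powr p)"
    using f by (simp add: Lp_space_def)
  \<comment> \<open>The truncation \<open>t k\<close> of \<open>f\<close> at height \<open>k\<close>, and the remainder \<open>r k\<close>.\<close>
  define t where "t k x = (if \<bar>f x\<bar> \<le> real k then f x else 0)" for k x
  define r where "r k x = f x - t k x" for k x
  have [measurable]: "t k \<in> borel_measurable M" for k
    unfolding t_def[abs_def] by measurable
  have t_Lp: "t k \<in> Lp_space M p" for k
    unfolding Lp_space_def using p
    by (auto intro!: Bochner_Integration.integrable_bound[OF int_f] simp: t_def)
  have t_L2: "t k \<in> Lp_space M 2" for k
    unfolding Lp_space_2_iff
  proof
    show "integrable M (\<lambda>x. (t k x)\<^sup>2)"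
      by (rule Bochner_Integration.integrable_bound[of M "\<lambda>_. (real k)\<^sup>2"])
        (auto simp: t_def abs_le_square_iff[symmetric])
  qed simp
  have r_Lp: "r k \<in> Lp_space M p" for k
    using Lp_lincomb[OF _ f t_Lp, of 1 "-1"] p unfolding r_def[abs_def] by simp
  have r_lim: "(\<lambda>k. LINT x|M. \<bar>r k x\<bar> powr p) \<longlonglongrightarrow> (LINT x|M. 0)"
  proof (rule integral_dominated_convergence[where w = "\<lambda>x. \<bar>f x\<bar> powr p"])
    show "AE x in M. (\<lambda>k. \<bar>r k x\<bar> powr p) \<longlonglongrightarrow> 0"
    proof (rule AE_I2)
      fix x
      obtain N where N: "\<bar>f x\<bar> \<le> real N"
        using real_arch_simple by blast
      have "\<forall>\<^sub>F k in sequentially. \<bar>r k x\<bar> powr p = 0"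
        using eventually_ge_at_top[of N] by eventually_elim (use N in \<open>auto simp: r_def t_def\<close>)
      then show "(\<lambda>k. \<bar>r k x\<bar> powr p) \<longlonglongrightarrow> 0"
        by (rule tendsto_eventually)
    qed
    show "AE x in M. norm (\<bar>r k x\<bar> powr p) \<le> \<bar>f x\<bar> powr p" for k
      using p by (auto simp: r_def t_def)
  qed (use int_f in \<open>auto simp: r_def\<close>)
  have proj_zero: "AE x in M. proj f x = 0"
    using proj_unique[OF p f zero] orth by simp
  define K where "K = 2 powr p * (\<bar>C'\<bar> powr p + \<bar>D\<bar> powr p)"
  have bound: "(LINT x|M. \<bar>T f x\<bar> powr p) \<le> K * (LINT x|M. \<bar>r k x\<bar> powr p)" for k
  proof -
    have split: "(\<lambda>x. 1 * r k x + 1 * t k x) = f"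
      by (simp add: r_def)
    have "AE x in M. T f x = T (r k) x + - 1 * proj (r k) x"
      using T_lin[OF r_Lp[of k] t_Lp[of k], of 1 1] proj_lincomb[OF p r_Lp[of k] t_Lp[of k], of 1 1]
        T_proj[OF t_Lp[of k] t_L2[of k]] proj_zero
      unfolding split by eventually_elim simp
    then have "(LINT x|M. \<bar>T f x\<bar> powr p) = (LINT x|M. \<bar>T (r k) x + - 1 * proj (r k) x\<bar> powr p)"
      using T_Lp[OF f] T_Lp[OF r_Lp[of k]] in_Lp[OF proj_in[OF p r_Lp[of k]], of p] p
      by (intro integral_cong_AE) (auto simp: Lp_space_def)
    also have "\<dots> \<le> 2 powr p * ((LINT x|M. \<bar>T (r k) x\<bar> powr p) + (LINT x|M. \<bar>- 1 * proj (r k) x\<bar> powr p))"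
      using p T_Lp[OF r_Lp[of k]] in_Lp[OF proj_in[OF p r_Lp[of k]], of p]
      by (intro Lp_add Lp_scale) auto
    also have "\<dots> \<le> 2 powr p * (\<bar>C'\<bar> powr p * (LINT x|M. \<bar>r k x\<bar> powr p) + \<bar>D\<bar> powr p * (LINT x|M. \<bar>r k x\<bar> powr p))"
      using powr_bound[of T "r k" C', OF T_bounded[OF r_Lp]] powr_bound[of proj "r k" D, OF D[OF r_Lp]]
      by (intro mult_left_mono add_mono) auto
    finally show ?thesis
      by (simp add: K_def algebra_simps)
  qed
  have "(LINT x|M. \<bar>T f x\<bar> powr p) \<le> K * 0"
    using r_lim bound by (intro LIMSEQ_le_const[OF tendsto_mult_left]) auto
  moreover have "0 \<le> (LINT x|M. \<bar>T f x\<bar> powr p)"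
    by simp
  ultimately have "Lp_norm M p (T f) = 0"
    by (simp add: Lp_norm_def)
  then show ?thesis
    using T_Lp[OF f] p by (intro Lp_norm_eq_0_AE[of p]) auto
qed

end

section \<open>Functions with moments of all orders\<close>

definition all_moments :: "'a measure \<Rightarrow> ('a \<Rightarrow> real) \<Rightarrow> bool" where
  "all_moments M G \<longleftrightarrow> G \<in> borel_measurable M \<and> (\<forall>k::nat. integrable M (\<lambda>x. \<bar>G x\<bar> ^ k))"

lemma all_moments_measurable [measurable_dest]: "all_moments M G \<Longrightarrow> G \<in> borel_measurable M"
  by (simp add: all_moments_def)

lemma all_moments_integrable_power:
  "all_moments M G \<Longrightarrow> integrable M (\<lambda>x. \<bar>G x\<bar> ^ k)"
  by (simp add: all_moments_def)

lemma all_moments_integrable: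
  assumes "all_moments M G"
  shows "integrable M G"
  using all_moments_integrable_power[OF assms, of 1] all_moments_measurable[OF assms]
    integrable_abs_cancel[of M G]
  by (simp only: power_one_right)

lemma all_moments_L2:
  assumes "all_moments M G"
  shows "G \<in> Lp_space M 2"
  using all_moments_integrable_power[OF assms, of 2] all_moments_measurable[OF assms]
  by (simp add: Lp_space_2_iff)

lemma all_moments_mult:
  assumes "all_moments M F" "all_moments M G"
  shows "all_moments M (\<lambda>x. F x * G x)"
  unfolding all_moments_def
proof (intro conjI allI)
  note [measurable] = assms[THEN all_moments_measurable]
  show "(\<lambda>x. F x * G x) \<in> borel_measurable M"
    by measurable
  fix k :: nat
  show "integrable M (\<lambda>x. \<bar>F x * G x\<bar> ^ k)"
  proof (rule Bochner_Integration.integrable_bound)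
    show "integrable M (\<lambda>x. \<bar>F x\<bar> ^ (2 * k) + \<bar>G x\<bar> ^ (2 * k))"
      using assms by (simp add: all_moments_def)
    have "a * b \<le> a\<^sup>2 + b\<^sup>2" if "a \<ge> 0" "b \<ge> 0" for a b :: real
      using sum_squares_bound[of a b] mult_nonneg_nonneg[OF that] by linarith
    from this[of "\<bar>F x\<bar> ^ k" "\<bar>G x\<bar> ^ k" for x]
    show "AE x in M. norm (\<bar>F x * G x\<bar> ^ k) \<le> norm (\<bar>F x\<bar> ^ (2 * k) + \<bar>G x\<bar> ^ (2 * k))"
      by (simp add: abs_mult power_mult_distrib power_mult[symmetric] mult.commute)
  qed measurable
qed

lemma all_moments_add:
  assumes "all_moments M F" "all_moments M G"
  shows "all_moments M (\<lambda>x. F x + G x)"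
  unfolding all_moments_def
proof (intro conjI allI)
  note [measurable] = assms[THEN all_moments_measurable]
  show "(\<lambda>x. F x + G x) \<in> borel_measurable M"
    by measurable
  fix k :: nat
  show "integrable M (\<lambda>x. \<bar>F x + G x\<bar> ^ k)"
  proof (rule Bochner_Integration.integrable_bound)
    show "integrable M (\<lambda>x. 2 ^ k * (\<bar>F x\<bar> ^ k + \<bar>G x\<bar> ^ k))"
      using assms by (simp add: all_moments_def)
    have "\<bar>a + b\<bar> ^ k \<le> 2 ^ k * (\<bar>a\<bar> ^ k + \<bar>b\<bar> ^ k)" for a b :: real
    proof -
      have "\<bar>a + b\<bar> ^ k \<le> (2 * max \<bar>a\<bar> \<bar>b\<bar>) ^ k"
        by (intro power_mono) auto
      also have "\<dots> = 2 ^ k * max \<bar>a\<bar> \<bar>b\<bar> ^ k"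
        by (simp add: power_mult_distrib)
      also have "\<dots> \<le> 2 ^ k * (\<bar>a\<bar> ^ k + \<bar>b\<bar> ^ k)"
        by (intro mult_left_mono) (auto simp: max_def)
      finally show ?thesis .
    qed
    then show "AE x in M. norm (\<bar>F x + G x\<bar> ^ k) \<le> norm (2 ^ k * (\<bar>F x\<bar> ^ k + \<bar>G x\<bar> ^ k))"
      by (auto simp: abs_mult power_abs)
  qed measurable
qed

lemma (in finite_measure) all_moments_const: "all_moments M (\<lambda>_. c)"
  by (simp add: all_moments_def)

lemma (in finite_measure) all_moments_sum:
  "(\<And>i. i \<in> I \<Longrightarrow> all_moments M (F i)) \<Longrightarrow> all_moments M (\<lambda>x. \<Sum>i\<in>I. F i x)"
  by (induction I rule: infinite_finite_induct) (simp_all add: all_moments_const all_moments_add)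

lemma (in finite_measure) all_moments_power:
  "all_moments M F \<Longrightarrow> all_moments M (\<lambda>x. F x ^ n)"
  by (induction n) (simp_all add: all_moments_const all_moments_mult)

lemma (in finite_measure) all_moments_scale:
  "all_moments M F \<Longrightarrow> all_moments M (\<lambda>x. c * F x)"
  by (intro all_moments_mult all_moments_const)

lemma (in finite_measure) all_moments_diff:
  assumes "all_moments M F" "all_moments M G"
  shows "all_moments M (\<lambda>x. F x - G x)"
  using all_moments_add[OF assms(1) all_moments_scale[OF assms(2), of "-1"]] by simp

lemma (in finite_measure) all_moments_Lp:
  assumes "all_moments M G" "0 \<le> p"
  shows "G \<in> Lp_space M p"
proof -
  define m where "m = nat \<lceil>p\<rceil>"
  have m: "p \<le> real (2 * m)"
    using assms(2) unfolding m_def by linarith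
  note [measurable] = all_moments_measurable[OF assms(1)]
  have "integrable M (\<lambda>x. \<bar>G x\<bar> powr p)"
  proof (rule Bochner_Integration.integrable_bound)
    show "integrable M (\<lambda>x. 1 + G x ^ (2 * m))"
      using all_moments_integrable[OF all_moments_power[OF assms(1)], of "2 * m"] by simp
    show "AE x in M. norm (\<bar>G x\<bar> powr p) \<le> norm (1 + G x ^ (2 * m))"
      using powr_abs_le_even_power[OF assms(2) m] by (auto intro!: AE_I2 intro: order_trans)
  qed measurable
  then show ?thesis
    by (simp add: Lp_space_def)
qed

lemmas (in finite_measure) all_moments_intros =
  all_moments_const all_moments_add all_moments_diff all_moments_mult all_moments_power
  all_moments_sum

text \<open>Minkowski's inequality in \<open>L\<^sup>m\<close> for nonnegative functions, stated for bounds on the \<open>m\<close>-th moments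
  and so free of \<open>m\<close>-th roots.\<close>

lemma (in finite_measure) expectation_sum_power_le:
  fixes Y :: "'i \<Rightarrow> 'a \<Rightarrow> real" and s :: "'i \<Rightarrow> real"
  assumes "finite I" and Y: "\<And>i. i \<in> I \<Longrightarrow> all_moments M (Y i)"
    and Y_nonneg: "\<And>i x. i \<in> I \<Longrightarrow> 0 \<le> Y i x" and s: "\<And>i. i \<in> I \<Longrightarrow> 0 < s i"
    and moment: "\<And>i. i \<in> I \<Longrightarrow> (LINT x|M. Y i x ^ m) \<le> K * s i ^ m"
    and m: "m > 0" and K: "K \<ge> 0"
  shows "(LINT x|M. (\<Sum>i\<in>I. Y i x) ^ m) \<le> K * (\<Sum>i\<in>I. s i) ^ m"
proof (cases "I = {}")
  case True
  then show ?thesis using m by (simp add: power_0_left)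
next
  case False
  define S where "S = (\<Sum>i\<in>I. s i)"
  have S: "S > 0"
    unfolding S_def using assms(1) False s by (intro sum_pos)
  have conv: "convex_on {0::real..} (\<lambda>x. x ^ m)"
    using convex_power_odd[of m] convex_on_subset[OF convex_power_even[of m], of "{0..}"] by blast
  \<comment> \<open>Jensen's inequality for the weights \<open>s i / S\<close>.\<close>
  have "(\<Sum>i\<in>I. Y i x) ^ m \<le> (\<Sum>i\<in>I. (s i / S) * (S / s i * Y i x) ^ m)" for x
  proof -
    have "(\<Sum>i\<in>I. (s i / S) *\<^sub>R (S / s i * Y i x)) ^ m \<le> (\<Sum>i\<in>I. (s i / S) * (S / s i * Y i x) ^ m)"
    proof (rule convex_on_sum[OF assms(1) False conv])
      show "(\<Sum>i\<in>I. s i / S) = 1"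
        using S by (simp add: S_def flip: sum_divide_distrib)
    qed (use s S Y_nonneg in \<open>auto simp: less_imp_le\<close>)
    also have "(\<Sum>i\<in>I. (s i / S) *\<^sub>R (S / s i * Y i x)) = (\<Sum>i\<in>I. Y i x)"
      using s S by (intro sum.cong) (auto simp: less_imp_neq[THEN not_sym])
    finally show ?thesis .
  qed
  then have "(LINT x|M. (\<Sum>i\<in>I. Y i x) ^ m) \<le> (LINT x|M. (\<Sum>i\<in>I. (s i / S) * (S / s i * Y i x) ^ m))"
    using Y by (intro integral_mono all_moments_integrable all_moments_intros) auto
  also have "\<dots> = (\<Sum>i\<in>I. (s i / S) * (S / s i) ^ m * (LINT x|M. Y i x ^ m))"
  proof -
    have "(s i / S) * (S / s i * Y i x) ^ m = ((s i / S) * (S / s i) ^ m) * Y i x ^ m" for i x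
      by (simp only: power_mult_distrib mult.assoc)
    then show ?thesis
      using Y by (simp only:) (subst Bochner_Integration.integral_sum,
        intro all_moments_integrable all_moments_mult all_moments_const all_moments_power, auto)
  qed
  also have "\<dots> \<le> (\<Sum>i\<in>I. (s i / S) * (S / s i) ^ m * (K * s i ^ m))"
    using moment s S by (intro sum_mono mult_left_mono) (auto simp: less_imp_le)
  also have "\<dots> = (\<Sum>i\<in>I. s i / S * (K * S ^ m))"
    using s by (intro sum.cong) (auto simp: power_divide less_imp_neq[THEN not_sym])
  also have "\<dots> = K * S ^ m"
    using S by (simp add: S_def flip: sum_distrib_right sum_divide_distrib)
  finally show ?thesis
    by (simp add: S_def)
qed

section \<open>Moments of the standard normal law\<close>

definition gaussian_moment :: "nat \<Rightarrow> real" where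
  "gaussian_moment n = (LINT x|lborel. std_normal_density x * x ^ n)"

lemma gaussian_moment_odd: "odd n \<Longrightarrow> gaussian_moment n = 0"
  unfolding gaussian_moment_def using integral_std_normal_moment_odd by (auto elim!: oddE)

lemma gaussian_moment_0 [simp]: "gaussian_moment 0 = 1"
  using integral_std_normal_moment_even[of 0] by (simp add: gaussian_moment_def)

lemma gaussian_moment_even_nonneg: "gaussian_moment (2 * k) \<ge> 0"
  unfolding gaussian_moment_def integral_std_normal_moment_even by simp

lemma gaussian_moment_Suc_Suc: "gaussian_moment (Suc (Suc n)) = real (Suc n) * gaussian_moment n"
proof (cases "even n")
  case True
  then obtain k where n: "n = 2 * k" by blast
  have "fact (2 * Suc k) / (2 ^ Suc k * fact (Suc k)) = real (Suc (2 * k)) * (fact (2 * k) / (2 ^ k * fact k))"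
    by (simp add: divide_simps)
  then show ?thesis
    using integral_std_normal_moment_even[of "Suc k"] integral_std_normal_moment_even[of k]
    by (simp add: n gaussian_moment_def)
next
  case False
  then show ?thesis by (simp add: gaussian_moment_odd)
qed

lemma gaussian_moment_2: "gaussian_moment 2 = 1"
  using gaussian_moment_Suc_Suc[of 0] by (simp add: numeral_2_eq_2)

section \<open>The dual space and its embedding\<close>

lemma blinfun_range_dense_eq_0:
  fixes \<phi> :: "'w::banach \<Rightarrow>\<^sub>L real"
  assumes dense: "closure (range \<iota>) = UNIV" and zero: "\<And>k. \<phi> (\<iota> k) = 0"
  shows "\<phi> = 0"
proof (rule blinfun_eqI)
  fix w
  have "closed {w. \<phi> w = 0}"
    by (intro closed_Collect_eq continuous_intros)
  moreover have "range \<iota> \<subseteq> {w. \<phi> w = 0}"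
    using zero by auto
  ultimately have "closure (range \<iota>) \<subseteq> {w. \<phi> w = 0}"
    by (rule closure_minimal[rotated])
  then show "\<phi> w = (0 :: 'w \<Rightarrow>\<^sub>L real) w"
    using dense by auto
qed

context abstract_wiener_space
begin

abbreviation e :: "('w \<Rightarrow>\<^sub>L real) \<Rightarrow> 'h" where
  "e \<equiv> dual_embedding \<iota>"

text \<open>The representer exists by the Riesz representation theorem, so the definite description that
  defines \<^const>\<open>dual_embedding\<close> denotes it.\<close>

lemma dual_embedding_inner: "blinfun_apply \<phi> (\<iota> k) = inner (e \<phi>) k"
proof -
  interpret bounded_linear "\<lambda>k. blinfun_apply \<phi> (\<iota> k)"
    by (rule bounded_linear_compose[OF blinfun.bounded_linear_right embedding_bounded_linear])
  obtain K where K: "\<And>k. norm (blinfun_apply \<phi> (\<iota> k)) \<le> norm k * K"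
    using bounded by blast
  have "\<exists>g\<in>UNIV. \<forall>k\<in>UNIV. inner g k = blinfun_apply \<phi> (\<iota> k)"
  proof (rule riesz_representation_form[where lc = "\<lambda>a x b y. a *\<^sub>R x + b *\<^sub>R y" and K = K])
    show "inner (a *\<^sub>R x + b *\<^sub>R y) z = a * inner x z + b * inner y z" for a b and x y z :: 'h
      by (simp add: inner_add_left)
    show "inner x y = inner y x" for x y :: 'h
      by (rule inner_commute)
    show "blinfun_apply \<phi> (\<iota> x) \<le> K * sqrt (inner x x)" for x
      using K[of x] by (simp add: norm_eq_sqrt_inner mult.commute)
    fix x :: "nat \<Rightarrow> 'h"
    assume C: "\<And>e. e > 0 \<Longrightarrow> \<exists>N. \<forall>m\<ge>N. \<forall>n\<ge>N.
      inner (1 *\<^sub>R x m + - 1 *\<^sub>R x n) (1 *\<^sub>R x m + - 1 *\<^sub>R x n) < e"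
    have "Cauchy x"
    proof (rule CauchyI)
      fix d :: real assume "d > 0"
      then obtain N where N: "\<And>m n. m \<ge> N \<Longrightarrow> n \<ge> N \<Longrightarrow> inner (x m - x n) (x m - x n) < d\<^sup>2"
        using C[of "d\<^sup>2"] by auto
      have "norm (x m - x n) < d" if "m \<ge> N" "n \<ge> N" for m n
        using N[OF that] \<open>d > 0\<close> by (simp add: power2_norm_eq_inner[symmetric] power_less_imp_less_base)
      then show "\<exists>N. \<forall>m\<ge>N. \<forall>n\<ge>N. norm (x m - x n) < d"
        by blast
    qed
    then obtain g where "x \<longlonglongrightarrow> g"
      using Cauchy_convergent convergent_def by blast
    then have "(\<lambda>n. inner (x n - g) (x n - g)) \<longlonglongrightarrow> inner (g - g) (g - g)"
      by (intro tendsto_intros)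
    then show "\<exists>g\<in>UNIV. (\<lambda>n. inner (1 *\<^sub>R x n + - 1 *\<^sub>R g) (1 *\<^sub>R x n + - 1 *\<^sub>R g)) \<longlonglongrightarrow> 0"
      by (intro bexI[of _ g]) simp_all
  qed (simp_all add: add scaleR)
  then obtain g where g: "\<And>k. blinfun_apply \<phi> (\<iota> k) = inner g k"
    by (metis UNIV_I)
  have "e \<phi> = g"
    unfolding dual_embedding_def
  proof (rule the_equality)
    show "\<forall>k. blinfun_apply \<phi> (\<iota> k) = inner g k"
      using g by simp
    show "h = g" if "\<forall>k. blinfun_apply \<phi> (\<iota> k) = inner h k" for h
      using that g by (metis inner_commute vector_eq_ldot)
  qed
  then show ?thesis
    using g by simp
qed

lemma dual_embedding_linear: "linear e"
proof (rule linearI)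
  show "e (\<phi> + \<psi>) = e \<phi> + e \<psi>" for \<phi> \<psi>
    by (rule vector_eq_rdot[THEN iffD1])
      (simp add: inner_add_left dual_embedding_inner[symmetric] blinfun.add_left)
  show "e (c *\<^sub>R \<phi>) = c *\<^sub>R e \<phi>" for c \<phi>
    by (rule vector_eq_rdot[THEN iffD1])
      (simp add: dual_embedding_inner[symmetric] blinfun.scaleR_left)
qed

lemmas dual_embedding_simps =
  linear_add[OF dual_embedding_linear] linear_diff[OF dual_embedding_linear]
  linear_cmul[OF dual_embedding_linear] linear_sum[OF dual_embedding_linear]
  linear_0[OF dual_embedding_linear]

lemma dual_embedding_eq_0_iff: "e \<phi> = 0 \<longleftrightarrow> \<phi> = 0"
proof
  assume "e \<phi> = 0"
  then show "\<phi> = 0"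
    by (intro blinfun_range_dense_eq_0[OF embedding_dense]) (simp add: dual_embedding_inner)
qed (simp add: dual_embedding_simps)

section \<open>Gaussian functionals\<close>

lemma functional_measurable [measurable]: "blinfun_apply \<phi> \<in> borel_measurable \<mu>"
proof -
  have "continuous_on UNIV (blinfun_apply \<phi>)"
    by (intro continuous_intros)
  then have "blinfun_apply \<phi> \<in> borel_measurable borel"
    by (rule borel_measurable_continuous_onI)
  then show ?thesis
    using measurable_cong_sets[OF sets_eq_borel refl, of borel] by blast
qed

text \<open>The characteristic functional, evaluated on the multiples of a single \<open>\<phi>\<close>, is the
  characteristic function of the law of \<open>\<phi>\<close>.\<close>

lemma functional_standard_normal:
  fixes \<phi> :: "'w \<Rightarrow>\<^sub>L real"
  assumes "\<phi> \<noteq> 0"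
  shows "distr \<mu> borel (\<lambda>w. \<phi> w / norm (e \<phi>)) = std_normal_distribution"
proof (rule Levy_uniqueness)
  define s where "s = norm (e \<phi>)"
  have s: "s \<noteq> 0"
    using assms by (simp add: s_def dual_embedding_eq_0_iff)
  have [measurable]: "(\<lambda>w. \<phi> w / s) \<in> borel_measurable \<mu>"
    by measurable
  show "real_distribution (distr \<mu> borel (\<lambda>w. \<phi> w / norm (e \<phi>)))"
    by (rule real_distribution_distr) measurable
  show "real_distribution std_normal_distribution"
    by (rule real_dist_normal_dist)
  show "char (distr \<mu> borel (\<lambda>w. \<phi> w / norm (e \<phi>))) = char std_normal_distribution"
    unfolding char_std_normal_distribution s_def[symmetric]
  proof
    fix t :: real
    have "char (distr \<mu> borel (\<lambda>w. \<phi> w / s)) t = (LINT w|\<mu>. exp (\<i> * complex_of_real (((t / s) *\<^sub>R \<phi>) w)))"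
      by (simp add: char_def integral_distr blinfun.scaleR_left)
    also have "\<dots> = exp (- (norm (e ((t / s) *\<^sub>R \<phi>)))\<^sup>2 / 2)"
      by (rule characteristic_functional)
    also have "norm (e ((t / s) *\<^sub>R \<phi>)) = \<bar>t\<bar>"
      using s by (simp add: dual_embedding_simps s_def)
    finally show "char (distr \<mu> borel (\<lambda>w. \<phi> w / s)) t = complex_of_real (exp (- t\<^sup>2 / 2))"
      by simp
  qed
qed

lemma
  fixes \<phi> :: "'w \<Rightarrow>\<^sub>L real"
  shows functional_power_integrable: "integrable \<mu> (\<lambda>w. \<bar>\<phi> w\<bar> ^ n)"
    and functional_moment: "(LINT w|\<mu>. \<phi> w ^ n) = gaussian_moment n * norm (e \<phi>) ^ n"
proof -
  have "integrable \<mu> (\<lambda>w. \<bar>\<phi> w\<bar> ^ n) \<and> (LINT w|\<mu>. \<phi> w ^ n) = gaussian_moment n * norm (e \<phi>) ^ n"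
  proof (cases "\<phi> = 0")
    case True
    then show ?thesis
      by (cases n) (simp_all add: dual_embedding_simps prob_space)
  next
    case False
    define s where "s = norm (e \<phi>)"
    have s: "s \<noteq> 0"
      using False by (simp add: s_def dual_embedding_eq_0_iff)
    note normal = functional_standard_normal[OF False, folded s_def]
    have "integrable (distr \<mu> borel (\<lambda>w. \<phi> w / s)) (\<lambda>x. \<bar>x\<bar> ^ n)"
      unfolding normal by (subst integrable_density) (auto simp: integrable_std_normal_moment_abs)
    then have "integrable \<mu> (\<lambda>w. \<bar>s\<bar> ^ n * \<bar>\<phi> w / s\<bar> ^ n)"
      by (subst (asm) integrable_distr_eq) auto
    then have 1: "integrable \<mu> (\<lambda>w. \<bar>\<phi> w\<bar> ^ n)"
      using s by (simp add: power_divide)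
    have "(LINT w|\<mu>. \<phi> w ^ n) = s ^ n * (LINT w|\<mu>. (\<phi> w / s) ^ n)"
      using s by (simp add: power_divide)
    also have "(LINT w|\<mu>. (\<phi> w / s) ^ n) = (LINT x|distr \<mu> borel (\<lambda>w. \<phi> w / s). x ^ n)"
      by (subst integral_distr) auto
    also have "\<dots> = gaussian_moment n"
      unfolding normal gaussian_moment_def by (subst integral_density) auto
    finally show ?thesis
      using 1 by (simp add: s_def)
  qed
  then show "integrable \<mu> (\<lambda>w. \<bar>\<phi> w\<bar> ^ n)" "(LINT w|\<mu>. \<phi> w ^ n) = gaussian_moment n * norm (e \<phi>) ^ n"
    by auto
qed

lemma functional_all_moments: "all_moments \<mu> (blinfun_apply \<phi>)"
  by (simp add: all_moments_def functional_power_integrable)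

lemmas moment_intros = all_moments_intros functional_all_moments

lemma functional_second_moment:
  fixes \<phi> :: "'w \<Rightarrow>\<^sub>L real"
  shows "(LINT w|\<mu>. (\<phi> w)\<^sup>2) = (norm (e \<phi>))\<^sup>2"
  by (simp add: functional_moment gaussian_moment_2)

section \<open>Integration by parts\<close>

text \<open>The expectation on the left is a polynomial in \<open>t\<close>. Comparing the coefficients of \<open>t\<close> in two
  expressions for it polarises an identity for the powers of single functionals into one for
  products of functionals, and in this way reduces joint moments to one-dimensional laws.\<close>

lemma DERIV_expectation_power:
  fixes \<psi> \<eta> :: "'w \<Rightarrow>\<^sub>L real"
  assumes H: "all_moments \<mu> H"
  shows "((\<lambda>t. LINT w|\<mu>. (\<psi> + t *\<^sub>R \<eta>) w ^ n * H w) has_real_derivative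
    real n * (LINT w|\<mu>. \<eta> w * \<psi> w ^ (n - 1) * H w)) (at 0)"
proof -
  define a where "a k = real (n choose k) * (LINT w|\<mu>. \<eta> w ^ k * \<psi> w ^ (n - k) * H w)" for k
  have eq: "(LINT w|\<mu>. (\<psi> + t *\<^sub>R \<eta>) w ^ n * H w) = (\<Sum>k\<le>n. a k * t ^ k)" for t
  proof -
    have "(\<psi> + t *\<^sub>R \<eta>) w ^ n * H w
      = (\<Sum>k\<le>n. (real (n choose k) * t ^ k) * (\<eta> w ^ k * \<psi> w ^ (n - k) * H w))" for w
      by (simp add: blinfun.add_left blinfun.scaleR_left add.commute[of "\<psi> w"] binomial_ring
          power_mult_distrib sum_distrib_left sum_distrib_right mult_ac)
    then have "(LINT w|\<mu>. (\<psi> + t *\<^sub>R \<eta>) w ^ n * H w)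
      = (\<Sum>k\<le>n. (real (n choose k) * t ^ k) * (LINT w|\<mu>. \<eta> w ^ k * \<psi> w ^ (n - k) * H w))"
      by (simp only:) (subst Bochner_Integration.integral_sum,
          auto intro!: all_moments_integrable moment_intros H)
    then show ?thesis
      by (simp add: a_def mult_ac)
  qed
  have "((\<lambda>t. \<Sum>k\<le>n. a k * t ^ k) has_real_derivative (\<Sum>k\<le>n. a k * (real k * 0 ^ (k - 1)))) (at 0)"
    by (auto intro!: derivative_eq_intros sum.cong)
  also have "(\<Sum>k\<le>n. a k * (real k * 0 ^ (k - 1))) = (\<Sum>k\<le>n. if k = 1 then a k else 0)"
    by (intro sum.cong) (auto simp: power_0_left)
  also have "\<dots> = real n * (LINT w|\<mu>. \<eta> w * \<psi> w ^ (n - 1) * H w)"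
    by (cases n) (simp_all add: a_def)
  finally show ?thesis
    unfolding eq .
qed

text \<open>Compare the coefficients of \<open>t\<close> in \<open>\<integral> (\<psi> + t \<phi>)\<^sup>n\<^sup>+\<^sup>1 d\<mu> = \<gamma>\<^sub>n\<^sub>+\<^sub>1 \<parallel>e \<psi> + t e \<phi>\<parallel>\<^sup>n\<^sup>+\<^sup>1\<close>, where \<open>\<gamma>\<^sub>k\<close> is
  the \<open>k\<close>-th moment of the standard normal law.\<close>

lemma functional_Stein:
  fixes \<phi> \<psi> :: "'w \<Rightarrow>\<^sub>L real"
  shows "(LINT w|\<mu>. \<phi> w * \<psi> w ^ n) = real n * inner (e \<phi>) (e \<psi>) * (LINT w|\<mu>. \<psi> w ^ (n - 1))"
proof -
  have lhs: "((\<lambda>t. LINT w|\<mu>. (\<psi> + t *\<^sub>R \<phi>) w ^ Suc n * 1) has_real_derivative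
    real (Suc n) * (LINT w|\<mu>. \<phi> w * \<psi> w ^ (Suc n - 1) * 1)) (at 0)"
    by (rule DERIV_expectation_power) (rule all_moments_const)
  have fn: "(LINT w|\<mu>. (\<psi> + t *\<^sub>R \<phi>) w ^ Suc n * 1)
      = gaussian_moment (Suc n) * norm (e \<psi> + t *\<^sub>R e \<phi>) ^ Suc n" for t
    using functional_moment[of "\<psi> + t *\<^sub>R \<phi>" "Suc n"] by (simp add: dual_embedding_simps)
  show ?thesis
  proof (cases "odd n")
    case False
    then have "real (Suc n) * (LINT w|\<mu>. \<phi> w * \<psi> w ^ (Suc n - 1) * 1) = 0"
      using DERIV_unique[OF lhs[unfolded fn], of 0] by (simp add: gaussian_moment_odd del: of_nat_Suc)
    moreover have "real n * (LINT w|\<mu>. \<psi> w ^ (n - 1)) = 0"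
      using False by (cases n) (simp_all add: functional_moment gaussian_moment_odd)
    ultimately show ?thesis by auto
  next
    case True
    then obtain k where n: "n = Suc (2 * k)"
      by (metis oddE Suc_eq_plus1)
    have "norm (e \<psi> + t *\<^sub>R e \<phi>) ^ Suc n
        = (inner (e \<psi>) (e \<psi>) + 2 * t * inner (e \<phi>) (e \<psi>) + t\<^sup>2 * inner (e \<phi>) (e \<phi>)) ^ Suc k" for t
    proof -
      have "Suc n = 2 * Suc k"
        by (simp add: n)
      then have "norm (e \<psi> + t *\<^sub>R e \<phi>) ^ Suc n = ((norm (e \<psi> + t *\<^sub>R e \<phi>))\<^sup>2) ^ Suc k"
        by (simp only: power_mult)
      also have "(norm (e \<psi> + t *\<^sub>R e \<phi>))\<^sup>2
          = inner (e \<psi>) (e \<psi>) + 2 * t * inner (e \<phi>) (e \<psi>) + t\<^sup>2 * inner (e \<phi>) (e \<phi>)"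
        unfolding power2_norm_eq_inner
        by (simp add: inner_add_left inner_add_right inner_commute power2_eq_square algebra_simps)
      finally show ?thesis .
    qed
    note fn' = fn[unfolded this]
    have "((\<lambda>t. gaussian_moment (Suc n) *
        (inner (e \<psi>) (e \<psi>) + 2 * t * inner (e \<phi>) (e \<psi>) + t\<^sup>2 * inner (e \<phi>) (e \<phi>)) ^ Suc k)
      has_real_derivative gaussian_moment (Suc n) *
        (real (Suc k) * (2 * inner (e \<phi>) (e \<psi>)) * inner (e \<psi>) (e \<psi>) ^ k)) (at 0)"
      by (auto intro!: derivative_eq_intros simp del: power_Suc)
    from DERIV_unique[OF lhs[unfolded fn'] this]
    have "real (Suc n) * (LINT w|\<mu>. \<phi> w * \<psi> w ^ n)
        = gaussian_moment (Suc n) * real (Suc k) * 2 * inner (e \<phi>) (e \<psi>) * inner (e \<psi>) (e \<psi>) ^ k"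
      by (simp add: mult_ac)
    also have "\<dots> = real (Suc n) * (real n * inner (e \<phi>) (e \<psi>) * (LINT w|\<mu>. \<psi> w ^ (n - 1)))"
    proof -
      have "(LINT w|\<mu>. \<psi> w ^ (n - 1)) = gaussian_moment (2 * k) * inner (e \<psi>) (e \<psi>) ^ k"
        using functional_moment[of \<psi> "2 * k"] by (simp add: n power_mult[of "norm (e \<psi>)"] power2_norm_eq_inner)
      then show ?thesis
        by (simp add: n gaussian_moment_Suc_Suc)
    qed
    finally show ?thesis by simp
  qed
qed

text \<open>\<open>D \<phi>\<close> plays the part of the derivative of \<open>H\<close> in the direction \<open>e \<phi>\<close>, and the case \<open>n = 0\<close> is the Gaussian
  integration by parts formula \<open>\<integral> \<phi> H d\<mu> = \<integral> D \<phi> d\<mu>\<close>. The additional factor \<open>\<psi>\<^sup>n\<close> makes the property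
  stable under multiplication of \<open>H\<close> by functionals: replacing \<open>\<psi>\<close> by \<open>\<psi> + t \<eta>\<close> produces the factor \<open>\<eta>\<close> as
  the coefficient of \<open>t\<close>.\<close>

definition by_parts :: "('w \<Rightarrow> real) \<Rightarrow> (('w \<Rightarrow>\<^sub>L real) \<Rightarrow> 'w \<Rightarrow> real) \<Rightarrow> bool" where
  "by_parts H D \<longleftrightarrow> all_moments \<mu> H \<and> (\<forall>\<phi>. all_moments \<mu> (D \<phi>)) \<and>
     (\<forall>(\<phi> :: 'w \<Rightarrow>\<^sub>L real) (\<psi> :: 'w \<Rightarrow>\<^sub>L real) n. (LINT w|\<mu>. blinfun_apply \<phi> w * blinfun_apply \<psi> w ^ n * H w)
        = real n * inner (e \<phi>) (e \<psi>) * (LINT w|\<mu>. blinfun_apply \<psi> w ^ (n - 1) * H w)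
          + (LINT w|\<mu>. blinfun_apply \<psi> w ^ n * D \<phi> w))"

lemma by_partsD:
  fixes \<phi> \<psi> :: "'w \<Rightarrow>\<^sub>L real"
  assumes "by_parts H D"
  shows "all_moments \<mu> H" "all_moments \<mu> (D \<phi>)"
    and "(LINT w|\<mu>. \<phi> w * \<psi> w ^ n * H w)
        = real n * inner (e \<phi>) (e \<psi>) * (LINT w|\<mu>. \<psi> w ^ (n - 1) * H w)
          + (LINT w|\<mu>. \<psi> w ^ n * D \<phi> w)"
  using assms unfolding by_parts_def by blast+

lemma by_parts_const: "by_parts (\<lambda>_. c) (\<lambda>_ _. 0)"
  unfolding by_parts_def by (simp add: all_moments_const functional_Stein)

lemma by_parts_add:
  assumes "by_parts H D" "by_parts K E"
  shows "by_parts (\<lambda>w. H w + K w) (\<lambda>\<phi> w. D \<phi> w + E \<phi> w)"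
proof -
  note H = by_partsD(1,2)[OF assms(1)] and K = by_partsD(1,2)[OF assms(2)]
  have add: "(LINT w|\<mu>. G w * (A w + B w)) = (LINT w|\<mu>. G w * A w) + (LINT w|\<mu>. G w * B w)"
    if "all_moments \<mu> G" "all_moments \<mu> A" "all_moments \<mu> B" for G A B
    using that by (simp add: distrib_left all_moments_integrable all_moments_mult)
  show ?thesis
    unfolding by_parts_def
  proof (intro conjI allI)
    fix \<phi> \<psi> :: "'w \<Rightarrow>\<^sub>L real" and n
    have "(LINT w|\<mu>. \<phi> w * \<psi> w ^ n * (H w + K w))
        = (LINT w|\<mu>. \<phi> w * \<psi> w ^ n * H w) + (LINT w|\<mu>. \<phi> w * \<psi> w ^ n * K w)"
      using H K by (intro add moment_intros)
    moreover have "(LINT w|\<mu>. \<psi> w ^ (n - 1) * (H w + K w))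
        = (LINT w|\<mu>. \<psi> w ^ (n - 1) * H w) + (LINT w|\<mu>. \<psi> w ^ (n - 1) * K w)"
      using H K by (intro add moment_intros)
    moreover have "(LINT w|\<mu>. \<psi> w ^ n * (D \<phi> w + E \<phi> w))
        = (LINT w|\<mu>. \<psi> w ^ n * D \<phi> w) + (LINT w|\<mu>. \<psi> w ^ n * E \<phi> w)"
      using H K by (intro add moment_intros)
    ultimately show "(LINT w|\<mu>. \<phi> w * \<psi> w ^ n * (H w + K w))
        = real n * inner (e \<phi>) (e \<psi>) * (LINT w|\<mu>. \<psi> w ^ (n - 1) * (H w + K w))
          + (LINT w|\<mu>. \<psi> w ^ n * (D \<phi> w + E \<phi> w))"
      using by_partsD(3)[OF assms(1), of \<phi> \<psi> n] by_partsD(3)[OF assms(2), of \<phi> \<psi> n]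
      by (simp add: distrib_left)
  qed (use H K in \<open>auto intro!: moment_intros\<close>)
qed

lemma by_parts_scale:
  assumes "by_parts H D"
  shows "by_parts (\<lambda>w. c * H w) (\<lambda>\<phi> w. c * D \<phi> w)"
  unfolding by_parts_def
proof (intro conjI allI)
  note H = by_partsD(1,2)[OF assms]
  fix \<phi> \<psi> :: "'w \<Rightarrow>\<^sub>L real" and n
  have pull: "(LINT w|\<mu>. G w * (c * A w)) = c * (LINT w|\<mu>. G w * A w)" for G A :: "'w \<Rightarrow> real"
    by (simp add: mult.left_commute)
  show "(LINT w|\<mu>. \<phi> w * \<psi> w ^ n * (c * H w))
        = real n * inner (e \<phi>) (e \<psi>) * (LINT w|\<mu>. \<psi> w ^ (n - 1) * (c * H w))
          + (LINT w|\<mu>. \<psi> w ^ n * (c * D \<phi> w))"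
    unfolding pull by_partsD(3)[OF assms] by (simp add: algebra_simps)
qed (use by_partsD(1,2)[OF assms] in \<open>auto intro!: moment_intros\<close>)

lemma by_parts_sum:
  "(\<And>i. i \<in> I \<Longrightarrow> by_parts (H i) (D i)) \<Longrightarrow>
    by_parts (\<lambda>w. \<Sum>i\<in>I. H i w) (\<lambda>\<phi> w. \<Sum>i\<in>I. D i \<phi> w)"
  by (induction I rule: infinite_finite_induct) (auto simp: by_parts_const by_parts_add)

text \<open>The product rule. Both sides of the formula for the exponent \<open>n + 1\<close> and the functional
  \<open>\<psi> + t \<eta>\<close> are differentiated at \<open>t = 0\<close>, and a common factor \<open>n + 1\<close> cancels.\<close>

lemma by_parts_mult_functional:
  fixes \<eta> :: "'w \<Rightarrow>\<^sub>L real"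
  assumes "by_parts H D"
  shows "by_parts (\<lambda>w. \<eta> w * H w) (\<lambda>\<phi> w. inner (e \<phi>) (e \<eta>) * H w + \<eta> w * D \<phi> w)"
  unfolding by_parts_def
proof (intro conjI allI)
  note H = by_partsD(1,2)[OF assms]
  fix \<phi> \<psi> :: "'w \<Rightarrow>\<^sub>L real" and n
  define L1 where "L1 t = (LINT w|\<mu>. (\<psi> + t *\<^sub>R \<eta>) w ^ Suc n * (\<phi> w * H w))" for t
  define L2 where "L2 t = (LINT w|\<mu>. (\<psi> + t *\<^sub>R \<eta>) w ^ n * H w)" for t
  define L3 where "L3 t = (LINT w|\<mu>. (\<psi> + t *\<^sub>R \<eta>) w ^ Suc n * D \<phi> w)" for t
  have eq: "L1 t = real (Suc n) * (inner (e \<phi>) (e \<psi>) + t * inner (e \<phi>) (e \<eta>)) * L2 t + L3 t" for t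
    using by_partsD(3)[OF assms, of \<phi> "\<psi> + t *\<^sub>R \<eta>" "Suc n"]
    by (simp add: L1_def L2_def L3_def dual_embedding_simps inner_add_right mult_ac)
  have D1: "(L1 has_real_derivative real (Suc n) * (LINT w|\<mu>. \<eta> w * \<psi> w ^ (Suc n - 1) * (\<phi> w * H w))) (at 0)"
    unfolding L1_def by (intro DERIV_expectation_power moment_intros H)
  have D2: "(L2 has_real_derivative real n * (LINT w|\<mu>. \<eta> w * \<psi> w ^ (n - 1) * H w)) (at 0)"
    unfolding L2_def by (intro DERIV_expectation_power H)
  have D3: "(L3 has_real_derivative real (Suc n) * (LINT w|\<mu>. \<eta> w * \<psi> w ^ (Suc n - 1) * D \<phi> w)) (at 0)"
    unfolding L3_def by (intro DERIV_expectation_power H)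
  have D1': "(L1 has_real_derivative
      real (Suc n) * (inner (e \<phi>) (e \<eta>) * L2 0
        + inner (e \<phi>) (e \<psi>) * (real n * (LINT w|\<mu>. \<eta> w * \<psi> w ^ (n - 1) * H w)))
      + real (Suc n) * (LINT w|\<mu>. \<eta> w * \<psi> w ^ (Suc n - 1) * D \<phi> w)) (at 0)"
    unfolding eq[abs_def] by (auto intro!: derivative_eq_intros D2 D3 simp: algebra_simps)
  have "real (Suc n) * (LINT w|\<mu>. \<eta> w * \<psi> w ^ n * (\<phi> w * H w)) = real (Suc n) *
      (inner (e \<phi>) (e \<eta>) * L2 0 + inner (e \<phi>) (e \<psi>) * (real n * (LINT w|\<mu>. \<eta> w * \<psi> w ^ (n - 1) * H w))
      + (LINT w|\<mu>. \<eta> w * \<psi> w ^ n * D \<phi> w))"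
    using DERIV_unique[OF D1 D1'] by (simp add: distrib_left)
  then have "(LINT w|\<mu>. \<eta> w * \<psi> w ^ n * (\<phi> w * H w)) =
      inner (e \<phi>) (e \<eta>) * (LINT w|\<mu>. \<psi> w ^ n * H w)
      + inner (e \<phi>) (e \<psi>) * (real n * (LINT w|\<mu>. \<eta> w * \<psi> w ^ (n - 1) * H w))
      + (LINT w|\<mu>. \<eta> w * \<psi> w ^ n * D \<phi> w)"
    by (simp add: L2_def)
  moreover have "(LINT w|\<mu>. \<psi> w ^ n * (inner (e \<phi>) (e \<eta>) * H w + \<eta> w * D \<phi> w))
      = inner (e \<phi>) (e \<eta>) * (LINT w|\<mu>. \<psi> w ^ n * H w) + (LINT w|\<mu>. \<eta> w * \<psi> w ^ n * D \<phi> w)"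
  proof -
    have "(LINT w|\<mu>. \<psi> w ^ n * (inner (e \<phi>) (e \<eta>) * H w + \<eta> w * D \<phi> w))
      = (LINT w|\<mu>. inner (e \<phi>) (e \<eta>) * (\<psi> w ^ n * H w) + \<eta> w * \<psi> w ^ n * D \<phi> w)"
      by (simp add: algebra_simps)
    also have "\<dots> = (LINT w|\<mu>. inner (e \<phi>) (e \<eta>) * (\<psi> w ^ n * H w)) + (LINT w|\<mu>. \<eta> w * \<psi> w ^ n * D \<phi> w)"
      by (intro Bochner_Integration.integral_add all_moments_integrable moment_intros H)
    finally show ?thesis
      by (simp only: integral_mult_right_zero)
  qed
  ultimately show "(LINT w|\<mu>. \<phi> w * \<psi> w ^ n * (\<eta> w * H w))
        = real n * inner (e \<phi>) (e \<psi>) * (LINT w|\<mu>. \<psi> w ^ (n - 1) * (\<eta> w * H w))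
          + (LINT w|\<mu>. \<psi> w ^ n * (inner (e \<phi>) (e \<eta>) * H w + \<eta> w * D \<phi> w))"
    by (simp add: mult_ac)
qed (use by_partsD(1,2)[OF assms] in \<open>auto intro!: moment_intros\<close>)

end

section \<open>Moments of quadratic functionals\<close>

lemma norm_sq_orthogonal_expansion:
  fixes z :: "'a::real_inner"
  assumes "finite B" "pairwise orthogonal B" "z \<in> span B"
  shows "(norm z)\<^sup>2 = (\<Sum>b\<in>B. (inner z b / norm b)\<^sup>2)"
proof -
  obtain u where u: "z = (\<Sum>b\<in>B. u b *\<^sub>R b)"
    using assms(1,3) by (auto simp: span_finite)
  have coeff: "inner z b = u b * inner b b" if "b \<in> B" for b
  proof -
    have "inner z b = (\<Sum>a\<in>B. u a * inner a b)"
      by (simp add: u inner_sum_left)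
    also have "\<dots> = (\<Sum>a\<in>B. if a = b then u b * inner b b else 0)"
      using assms(2) that by (intro sum.cong) (auto simp: pairwise_def orthogonal_def)
    finally show ?thesis
      using assms(1) that by simp
  qed
  have "(norm z)\<^sup>2 = (\<Sum>b\<in>B. u b * inner z b)"
    using arg_cong[OF u, of "inner z"] by (simp add: power2_norm_eq_inner inner_sum_right)
  also have "\<dots> = (\<Sum>b\<in>B. (inner z b / norm b)\<^sup>2)"
    by (intro sum.cong refl) (auto simp: coeff power2_eq_square norm_eq_sqrt_inner)
  finally show ?thesis .
qed

text \<open>Lets a term \<open>k a\<^sup>n r\<close> be absorbed into \<open>a\<^sup>n\<^sup>+\<^sup>1\<close> at the price of a power of \<open>r\<close>: either \<open>r\<close> is small
  compared with \<open>a\<close>, or \<open>a\<close> is bounded by a multiple of \<open>r\<close>.\<close>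

lemma power_mult_le_half:
  fixes a r k :: real
  assumes "a \<ge> 0" "r \<ge> 0" "k \<ge> 0"
  shows "k * a ^ n * r \<le> a ^ Suc n / 2 + (2 * k * r) ^ Suc n"
proof (cases "2 * k * r \<le> a")
  case True
  then have "(k * r) * a ^ n \<le> (a / 2) * a ^ n"
    using assms by (intro mult_right_mono) auto
  moreover have "0 \<le> (2 * k * r) ^ Suc n"
    using assms by (intro zero_le_power) auto
  ultimately show ?thesis
    by (simp add: mult_ac)
next
  case False
  then have "a ^ n \<le> (2 * k * r) ^ n"
    using assms by (intro power_mono) auto
  then have "k * r * a ^ n \<le> k * r * (2 * k * r) ^ n"
    using assms by (intro mult_left_mono) auto
  also have "\<dots> \<le> (2 * k * r) * (2 * k * r) ^ n"
    using assms by (intro mult_right_mono) auto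
  finally have "k * a ^ n * r \<le> (2 * k * r) ^ Suc n"
    by (simp add: mult_ac)
  moreover have "0 \<le> a ^ Suc n / 2"
    using assms by simp
  ultimately show ?thesis by linarith
qed

context abstract_wiener_space
begin

text \<open>The elements of the second chaos that are built from finitely many continuous functionals.\<close>

definition quad :: "nat \<Rightarrow> (nat \<Rightarrow> real) \<Rightarrow> (nat \<Rightarrow> 'w \<Rightarrow>\<^sub>L real) \<Rightarrow> 'w \<Rightarrow> real" where
  "quad m c \<phi> w = (\<Sum>j<m. c j * ((blinfun_apply (\<phi> j) w)\<^sup>2 - (norm (e (\<phi> j)))\<^sup>2))"

text \<open>The gradient of \<open>quad\<close> at \<open>w\<close> is twice this element of \<open>H\<close>.\<close>

definition half_grad :: "nat \<Rightarrow> (nat \<Rightarrow> real) \<Rightarrow> (nat \<Rightarrow> 'w \<Rightarrow>\<^sub>L real) \<Rightarrow> 'w \<Rightarrow> 'h" where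
  "half_grad m c \<phi> w = (\<Sum>j<m. (c j * blinfun_apply (\<phi> j) w) *\<^sub>R e (\<phi> j))"

lemma quad_all_moments: "all_moments \<mu> (quad m c \<phi>)"
  unfolding quad_def[abs_def] by (intro moment_intros)

lemma half_grad_inner_all_moments: "all_moments \<mu> (\<lambda>w. inner h (half_grad m c \<phi> w))"
  unfolding half_grad_def[abs_def] inner_sum_right inner_scaleR_right by (intro moment_intros)

lemma by_parts_mult_quad:
  assumes "by_parts K D"
  shows "by_parts (\<lambda>w. quad m c \<phi> w * K w)
    (\<lambda>\<psi> w. 2 * inner (e \<psi>) (half_grad m c \<phi> w) * K w + quad m c \<phi> w * D \<psi> w)"
proof -
  define s where "s j = - (norm (e (\<phi> j)))\<^sup>2" for j
  define q where "q j = blinfun_apply (\<phi> j)" for j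
  have "by_parts (\<lambda>w. \<Sum>j<m. c j * (q j w * (q j w * K w) + s j * K w))
    (\<lambda>\<psi> w. \<Sum>j<m. c j * ((inner (e \<psi>) (e (\<phi> j)) * (q j w * K w)
        + q j w * (inner (e \<psi>) (e (\<phi> j)) * K w + q j w * D \<psi> w)) + s j * D \<psi> w))"
    unfolding q_def
    by (intro by_parts_sum by_parts_scale by_parts_add by_parts_mult_functional assms)
  also have "(\<lambda>w. \<Sum>j<m. c j * (q j w * (q j w * K w) + s j * K w)) = (\<lambda>w. quad m c \<phi> w * K w)"
    by (intro ext) (simp add: quad_def q_def s_def sum_distrib_right sum_distrib_left algebra_simps power2_eq_square)
  also have "(\<lambda>\<psi> w. \<Sum>j<m. c j * ((inner (e \<psi>) (e (\<phi> j)) * (q j w * K w)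
        + q j w * (inner (e \<psi>) (e (\<phi> j)) * K w + q j w * D \<psi> w)) + s j * D \<psi> w))
      = (\<lambda>\<psi> w. 2 * inner (e \<psi>) (half_grad m c \<phi> w) * K w + quad m c \<phi> w * D \<psi> w)"
    by (intro ext) (simp add: quad_def half_grad_def q_def s_def inner_sum_right sum_distrib_left
        sum_distrib_right power2_eq_square algebra_simps sum.distrib[symmetric] sum_subtractf[symmetric])
  finally show ?thesis .
qed

lemma by_parts_quad_power:
  "by_parts (\<lambda>w. quad m c \<phi> w ^ N)
    (\<lambda>\<psi> w. real N * quad m c \<phi> w ^ (N - 1) * (2 * inner (e \<psi>) (half_grad m c \<phi> w)))"
proof (induction N)
  case 0
  then show ?case
    using by_parts_const[of 1] by simp
next
  case (Suc N)
  have "(\<lambda>\<psi> w. 2 * inner (e \<psi>) (half_grad m c \<phi> w) * quad m c \<phi> w ^ N + quad m c \<phi> w *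
      (real N * quad m c \<phi> w ^ (N - 1) * (2 * inner (e \<psi>) (half_grad m c \<phi> w))))
    = (\<lambda>\<psi> w. real (Suc N) * quad m c \<phi> w ^ (Suc N - 1) * (2 * inner (e \<psi>) (half_grad m c \<phi> w)))"
    by (intro ext, cases N) (simp_all add: algebra_simps)
  then show ?case
    using by_parts_mult_quad[OF Suc, of m c \<phi>] by (simp only: power_Suc)
qed

lemma half_grad_sq_all_moments: "all_moments \<mu> (\<lambda>w. (norm (half_grad m c \<phi> w))\<^sup>2)"
proof -
  have "(norm (half_grad m c \<phi> w))\<^sup>2
      = (\<Sum>j<m. c j * blinfun_apply (\<phi> j) w * inner (e (\<phi> j)) (half_grad m c \<phi> w))" for w
    unfolding power2_norm_eq_inner by (subst (1) half_grad_def) (simp add: inner_sum_left)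
  then show ?thesis
    by (simp only:) (intro moment_intros half_grad_inner_all_moments)
qed

text \<open>One factor of \<open>quad\<close> is expanded, and one copy of \<open>\<phi>\<^sub>j\<close> in each \<open>\<phi>\<^sub>j\<^sup>2\<close> is integrated by parts. The
  derivative of the other copy cancels the constant \<open>\<parallel>e \<phi>\<^sub>j\<parallel>\<^sup>2\<close>, and the derivative of the remaining power
  of \<open>quad\<close> brings in \<open>half_grad\<close>.\<close>

lemma quad_moment_recursion:
  "(LINT w|\<mu>. quad m c \<phi> w ^ Suc N)
    = 2 * real N * (LINT w|\<mu>. quad m c \<phi> w ^ (N - 1) * (norm (half_grad m c \<phi> w))\<^sup>2)"
proof -
  define F where "F = quad m c \<phi>"
  define Z where "Z = half_grad m c \<phi>"
  define q where "q j = blinfun_apply (\<phi> j)" for j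
  have mom: "all_moments \<mu> F" "\<And>j. all_moments \<mu> (q j)"
      "\<And>h. all_moments \<mu> (\<lambda>w. inner h (Z w))"
    by (simp_all add: F_def q_def Z_def quad_all_moments functional_all_moments half_grad_inner_all_moments)
  have parts: "(LINT w|\<mu>. (q j w)\<^sup>2 * F w ^ N - (norm (e (\<phi> j)))\<^sup>2 * F w ^ N)
      = 2 * real N * (LINT w|\<mu>. q j w * F w ^ (N - 1) * inner (e (\<phi> j)) (Z w))" for j
  proof -
    have "(LINT w|\<mu>. (q j w)\<^sup>2 * F w ^ N - (norm (e (\<phi> j)))\<^sup>2 * F w ^ N)
        = (LINT w|\<mu>. (q j w)\<^sup>2 * F w ^ N) - (norm (e (\<phi> j)))\<^sup>2 * (LINT w|\<mu>. F w ^ N)"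
      using mom by (simp add: all_moments_integrable all_moments_mult all_moments_power)
    also have "(LINT w|\<mu>. (q j w)\<^sup>2 * F w ^ N) = (LINT w|\<mu>. q j w * q j w ^ 1 * F w ^ N)"
      by (simp add: power2_eq_square)
    also have "\<dots> = (norm (e (\<phi> j)))\<^sup>2 * (LINT w|\<mu>. F w ^ N)
        + (LINT w|\<mu>. q j w * (real N * F w ^ (N - 1) * (2 * inner (e (\<phi> j)) (Z w))))"
      using by_partsD(3)[OF by_parts_quad_power, of "\<phi> j" "\<phi> j" 1 m c \<phi> N]
      by (simp add: q_def F_def Z_def power2_norm_eq_inner)
    also have "(LINT w|\<mu>. q j w * (real N * F w ^ (N - 1) * (2 * inner (e (\<phi> j)) (Z w))))
        = (LINT w|\<mu>. (2 * real N) * (q j w * F w ^ (N - 1) * inner (e (\<phi> j)) (Z w)))"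
      by (simp add: mult_ac)
    finally show ?thesis by (simp only: integral_mult_right_zero)
  qed
  have "(LINT w|\<mu>. F w ^ Suc N)
      = (LINT w|\<mu>. (\<Sum>j<m. c j * ((q j w)\<^sup>2 * F w ^ N - (norm (e (\<phi> j)))\<^sup>2 * F w ^ N)))"
  proof (rule Bochner_Integration.integral_cong[OF refl])
    fix w
    have "F w ^ Suc N = (\<Sum>j<m. c j * ((q j w)\<^sup>2 - (norm (e (\<phi> j)))\<^sup>2)) * F w ^ N"
      by (simp add: F_def quad_def q_def)
    then show "F w ^ Suc N = (\<Sum>j<m. c j * ((q j w)\<^sup>2 * F w ^ N - (norm (e (\<phi> j)))\<^sup>2 * F w ^ N))"
      by (simp only: sum_distrib_right left_diff_distrib mult.assoc)
  qed
  also have "\<dots> = (\<Sum>j<m. c j * (2 * real N * (LINT w|\<mu>. q j w * F w ^ (N - 1) * inner (e (\<phi> j)) (Z w))))"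
    unfolding parts[symmetric] using mom
    by (subst Bochner_Integration.integral_sum)
      (auto intro!: all_moments_integrable moment_intros simp del: Bochner_Integration.integral_diff)
  also have "\<dots> = (\<Sum>j<m. LINT w|\<mu>. 2 * real N * (c j * q j w * F w ^ (N - 1) * inner (e (\<phi> j)) (Z w)))"
    by (simp add: mult_ac)
  also have "\<dots> = (LINT w|\<mu>. (\<Sum>j<m. 2 * real N * (c j * q j w * F w ^ (N - 1) * inner (e (\<phi> j)) (Z w))))"
    using mom by (intro Bochner_Integration.integral_sum[symmetric] all_moments_integrable moment_intros)
  also have "\<dots> = (LINT w|\<mu>. 2 * real N * (F w ^ (N - 1) * (norm (Z w))\<^sup>2))"
  proof (rule Bochner_Integration.integral_cong[OF refl])
    fix w
    have "(norm (Z w))\<^sup>2 = (\<Sum>j<m. c j * q j w * inner (e (\<phi> j)) (Z w))"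
      unfolding power2_norm_eq_inner
      by (subst (1) Z_def, subst half_grad_def) (simp add: inner_sum_left q_def)
    then show "(\<Sum>j<m. 2 * real N * (c j * q j w * F w ^ (N - 1) * inner (e (\<phi> j)) (Z w)))
        = 2 * real N * (F w ^ (N - 1) * (norm (Z w))\<^sup>2)"
      by (simp add: sum_distrib_left mult_ac)
  qed
  finally show ?thesis
    by (simp add: F_def Z_def)
qed

text \<open>In an orthogonal basis of the finite-dimensional space that contains \<open>half_grad\<close>, its squared norm is a sum
  of squares of Gaussian functionals, whose moments are explicit.\<close>

lemma half_grad_moment_le:
  "(LINT w|\<mu>. ((norm (half_grad m c \<phi> w))\<^sup>2) ^ k)
    \<le> gaussian_moment (2 * k) * (LINT w|\<mu>. (norm (half_grad m c \<phi> w))\<^sup>2) ^ k"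
proof (cases "k = 0")
  case True
  then show ?thesis by (simp add: prob_space)
next
  case False
  obtain B where B: "finite B" "span B = span ((\<lambda>j. e (\<phi> j)) ` {..<m})" "pairwise orthogonal B"
    using basis_orthogonal[of "(\<lambda>j. e (\<phi> j)) ` {..<m}"] by blast
  define \<zeta> where "\<zeta> b = (\<Sum>j<m. (c j * inner (e (\<phi> j)) b / norm b) *\<^sub>R \<phi> j)" for b
  define I where "I = {b \<in> B. \<zeta> b \<noteq> 0}"
  have I: "finite I"
    using B(1) by (simp add: I_def)
  have eq: "(norm (half_grad m c \<phi> w))\<^sup>2 = (\<Sum>b\<in>I. (\<zeta> b w)\<^sup>2)" for w
  proof -
    have "half_grad m c \<phi> w \<in> span B"
      unfolding half_grad_def B(2) by (intro span_sum span_scale span_base) auto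
    then have "(norm (half_grad m c \<phi> w))\<^sup>2 = (\<Sum>b\<in>B. (inner (half_grad m c \<phi> w) b / norm b)\<^sup>2)"
      by (rule norm_sq_orthogonal_expansion[OF B(1,3)])
    also have "\<dots> = (\<Sum>b\<in>B. (\<zeta> b w)\<^sup>2)"
      by (simp add: \<zeta>_def half_grad_def inner_sum_left blinfun.sum_left blinfun.scaleR_left
          sum_divide_distrib mult_ac)
    also have "\<dots> = (\<Sum>b\<in>I. (\<zeta> b w)\<^sup>2)"
      using B(1) by (intro sum.mono_neutral_right) (auto simp: I_def)
    finally show ?thesis .
  qed
  have "(LINT w|\<mu>. (\<Sum>b\<in>I. (\<zeta> b w)\<^sup>2) ^ k) \<le> gaussian_moment (2 * k) * (\<Sum>b\<in>I. (norm (e (\<zeta> b)))\<^sup>2) ^ k"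
  proof (rule expectation_sum_power_le[OF I])
    show "0 < (norm (e (\<zeta> b)))\<^sup>2" if "b \<in> I" for b
      using that by (simp add: I_def dual_embedding_eq_0_iff)
    show "(LINT w|\<mu>. ((\<zeta> b w)\<^sup>2) ^ k) \<le> gaussian_moment (2 * k) * ((norm (e (\<zeta> b)))\<^sup>2) ^ k" for b
      by (simp add: power_mult[symmetric] functional_moment)
  qed (use False in \<open>auto intro!: moment_intros gaussian_moment_even_nonneg\<close>)
  also have "(\<Sum>b\<in>I. (norm (e (\<zeta> b)))\<^sup>2) = (LINT w|\<mu>. (\<Sum>b\<in>I. (\<zeta> b w)\<^sup>2))"
    by (subst Bochner_Integration.integral_sum)
      (auto intro!: all_moments_integrable moment_intros simp: functional_second_moment)
  finally show ?thesis
    by (simp add: eq)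
qed

text \<open>Hypercontractivity. With \<open>F\<close> for \<open>quad\<close> and \<open>R\<close> for the squared norm of \<open>half_grad\<close>, the recursion
  bounds \<open>\<integral> F\<^sup>2\<^sup>k\<close> by \<open>4 k \<integral> F\<^sup>2\<^sup>k\<^sup>-\<^sup>2 R\<close>. Half of \<open>\<integral> F\<^sup>2\<^sup>k\<close> is absorbed on the left, which leaves a multiple
  of \<open>\<integral> R\<^sup>k\<close>; this is bounded by a multiple of \<open>(\<integral> R)\<^sup>k\<close>, and \<open>2 \<integral> R = \<integral> F\<^sup>2\<close> by the recursion once more.\<close>

lemma quad_moment_le:
  "(LINT w|\<mu>. quad m c \<phi> w ^ (2 * k))
    \<le> 2 * (4 * real k) ^ k * gaussian_moment (2 * k) * (LINT w|\<mu>. (quad m c \<phi> w)\<^sup>2) ^ k"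
proof (cases k)
  case 0
  then show ?thesis by (simp add: prob_space)
next
  case (Suc n)
  define F where "F = quad m c \<phi>"
  define R where "R w = (norm (half_grad m c \<phi> w))\<^sup>2" for w
  have mom: "all_moments \<mu> F" "all_moments \<mu> R"
    by (simp_all add: F_def R_def[abs_def] quad_all_moments half_grad_sq_all_moments)
  have R_nonneg: "R w \<ge> 0" for w
    by (simp add: R_def)
  have second: "(LINT w|\<mu>. (F w)\<^sup>2) = 2 * (LINT w|\<mu>. R w)"
    using quad_moment_recursion[of m c \<phi> 1] by (simp add: F_def R_def numeral_2_eq_2)
  have "(LINT w|\<mu>. F w ^ (2 * k)) = 2 * real (Suc (2 * n)) * (LINT w|\<mu>. F w ^ (2 * n) * R w)"
    using quad_moment_recursion[of m c \<phi> "Suc (2 * n)"] by (simp add: F_def R_def Suc)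
  also have "\<dots> = (LINT w|\<mu>. 2 * real (Suc (2 * n)) * ((F w)\<^sup>2) ^ n * R w)"
    by (simp only: Bochner_Integration.integral_mult_right_zero[symmetric] power_mult[symmetric] mult.assoc)
  also have "\<dots> \<le> (LINT w|\<mu>. F w ^ (2 * k) / 2 + (8 * real k) ^ k * R w ^ k)"
  proof (intro integral_mono)
    fix w
    have "2 * real (Suc (2 * n)) * ((F w)\<^sup>2) ^ n * R w \<le> 4 * real k * ((F w)\<^sup>2) ^ n * R w"
      using R_nonneg by (intro mult_right_mono) (auto simp: Suc)
    also have "\<dots> \<le> ((F w)\<^sup>2) ^ Suc n / 2 + (2 * (4 * real k) * R w) ^ Suc n"
      using R_nonneg by (intro power_mult_le_half) auto
    also have "\<dots> = F w ^ (2 * k) / 2 + (8 * real k) ^ k * R w ^ k"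
      by (simp only: Suc[symmetric] power_mult[symmetric] power_mult_distrib[symmetric]) simp
    finally show "2 * real (Suc (2 * n)) * ((F w)\<^sup>2) ^ n * R w
      \<le> F w ^ (2 * k) / 2 + (8 * real k) ^ k * R w ^ k" .
  next
    show "integrable \<mu> (\<lambda>w. 2 * real (Suc (2 * n)) * ((F w)\<^sup>2) ^ n * R w)"
      by (intro all_moments_integrable moment_intros mom)
    show "integrable \<mu> (\<lambda>w. F w ^ (2 * k) / 2 + (8 * real k) ^ k * R w ^ k)"
      unfolding divide_inverse by (intro all_moments_integrable moment_intros mom)
  qed
  also have "\<dots> = (LINT w|\<mu>. F w ^ (2 * k)) / 2 + (8 * real k) ^ k * (LINT w|\<mu>. R w ^ k)"
    using mom by (simp add: all_moments_integrable all_moments_power)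
  finally have "(LINT w|\<mu>. F w ^ (2 * k)) \<le> 2 * (8 * real k) ^ k * (LINT w|\<mu>. R w ^ k)"
    by simp
  also have "\<dots> \<le> 2 * (8 * real k) ^ k * (gaussian_moment (2 * k) * (LINT w|\<mu>. R w) ^ k)"
    unfolding R_def by (intro mult_left_mono half_grad_moment_le) auto
  also have "\<dots> = 2 * ((8 * real k) * (LINT w|\<mu>. R w)) ^ k * gaussian_moment (2 * k)"
    by (simp only: power_mult_distrib mult_ac)
  also have "(8 * real k) * (LINT w|\<mu>. R w) = (4 * real k) * (LINT w|\<mu>. (F w)\<^sup>2)"
    by (simp add: second)
  finally show ?thesis
    by (simp only: F_def power_mult_distrib mult_ac)
qed

end

section \<open>Closures in the space of square-integrable functions\<close>

definition L2_closure :: "'a measure \<Rightarrow> ('a \<Rightarrow> real) set \<Rightarrow> ('a \<Rightarrow> real) set" where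
  "L2_closure M S = {F \<in> Lp_space M 2. \<forall>d>0. \<exists>G\<in>S. (LINT x|M. (F x - G x)\<^sup>2) < d}"

lemma L2_closureI:
  assumes "F \<in> Lp_space M 2" "\<And>d. d > 0 \<Longrightarrow> \<exists>G\<in>S. (LINT x|M. (F x - G x)\<^sup>2) < d"
  shows "F \<in> L2_closure M S"
  using assms by (simp add: L2_closure_def)

lemma L2_closureE:
  assumes "F \<in> L2_closure M S" "d > 0"
  obtains G where "G \<in> S" "(LINT x|M. (F x - G x)\<^sup>2) < d"
  using assms by (auto simp: L2_closure_def)

lemma L2_closure_subset_L2: "L2_closure M S \<subseteq> Lp_space M 2"
  by (auto simp: L2_closure_def)

lemma subset_L2_closure: "S \<subseteq> Lp_space M 2 \<Longrightarrow> S \<subseteq> L2_closure M S"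
  by (auto intro!: L2_closureI intro: bexI[rotated])

lemma L2_closure_tendsto:
  assumes "F \<in> Lp_space M 2" "\<And>n. G n \<in> S" "(\<lambda>n. LINT x|M. (F x - G n x)\<^sup>2) \<longlonglongrightarrow> 0"
  shows "F \<in> L2_closure M S"
proof (rule L2_closureI[OF assms(1)])
  fix d :: real assume "d > 0"
  then have "\<forall>\<^sub>F n in sequentially. (LINT x|M. (F x - G n x)\<^sup>2) < d"
    by (rule order_tendstoD(2)[OF assms(3)])
  then show "\<exists>G\<in>S. (LINT x|M. (F x - G x)\<^sup>2) < d"
    using assms(2) by (meson eventually_sequentially order_refl)
qed

lemma L2_closure_closed:
  assumes S: "S \<subseteq> Lp_space M 2" and F: "F \<in> Lp_space M 2"
    and approx: "\<And>d. d > 0 \<Longrightarrow> \<exists>G\<in>L2_closure M S. (LINT x|M. (F x - G x)\<^sup>2) < d"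
  shows "F \<in> L2_closure M S"
proof (rule L2_closureI[OF F])
  fix d :: real assume "d > 0"
  then obtain G where G: "G \<in> L2_closure M S" "(LINT x|M. (F x - G x)\<^sup>2) < d / 4"
    using approx[of "d / 4"] by auto
  obtain H where H: "H \<in> S" "(LINT x|M. (G x - H x)\<^sup>2) < d / 4"
    using L2_closureE[OF G(1), of "d / 4"] \<open>d > 0\<close> by auto
  have "G \<in> Lp_space M 2" "H \<in> Lp_space M 2"
    using G H S by (auto simp: L2_closure_def)
  from L2_integral_triangle_le[OF F this] have "(LINT x|M. (F x - H x)\<^sup>2) < d"
    using G(2) H(2) by linarith
  then show "\<exists>H\<in>S. (LINT x|M. (F x - H x)\<^sup>2) < d"
    using H(1) by blast
qed

lemma L2_closure_lincomb:
  assumes S: "S \<subseteq> Lp_space M 2"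
    and lincomb: "\<And>F G. F \<in> S \<Longrightarrow> G \<in> S \<Longrightarrow> (\<lambda>x. a * F x + b * G x) \<in> S"
    and F: "F \<in> L2_closure M S" and G: "G \<in> L2_closure M S"
  shows "(\<lambda>x. a * F x + b * G x) \<in> L2_closure M S"
proof (rule L2_closureI)
  have L2: "F \<in> Lp_space M 2" "G \<in> Lp_space M 2"
    using F G by (auto simp: L2_closure_def)
  then show "(\<lambda>x. a * F x + b * G x) \<in> Lp_space M 2"
    by (rule L2_lincomb)
  fix d :: real assume "d > 0"
  define d' where "d' = d / (2 * (a\<^sup>2 + b\<^sup>2 + 1))"
  have pos: "2 * (a\<^sup>2 + b\<^sup>2 + 1) > 0"
    by (smt (verit) zero_le_power2)
  then have d': "d' > 0" "2 * (a\<^sup>2 + b\<^sup>2 + 1) * d' = d"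
    using \<open>d > 0\<close> by (auto simp: d'_def)
  obtain F' G' where F': "F' \<in> S" "(LINT x|M. (F x - F' x)\<^sup>2) < d'"
    and G': "G' \<in> S" "(LINT x|M. (G x - G' x)\<^sup>2) < d'"
    using L2_closureE[OF F d'(1)] L2_closureE[OF G d'(1)] by metis
  have diff: "(\<lambda>x. F x - F' x) \<in> Lp_space M 2" "(\<lambda>x. G x - G' x) \<in> Lp_space M 2"
    using L2 F' G' S by (auto intro!: L2_diff)
  have "(LINT x|M. (a * F x + b * G x - (a * F' x + b * G' x))\<^sup>2)
      = (LINT x|M. ((a * (F x - F' x) + 0 * (F x - F' x)) + (b * (G x - G' x) + 0 * (G x - G' x)))\<^sup>2)"
    by (simp add: algebra_simps)
  also have "\<dots> \<le> 2 * (LINT x|M. (a * (F x - F' x) + 0 * (F x - F' x))\<^sup>2)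
      + 2 * (LINT x|M. (b * (G x - G' x) + 0 * (G x - G' x))\<^sup>2)"
    by (intro L2_integral_sum_le L2_lincomb diff)
  also have "\<dots> = 2 * (a\<^sup>2 * (LINT x|M. (F x - F' x)\<^sup>2)) + 2 * (b\<^sup>2 * (LINT x|M. (G x - G' x)\<^sup>2))"
    by (simp add: power_mult_distrib)
  also have "\<dots> \<le> 2 * (a\<^sup>2 * d') + 2 * (b\<^sup>2 * d')"
    using F'(2) G'(2) by (intro add_mono mult_left_mono) auto
  also have "\<dots> < d"
    using d' by (simp add: algebra_simps)
  finally show "\<exists>H\<in>S. (LINT x|M. (a * F x + b * G x - H x)\<^sup>2) < d"
    by (rule bexI[where x = "\<lambda>x. a * F' x + b * G' x"]) (rule lincomb[OF F'(1) G'(1)])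
qed

lemma L2_closure_sum:
  fixes m :: nat
  assumes S: "S \<subseteq> Lp_space M 2" and zero: "(\<lambda>_. 0) \<in> S"
    and lincomb: "\<And>F G a b. F \<in> S \<Longrightarrow> G \<in> S \<Longrightarrow> (\<lambda>x. a * F x + b * G x) \<in> S"
    and F: "\<And>j. F j \<in> L2_closure M S"
  shows "(\<lambda>x. \<Sum>j<m. c j * F j x) \<in> L2_closure M S"
proof (induction m)
  case 0
  then show ?case
    using subsetD[OF subset_L2_closure[OF S] zero] by simp
next
  case (Suc m)
  have "(\<lambda>x. 1 * (\<Sum>j<m. c j * F j x) + c m * F m x) \<in> L2_closure M S"
    by (rule L2_closure_lincomb[OF S _ Suc F]) (rule lincomb)
  then show ?case
    by simp
qed

text \<open>The factor \<open>2 ^ k\<close> comes from the crude bound \<open>\<integral> G\<^sup>2 \<le> 2 \<integral> (G - F)\<^sup>2 + 2 \<integral> F\<^sup>2\<close> for the approximants \<open>G\<close>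
  of \<open>F\<close>.\<close>

lemma (in prob_space) L2_closure_even_moment:
  assumes S: "\<And>G. G \<in> S \<Longrightarrow> all_moments M G"
    and moment: "\<And>G k. G \<in> S \<Longrightarrow> (LINT x|M. G x ^ (2 * k)) \<le> C k * (LINT x|M. (G x)\<^sup>2) ^ k"
    and C: "\<And>k. C k \<ge> 0"
    and F: "F \<in> L2_closure M S"
  shows "integrable M (\<lambda>x. F x ^ (2 * k))"
    and "(LINT x|M. F x ^ (2 * k)) \<le> C k * 2 ^ k * (LINT x|M. (F x)\<^sup>2) ^ k"
proof -
  have F_L2: "F \<in> Lp_space M 2"
    using F by (simp add: L2_closure_def)
  have "\<exists>G\<in>S. (LINT x|M. (F x - G x)\<^sup>2) < 1 / real (Suc n)" for n
    using L2_closureE[OF F, of "1 / real (Suc n)"] by auto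
  then obtain G where G: "\<And>n. G n \<in> S" "\<And>n. (LINT x|M. (F x - G n x)\<^sup>2) < 1 / real (Suc n)"
    by metis
  have G_L2: "G n \<in> Lp_space M 2" for n
    using S[OF G(1)] by (rule all_moments_L2)
  have lim0: "(\<lambda>n. 1 / real (Suc n)) \<longlonglongrightarrow> 0"
    using LIMSEQ_inverse_real_of_nat by (simp add: inverse_eq_divide)
  have lim: "(\<lambda>n. LINT x|M. (G n x - F x)\<^sup>2) \<longlonglongrightarrow> 0"
    by (rule tendsto_sandwich[OF always_eventually always_eventually tendsto_const lim0])
      (auto simp: power2_commute[of "G _ _"] less_imp_le[OF G(2)] simp del: of_nat_Suc)
  obtain r where r: "strict_mono r" "AE x in M. (\<lambda>n. G (r n) x) \<longlonglongrightarrow> F x"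
    using L2_tendsto_AE_subseq[OF G_L2 F_L2 lim] by blast
  define a where "a n = C k * (2 * (LINT x|M. (G n x - F x)\<^sup>2) + 2 * (LINT x|M. (F x)\<^sup>2)) ^ k" for n
  have bound: "(LINT x|M. G n x ^ (2 * k)) \<le> a n" for n
  proof -
    have "(LINT x|M. (G n x)\<^sup>2) \<le> 2 * (LINT x|M. (G n x - F x)\<^sup>2) + 2 * (LINT x|M. (F x)\<^sup>2)"
      using L2_integral_sum_le[OF L2_diff[OF G_L2[of n] F_L2] F_L2] by simp
    then have "(LINT x|M. (G n x)\<^sup>2) ^ k \<le> (2 * (LINT x|M. (G n x - F x)\<^sup>2) + 2 * (LINT x|M. (F x)\<^sup>2)) ^ k"
      by (intro power_mono) simp_all
    then show ?thesis
      unfolding a_def using moment[OF G(1)] C[of k] by (meson mult_left_mono order_trans)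
  qed
  have a_lim: "(\<lambda>n. a (r n)) \<longlonglongrightarrow> C k * (2 * 0 + 2 * (LINT x|M. (F x)\<^sup>2)) ^ k"
    unfolding a_def using LIMSEQ_subseq_LIMSEQ[OF lim r(1)]
    by (intro tendsto_intros) (simp add: o_def)
  have power_lim: "AE x in M. (\<lambda>n. G (r n) x ^ (2 * k)) \<longlonglongrightarrow> F x ^ (2 * k)"
    using r(2) by eventually_elim (rule tendsto_power)
  have int: "integrable M (\<lambda>x. G n x ^ (2 * k))" for n
    using S[OF G(1)] by (intro all_moments_integrable all_moments_power)
  have meas: "(\<lambda>x. F x ^ (2 * k)) \<in> borel_measurable M"
    using F_L2 by (auto simp: Lp_space_def)
  note Fatou = integral_le_limit_Fatou[where g = "\<lambda>n x. G (r n) x ^ (2 * k)",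
      OF int zero_le_even_power meas power_lim bound a_lim]
  show "integrable M (\<lambda>x. F x ^ (2 * k))"
    by (rule Fatou) simp
  have "(LINT x|M. F x ^ (2 * k)) \<le> C k * (2 * 0 + 2 * (LINT x|M. (F x)\<^sup>2)) ^ k"
    by (rule Fatou) simp
  then show "(LINT x|M. F x ^ (2 * k)) \<le> C k * 2 ^ k * (LINT x|M. (F x)\<^sup>2) ^ k"
    by (simp only: add_0 mult_zero_right power_mult_distrib mult.assoc)
qed

lemma (in prob_space) hypercontractive_subspace_closure:
  assumes S: "\<And>G. G \<in> S \<Longrightarrow> all_moments M G"
    and moment: "\<And>G k. G \<in> S \<Longrightarrow> (LINT x|M. G x ^ (2 * k)) \<le> C k * (LINT x|M. (G x)\<^sup>2) ^ k"
    and C: "\<And>k. C k \<ge> 0"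
    and T: "T \<subseteq> L2_closure M S" and zero: "(\<lambda>_. 0) \<in> T"
    and lincomb: "\<And>F G a b. F \<in> T \<Longrightarrow> G \<in> T \<Longrightarrow> (\<lambda>x. a * F x + b * G x) \<in> T"
    and S_lincomb: "\<And>F G a b. F \<in> S \<Longrightarrow> G \<in> S \<Longrightarrow> (\<lambda>x. a * F x + b * G x) \<in> S"
  shows "hypercontractive_subspace M (L2_closure M T) (\<lambda>k. C k * 2 ^ k)"
    and "L2_closure M T \<subseteq> L2_closure M S"
proof -
  have S_L2: "S \<subseteq> Lp_space M 2"
    using S all_moments_L2 by blast
  have T_L2: "T \<subseteq> Lp_space M 2"
    using T L2_closure_subset_L2 by blast
  show sub: "L2_closure M T \<subseteq> L2_closure M S"
  proof
    fix F assume "F \<in> L2_closure M T"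
    then show "F \<in> L2_closure M S"
      using T by (intro L2_closure_closed[OF S_L2]) (auto simp: L2_closure_def, blast)
  qed
  show "hypercontractive_subspace M (L2_closure M T) (\<lambda>k. C k * 2 ^ k)"
  proof
    show "L2_closure M T \<subseteq> Lp_space M 2"
      by (rule L2_closure_subset_L2)
    show "(\<lambda>_. 0) \<in> L2_closure M T"
      by (rule subsetD[OF subset_L2_closure[OF T_L2] zero])
    show "(\<lambda>x. a * F x + b * G x) \<in> L2_closure M T" if "F \<in> L2_closure M T" "G \<in> L2_closure M T" for F G a b
      using that by (intro L2_closure_lincomb[OF T_L2 lincomb])
    show "F \<in> L2_closure M T" if "F \<in> Lp_space M 2"
      "\<And>d. d > 0 \<Longrightarrow> \<exists>G\<in>L2_closure M T. (LINT x|M. (F x - G x)\<^sup>2) < d" for F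
      using that by (rule L2_closure_closed[OF T_L2])
    show "integrable M (\<lambda>x. F x ^ (2 * m))" if "F \<in> L2_closure M T" for F m
      by (rule L2_closure_even_moment(1)[OF S moment C subsetD[OF sub that]])
    show "(LINT x|M. F x ^ (2 * m)) \<le> C m * 2 ^ m * (LINT x|M. (F x)\<^sup>2) ^ m" if "F \<in> L2_closure M T" for F m
      by (rule L2_closure_even_moment(2)[OF S moment C subsetD[OF sub that]])
  qed
qed

text \<open>The pairing with \<open>f \<in> L\<^sup>p\<close> is continuous on the closure for the \<open>L\<^sup>2\<close> norm, although \<open>f\<close> need
  not be square-integrable.\<close>

lemma (in prob_space) orthogonal_L2_closure:
  assumes "hypercontractive_subspace M (L2_closure M S) C"
    and S: "S \<subseteq> Lp_space M 2" and p: "p > 1" and f: "f \<in> Lp_space M p"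
    and orth: "\<And>G. G \<in> S \<Longrightarrow> (LINT x|M. f x * G x) = 0" and F: "F \<in> L2_closure M S"
  shows "(LINT x|M. f x * F x) = 0"
proof -
  interpret hypercontractive_subspace M "L2_closure M S" C
    by fact
  obtain D where D: "D \<ge> 0"
    "\<And>F. F \<in> L2_closure M S \<Longrightarrow> \<bar>LINT x|M. f x * F x\<bar> \<le> D * Lp_norm M p f * Lp_norm M 2 F"
    using pairing_le[OF p] f by blast
  define K where "K = D * Lp_norm M p f"
  have K: "K \<ge> 0"
    using D(1) Lp_norm_nonneg[of M p f] by (simp add: K_def)
  have small: "\<bar>LINT x|M. f x * F x\<bar> \<le> K * d" if d: "d > 0" for d
  proof -
    obtain G where G: "G \<in> S" "(LINT x|M. (F x - G x)\<^sup>2) < d\<^sup>2"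
      using L2_closureE[OF F, of "d\<^sup>2"] d by auto
    have G': "G \<in> L2_closure M S"
      using subset_L2_closure[OF S] G(1) by blast
    have diff: "(\<lambda>x. F x - G x) \<in> L2_closure M S"
      using lincomb[OF F G', of 1 "-1"] by simp
    have "(LINT x|M. f x * (F x - G x)) = (LINT x|M. f x * F x)"
      using pairing_integrable(1)[OF p f F] pairing_integrable(1)[OF p f G'] orth[OF G(1)]
      by (simp add: right_diff_distrib)
    then have "\<bar>LINT x|M. f x * F x\<bar> \<le> K * Lp_norm M 2 (\<lambda>x. F x - G x)"
      using D(2)[OF diff] by (simp add: K_def)
    also have "\<dots> \<le> K * d"
      using G(2) d K by (intro mult_left_mono) (auto simp: Lp_norm_2 intro!: real_le_lsqrt)
    finally show ?thesis .
  qed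
  have "\<bar>LINT x|M. f x * F x\<bar> \<le> 0 + d" if "d > 0" for d
  proof -
    have "K * (d / (K + 1)) \<le> d"
      using K that by (simp add: field_simps)
    then show ?thesis
      using small[of "d / (K + 1)"] K that by simp
  qed
  then have "\<bar>LINT x|M. f x * F x\<bar> \<le> 0"
    by (rule field_le_epsilon)
  then show ?thesis by simp
qed

section \<open>The first two Wiener chaoses\<close>

context abstract_wiener_space
begin

text \<open>The map that sends \<open>e \<phi>\<close> to \<open>\<phi>\<close> is an isometry into \<open>L\<^sup>2\<close> with dense domain, so it extends to \<open>H\<close>.\<close>

lemma wiener_integral_exists:
  "\<exists>F. F \<in> Lp_space \<mu> 2 \<and> (\<forall>\<phi> :: nat \<Rightarrow> 'w \<Rightarrow>\<^sub>L real. (\<lambda>k. e (\<phi> k)) \<longlonglongrightarrow> h \<longrightarrow>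
     (\<lambda>k. Lp_norm \<mu> 2 (\<lambda>w. F w - blinfun_apply (\<phi> k) w)) \<longlonglongrightarrow> 0)"
  and dual_approximation: "\<exists>\<phi> :: nat \<Rightarrow> 'w \<Rightarrow>\<^sub>L real. (\<lambda>k. e (\<phi> k)) \<longlonglongrightarrow> h"
proof -
  have "h \<in> closure (range e)"
    using dual_dense by simp
  then obtain x where x: "\<And>n. x n \<in> range e" "x \<longlonglongrightarrow> h"
    unfolding closure_sequential by blast
  then obtain \<phi> where \<phi>: "\<And>n. x n = e (\<phi> n)"
    unfolding image_iff by metis
  have lim: "(\<lambda>k. e (\<phi> k)) \<longlonglongrightarrow> h"
    using x(2) by (simp add: \<phi>[abs_def])
  then show "\<exists>\<phi> :: nat \<Rightarrow> 'w \<Rightarrow>\<^sub>L real. (\<lambda>k. e (\<phi> k)) \<longlonglongrightarrow> h"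
    by blast
  have L2: "blinfun_apply \<psi> \<in> Lp_space \<mu> 2" for \<psi> :: "'w \<Rightarrow>\<^sub>L real"
    by (rule all_moments_L2[OF functional_all_moments])
  have isometry: "(LINT w|\<mu>. (blinfun_apply \<psi> w - blinfun_apply \<psi>' w)\<^sup>2) = (norm (e \<psi> - e \<psi>'))\<^sup>2" for \<psi> \<psi>'
    using functional_second_moment[of "\<psi> - \<psi>'"] by (simp add: blinfun.diff_left dual_embedding_simps)
  obtain F where F: "F \<in> Lp_space \<mu> 2" "(\<lambda>k. LINT w|\<mu>. (\<phi> k w - F w)\<^sup>2) \<longlonglongrightarrow> 0"
  proof (atomize_elim, unfold Bex_def[symmetric], rule L2_complete[OF L2])
    fix d :: real assume "d > 0"
    then obtain N where N: "\<And>m n. m \<ge> N \<Longrightarrow> n \<ge> N \<Longrightarrow> norm (e (\<phi> m) - e (\<phi> n)) < sqrt d"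
      using CauchyD[OF LIMSEQ_imp_Cauchy[OF lim], of "sqrt d"] by auto
    have "(norm (e (\<phi> m) - e (\<phi> n)))\<^sup>2 < d" if "m \<ge> N" "n \<ge> N" for m n
      using N[OF that] \<open>d > 0\<close> by (metis norm_ge_zero power_strict_mono real_sqrt_pow2 less_imp_le zero_less_numeral)
    then show "\<exists>N. \<forall>m\<ge>N. \<forall>n\<ge>N. (LINT w|\<mu>. (\<phi> m w - \<phi> n w)\<^sup>2) < d"
      unfolding isometry by blast
  qed
  have "(\<lambda>k. Lp_norm \<mu> 2 (\<lambda>w. F w - \<psi> k w)) \<longlonglongrightarrow> 0"
    if \<psi>: "(\<lambda>k. e (\<psi> k)) \<longlonglongrightarrow> h" for \<psi> :: "nat \<Rightarrow> 'w \<Rightarrow>\<^sub>L real"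
  proof -
    have "(\<lambda>k. LINT w|\<mu>. (F w - \<psi> k w)\<^sup>2) \<longlonglongrightarrow> 0"
    proof (rule tendsto_sandwich[OF always_eventually always_eventually tendsto_const])
      show "\<forall>k. (LINT w|\<mu>. (F w - \<psi> k w)\<^sup>2) \<le> 2 * (LINT w|\<mu>. (\<phi> k w - F w)\<^sup>2) + 2 * (norm (e (\<phi> k) - e (\<psi> k)))\<^sup>2"
        using L2_integral_triangle_le[OF F(1) L2 L2] by (auto simp: isometry power2_commute[of "F _"])
      show "(\<lambda>k. 2 * (LINT w|\<mu>. (\<phi> k w - F w)\<^sup>2) + 2 * (norm (e (\<phi> k) - e (\<psi> k)))\<^sup>2) \<longlonglongrightarrow> 0"
      proof -
        have d: "(\<lambda>k. e (\<phi> k) - e (\<psi> k)) \<longlonglongrightarrow> 0"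
          using tendsto_diff[OF lim \<psi>] by simp
        show ?thesis
          using tendsto_add[OF tendsto_mult_left[OF F(2), of 2]
              tendsto_mult_left[OF tendsto_power[OF tendsto_norm[OF d], of 2], of 2]]
          by simp
      qed
    qed auto
    then show ?thesis
      unfolding Lp_norm_2 using tendsto_real_sqrt by fastforce
  qed
  then show "\<exists>F. F \<in> Lp_space \<mu> 2 \<and> (\<forall>\<phi> :: nat \<Rightarrow> 'w \<Rightarrow>\<^sub>L real. (\<lambda>k. e (\<phi> k)) \<longlonglongrightarrow> h \<longrightarrow>
     (\<lambda>k. Lp_norm \<mu> 2 (\<lambda>w. F w - blinfun_apply (\<phi> k) w)) \<longlonglongrightarrow> 0)"
    using F(1) by blast
qed

lemma
  shows wiener_integral_L2: "wiener_integral \<iota> \<mu> h \<in> Lp_space \<mu> 2"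
    and wiener_integral_limit: "(\<lambda>k. e (\<phi> k)) \<longlonglongrightarrow> h \<Longrightarrow>
      (\<lambda>k. LINT w|\<mu>. (wiener_integral \<iota> \<mu> h w - blinfun_apply (\<phi> k) w)\<^sup>2) \<longlonglongrightarrow> 0"
proof -
  note * = someI_ex[OF wiener_integral_exists[of h], folded wiener_integral_def]
  show "wiener_integral \<iota> \<mu> h \<in> Lp_space \<mu> 2"
    using * by blast
  assume "(\<lambda>k. e (\<phi> k)) \<longlonglongrightarrow> h"
  with * have "(\<lambda>k. Lp_norm \<mu> 2 (\<lambda>w. wiener_integral \<iota> \<mu> h w - blinfun_apply (\<phi> k) w)) \<longlonglongrightarrow> 0"
    by blast
  from tendsto_power[OF this, of 2]
  show "(\<lambda>k. LINT w|\<mu>. (wiener_integral \<iota> \<mu> h w - blinfun_apply (\<phi> k) w)\<^sup>2) \<longlonglongrightarrow> 0"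
    by (simp add: Lp_norm_2)
qed

lemma quad_lincomb:
  "\<exists>m'' c'' \<phi>''. (\<lambda>w. a * quad m c \<phi> w + b * quad m' c' \<phi>' w) = quad m'' c'' \<phi>''"
proof (intro exI ext)
  fix w
  define d where "d j = (if j < m then a * c j else b * c' (j - m))" for j
  define \<psi> where "\<psi> j = (if j < m then \<phi> j else \<phi>' (j - m))" for j
  define s where "s (\<eta> :: 'w \<Rightarrow>\<^sub>L real) = (\<eta> w)\<^sup>2 - (norm (e \<eta>))\<^sup>2" for \<eta>
  have "(\<Sum>j<m + m'. d j * s (\<psi> j)) = (\<Sum>j<m. d j * s (\<psi> j)) + (\<Sum>j<m'. d (j + m) * s (\<psi> (j + m)))"
    by (induction m') (simp_all add: add.commute add.left_commute)
  then show "a * quad m c \<phi> w + b * quad m' c' \<phi>' w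
    = quad (m + m') (\<lambda>j. if j < m then a * c j else b * c' (j - m)) (\<lambda>j. if j < m then \<phi> j else \<phi>' (j - m)) w"
    by (simp add: quad_def d_def[symmetric] \<psi>_def[symmetric] s_def[symmetric])
      (simp add: d_def \<psi>_def sum_distrib_left mult.assoc)
qed

lemma multiple_integral_1_closure:
  "multiple_integral \<iota> \<mu> 1 h \<in> L2_closure \<mu> (range blinfun_apply)"
proof (cases "h = 0")
  case True
  have "blinfun_apply (0 :: 'w \<Rightarrow>\<^sub>L real) \<in> L2_closure \<mu> (range blinfun_apply)"
    by (rule subsetD[OF subset_L2_closure]) (auto intro: all_moments_L2[OF functional_all_moments])
  moreover have "multiple_integral \<iota> \<mu> 1 h = blinfun_apply (0 :: 'w \<Rightarrow>\<^sub>L real)"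
    using True by (intro ext) (simp add: multiple_integral_def)
  ultimately show ?thesis by simp
next
  case False
  then have eq: "multiple_integral \<iota> \<mu> 1 h = wiener_integral \<iota> \<mu> h"
    by (intro ext) (simp add: multiple_integral_def)
  obtain \<phi> where "(\<lambda>k. e (\<phi> k)) \<longlonglongrightarrow> h"
    using dual_approximation by blast
  from wiener_integral_limit[OF this] show ?thesis
    unfolding eq by (rule L2_closure_tendsto[OF wiener_integral_L2, rotated]) simp
qed

text \<open>The difference is itself a \<open>quad\<close>, so its second moment is given by the recursion.\<close>

lemma square_diff_second_moment:
  defines "q \<equiv> \<lambda>(\<phi> :: 'w \<Rightarrow>\<^sub>L real) w. (blinfun_apply \<phi> w)\<^sup>2 - (norm (e \<phi>))\<^sup>2"
  shows "(LINT w|\<mu>. (q \<phi> w - q \<psi> w)\<^sup>2) \<le> 4 * (norm (e \<phi> - e \<psi>))\<^sup>2 * ((norm (e \<phi>))\<^sup>2 + (norm (e \<psi>))\<^sup>2)"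
proof -
  define c where "c j = (if j = 0 then 1 else - 1 :: real)" for j :: nat
  define \<eta> where "\<eta> j = (if j = 0 then \<phi> else \<psi>)" for j :: nat
  have q: "q \<phi> w - q \<psi> w = quad 2 c \<eta> w" for w
    by (simp add: q_def quad_def numeral_2_eq_2 c_def \<eta>_def)
  have Z: "half_grad 2 c \<eta> w = \<phi> w *\<^sub>R (e \<phi> - e \<psi>) + (\<phi> - \<psi>) w *\<^sub>R e \<psi>" for w
    by (simp add: half_grad_def numeral_2_eq_2 c_def \<eta>_def blinfun.diff_left algebra_simps)
  have "(LINT w|\<mu>. (q \<phi> w - q \<psi> w)\<^sup>2) = 2 * (LINT w|\<mu>. (norm (half_grad 2 c \<eta> w))\<^sup>2)"
    using quad_moment_recursion[of 2 c \<eta> 1] by (simp add: q numeral_2_eq_2)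
  also have "(LINT w|\<mu>. (norm (half_grad 2 c \<eta> w))\<^sup>2)
      \<le> (LINT w|\<mu>. 2 * ((norm (e \<phi> - e \<psi>))\<^sup>2 * (\<phi> w)\<^sup>2) + 2 * ((norm (e \<psi>))\<^sup>2 * ((\<phi> - \<psi>) w)\<^sup>2))"
  proof (rule integral_mono)
    show "(norm (half_grad 2 c \<eta> w))\<^sup>2
        \<le> 2 * ((norm (e \<phi> - e \<psi>))\<^sup>2 * (\<phi> w)\<^sup>2) + 2 * ((norm (e \<psi>))\<^sup>2 * ((\<phi> - \<psi>) w)\<^sup>2)" for w
    proof -
      have "(norm (half_grad 2 c \<eta> w))\<^sup>2 \<le> (norm (\<phi> w *\<^sub>R (e \<phi> - e \<psi>)) + norm ((\<phi> - \<psi>) w *\<^sub>R e \<psi>))\<^sup>2"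
        unfolding Z by (intro power_mono norm_triangle_ineq norm_ge_zero)
      also have "\<dots> \<le> 2 * (norm (\<phi> w *\<^sub>R (e \<phi> - e \<psi>)))\<^sup>2 + 2 * (norm ((\<phi> - \<psi>) w *\<^sub>R e \<psi>))\<^sup>2"
        by (rule square_sum_le)
      finally show ?thesis
        by (simp add: power_mult_distrib mult_ac)
    qed
  qed (intro all_moments_integrable half_grad_sq_all_moments moment_intros)+
  also have "\<dots> = 2 * ((norm (e \<phi> - e \<psi>))\<^sup>2 * (norm (e \<phi>))\<^sup>2)
      + 2 * ((norm (e \<psi>))\<^sup>2 * (norm (e (\<phi> - \<psi>)))\<^sup>2)"
    unfolding functional_second_moment[symmetric]
    by (subst Bochner_Integration.integral_add) (auto intro!: all_moments_integrable moment_intros)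
  also have "\<dots> = 2 * (norm (e \<phi> - e \<psi>))\<^sup>2 * ((norm (e \<phi>))\<^sup>2 + (norm (e \<psi>))\<^sup>2)"
    by (simp add: dual_embedding_simps algebra_simps)
  finally show ?thesis by simp
qed

text \<open>For \<open>\<phi>\<^sub>k\<close> with \<open>e \<phi>\<^sub>k \<longlonglongrightarrow> h\<close>, convergence of \<open>\<phi>\<^sub>k\<close> to \<open>\<delta>(h)\<close> in \<open>L\<^sup>2\<close> says nothing about the \<open>L\<^sup>2\<close> distance of the
  squares. But the functions \<open>\<phi>\<^sub>k\<^sup>2 - \<parallel>e \<phi>\<^sub>k\<parallel>\<^sup>2\<close> form a Cauchy sequence in \<open>L\<^sup>2\<close>, and a subsequence converges to
  \<open>\<delta>(h)\<^sup>2 - \<parallel>h\<parallel>\<^sup>2\<close> almost everywhere.\<close>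

lemma multiple_integral_2_closure:
  "multiple_integral \<iota> \<mu> 2 h \<in> L2_closure \<mu> {quad m c \<phi> |m c \<phi>. True}"
proof (cases "h = 0")
  case True
  have "quad 0 (\<lambda>_. 0) (\<lambda>_. 0) \<in> L2_closure \<mu> {quad m c \<phi> |m c \<phi>. True}"
    by (rule subsetD[OF subset_L2_closure]) (auto intro: all_moments_L2[OF quad_all_moments])
  moreover have "multiple_integral \<iota> \<mu> 2 h = quad 0 (\<lambda>_. 0) (\<lambda>_. 0)"
    using True by (intro ext) (simp add: multiple_integral_def quad_def)
  ultimately show ?thesis by simp
next
  case False
  define \<delta> where "\<delta> = wiener_integral \<iota> \<mu> h"
  define G where "G w = (\<delta> w)\<^sup>2 - (norm h)\<^sup>2" for w
  have eq: "multiple_integral \<iota> \<mu> 2 h = G"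
    using False
    by (intro ext) (simp add: multiple_integral_def G_def \<delta>_def numeral_2_eq_2 field_simps)
  have \<delta>_L2: "\<delta> \<in> Lp_space \<mu> 2"
    unfolding \<delta>_def by (rule wiener_integral_L2)
  have G_meas: "G \<in> borel_measurable \<mu>"
    using \<delta>_L2 unfolding G_def[abs_def] by (auto simp: Lp_space_def)
  obtain \<phi> where \<phi>: "(\<lambda>k. e (\<phi> k)) \<longlonglongrightarrow> h"
    using dual_approximation by blast
  define q where "q k w = (blinfun_apply (\<phi> k) w)\<^sup>2 - (norm (e (\<phi> k)))\<^sup>2" for k w
  have q_quad: "q k = quad 1 (\<lambda>_. 1) (\<lambda>_. \<phi> k)" for k
    by (intro ext) (simp add: q_def quad_def)
  have q_L2: "q k \<in> Lp_space \<mu> 2" for k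
    unfolding q_quad by (rule all_moments_L2[OF quad_all_moments])
  have "(\<lambda>k. LINT w|\<mu>. (\<phi> k w - \<delta> w)\<^sup>2) \<longlonglongrightarrow> 0"
    using wiener_integral_limit[OF \<phi>] by (simp add: \<delta>_def power2_commute)
  then obtain r where r: "strict_mono r" "AE w in \<mu>. (\<lambda>n. \<phi> (r n) w) \<longlonglongrightarrow> \<delta> w"
    using L2_tendsto_AE_subseq[OF all_moments_L2[OF functional_all_moments] \<delta>_L2] by blast
  have \<phi>r: "(\<lambda>n. e (\<phi> (r n))) \<longlonglongrightarrow> h"
    using LIMSEQ_subseq_LIMSEQ[OF \<phi> r(1)] by (simp add: o_def)
  have q_lim: "AE w in \<mu>. (\<lambda>n. q (r n) w) \<longlonglongrightarrow> G w"
    using r(2)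
  proof eventually_elim
    case (elim w)
    then show ?case
      unfolding q_def G_def by (intro tendsto_intros \<phi>r)
  qed
  define a where "a k v = 4 * (norm (v - e (\<phi> k)))\<^sup>2 * ((norm v)\<^sup>2 + (norm (e (\<phi> k)))\<^sup>2)" for k v
  have q_dist: "(LINT w|\<mu>. (q (r n) w - q k w)\<^sup>2) \<le> a k (e (\<phi> (r n)))" for n k
    unfolding q_def a_def by (rule square_diff_second_moment)
  have a_lim: "(\<lambda>n. a k (e (\<phi> (r n)))) \<longlonglongrightarrow> a k h" for k
    unfolding a_def by (intro tendsto_intros \<phi>r)
  note Fatou = L2_limit_Fatou[OF q_L2 G_meas q_L2 q_lim q_dist a_lim]
  have "(\<lambda>k. LINT w|\<mu>. (G w - q k w)\<^sup>2) \<longlonglongrightarrow> 0"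
  proof (rule tendsto_sandwich[OF always_eventually always_eventually tendsto_const])
    show "\<forall>k. (LINT w|\<mu>. (G w - q k w)\<^sup>2) \<le> a k h"
      using Fatou(2) by blast
    have "(\<lambda>k. a k h) \<longlonglongrightarrow> 4 * (norm (h - h))\<^sup>2 * ((norm h)\<^sup>2 + (norm h)\<^sup>2)"
      unfolding a_def by (intro tendsto_intros \<phi>)
    then show "(\<lambda>k. a k h) \<longlonglongrightarrow> 0"
      by simp
  qed auto
  then show ?thesis
    unfolding eq by (rule L2_closure_tendsto[OF Fatou(1), rotated]) (auto simp: q_quad)
qed

definition multiple_integral_span :: "nat \<Rightarrow> ('w \<Rightarrow> real) set" where
  "multiple_integral_span n = {\<lambda>w. \<Sum>j<m. c j * multiple_integral \<iota> \<mu> n (h j) w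
     |m c (h :: nat \<Rightarrow> 'h). True}"

lemma wiener_chaos_eq_closure: "wiener_chaos \<iota> \<mu> n = L2_closure \<mu> (multiple_integral_span n)"
proof -
  let ?S = "multiple_integral_span n"
  have lt: "Lp_norm \<mu> 2 F < d \<longleftrightarrow> (LINT w|\<mu>. (F w)\<^sup>2) < d\<^sup>2" if "d > 0" for F d
  proof
    assume "Lp_norm \<mu> 2 F < d"
    then have "(Lp_norm \<mu> 2 F)\<^sup>2 < d\<^sup>2"
      by (intro power_strict_mono) (auto simp: Lp_norm_nonneg)
    then show "(LINT w|\<mu>. (F w)\<^sup>2) < d\<^sup>2"
      by (simp add: Lp_norm_2)
  next
    assume "(LINT w|\<mu>. (F w)\<^sup>2) < d\<^sup>2"
    then show "Lp_norm \<mu> 2 F < d"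
      using that by (simp add: Lp_norm_2 real_less_lsqrt)
  qed
  have "(\<forall>d>0. \<exists>(m::nat) c h. Lp_norm \<mu> 2 (\<lambda>w. F w - (\<Sum>j<m. c j * multiple_integral \<iota> \<mu> n (h j) w)) < d)
      \<longleftrightarrow> (\<forall>d>0. \<exists>G\<in>?S. (LINT w|\<mu>. (F w - G w)\<^sup>2) < d)" for F
  proof (intro iffI allI impI)
    fix d :: real assume d: "d > 0"
      and *: "\<forall>d>0. \<exists>(m::nat) c h. Lp_norm \<mu> 2 (\<lambda>w. F w - (\<Sum>j<m. c j * multiple_integral \<iota> \<mu> n (h j) w)) < d"
    then obtain m :: nat and c h where "Lp_norm \<mu> 2 (\<lambda>w. F w - (\<Sum>j<m. c j * multiple_integral \<iota> \<mu> n (h j) w)) < sqrt d"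
      by (meson real_sqrt_gt_zero)
    then have "(LINT w|\<mu>. (F w - (\<Sum>j<m. c j * multiple_integral \<iota> \<mu> n (h j) w))\<^sup>2) < d"
      using d by (simp add: lt)
    then show "\<exists>G\<in>?S. (LINT w|\<mu>. (F w - G w)\<^sup>2) < d"
      by (rule bexI[where x = "\<lambda>w. \<Sum>j<m. c j * multiple_integral \<iota> \<mu> n (h j) w"])
        (auto simp: multiple_integral_span_def)
  next
    fix d :: real assume d: "d > 0" and *: "\<forall>d>0. \<exists>G\<in>?S. (LINT w|\<mu>. (F w - G w)\<^sup>2) < d"
    then obtain G where "G \<in> ?S" and G: "(LINT w|\<mu>. (F w - G w)\<^sup>2) < d\<^sup>2"
      by (meson zero_less_power)
    then obtain m :: nat and c h where "G = (\<lambda>w. \<Sum>j<m. c j * multiple_integral \<iota> \<mu> n (h j) w)"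
      unfolding multiple_integral_span_def by blast
    with G show "\<exists>(m::nat) c h. Lp_norm \<mu> 2 (\<lambda>w. F w - (\<Sum>j<m. c j * multiple_integral \<iota> \<mu> n (h j) w)) < d"
      unfolding lt[OF d] by blast
  qed
  then show ?thesis
    by (simp add: wiener_chaos_def L2_closure_def)
qed

lemma multiple_integral_span_lincomb:
  assumes "F \<in> multiple_integral_span n" "G \<in> multiple_integral_span n"
  shows "(\<lambda>w. a * F w + b * G w) \<in> multiple_integral_span n"
proof -
  obtain m :: nat and c h where F: "F = (\<lambda>w. \<Sum>j<m. c j * multiple_integral \<iota> \<mu> n (h j) w)"
    using assms(1) unfolding multiple_integral_span_def by blast
  obtain m' :: nat and c' h' where G: "G = (\<lambda>w. \<Sum>j<m'. c' j * multiple_integral \<iota> \<mu> n (h' j) w)"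
    using assms(2) unfolding multiple_integral_span_def by blast
  define d where "d j = (if j < m then a * c j else b * c' (j - m))" for j
  define k where "k j = (if j < m then h j else h' (j - m))" for j
  have "a * F w + b * G w = (\<Sum>j<m + m'. d j * multiple_integral \<iota> \<mu> n (k j) w)" for w
  proof -
    have "(\<Sum>j<m + m'. d j * multiple_integral \<iota> \<mu> n (k j) w)
      = (\<Sum>j<m. d j * multiple_integral \<iota> \<mu> n (k j) w) + (\<Sum>j<m'. d (j + m) * multiple_integral \<iota> \<mu> n (k (j + m)) w)"
      by (induction m') (simp_all add: add.commute add.left_commute)
    then show ?thesis
      by (simp add: F G d_def k_def sum_distrib_left mult.assoc)
  qed
  then show ?thesis
    unfolding multiple_integral_span_def by blast
qed

text \<open>\<open>S\<close> stands for a space of concrete functions with known moments whose \<open>L\<^sup>2\<close> closure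
  contains the chaos: the functionals for \<open>n = 1\<close>, the functions \<open>quad\<close> for \<open>n = 2\<close>.\<close>

lemma wiener_chaos_hypercontractive:
  assumes S: "\<And>G. G \<in> S \<Longrightarrow> all_moments \<mu> G"
    and zero: "(\<lambda>_. 0) \<in> S"
    and S_lincomb: "\<And>F G a b. F \<in> S \<Longrightarrow> G \<in> S \<Longrightarrow> (\<lambda>w. a * F w + b * G w) \<in> S"
    and moment: "\<And>G k. G \<in> S \<Longrightarrow> (LINT w|\<mu>. G w ^ (2 * k)) \<le> C k * (LINT w|\<mu>. (G w)\<^sup>2) ^ k"
    and C: "\<And>k. C k \<ge> 0"
    and approx: "\<And>h. multiple_integral \<iota> \<mu> n h \<in> L2_closure \<mu> S"
  shows "hypercontractive_subspace \<mu> (wiener_chaos \<iota> \<mu> n) (\<lambda>k. C k * 2 ^ k)"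
    and "hypercontractive_subspace \<mu> (L2_closure \<mu> S) (\<lambda>k. C k * 2 ^ k)"
    and "wiener_chaos \<iota> \<mu> n \<subseteq> L2_closure \<mu> S"
proof -
  define T where "T = multiple_integral_span n"
  have S_L2: "S \<subseteq> Lp_space \<mu> 2"
    using S all_moments_L2 by blast
  have T: "T \<subseteq> L2_closure \<mu> S"
    using L2_closure_sum[OF S_L2 zero S_lincomb approx] unfolding T_def multiple_integral_span_def by blast
  have T_zero: "(\<lambda>_. 0) \<in> T"
    unfolding T_def multiple_integral_span_def by (rule CollectI, rule exI[of _ 0]) simp
  note T_lincomb = multiple_integral_span_lincomb[of _ n, folded T_def]
  have chaos: "wiener_chaos \<iota> \<mu> n = L2_closure \<mu> T"
    unfolding T_def by (rule wiener_chaos_eq_closure)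
  show "hypercontractive_subspace \<mu> (wiener_chaos \<iota> \<mu> n) (\<lambda>k. C k * 2 ^ k)"
    unfolding chaos
    by (rule hypercontractive_subspace_closure(1)[where S = S and T = T])
      (fact S moment C T T_zero T_lincomb S_lincomb)+
  show "wiener_chaos \<iota> \<mu> n \<subseteq> L2_closure \<mu> S"
    unfolding chaos
    by (rule hypercontractive_subspace_closure(2)[where S = S and T = T])
      (fact S moment C T T_zero T_lincomb S_lincomb)+
  show "hypercontractive_subspace \<mu> (L2_closure \<mu> S) (\<lambda>k. C k * 2 ^ k)"
    by (rule hypercontractive_subspace_closure(1)[where S = S and T = S])
      (fact S moment C subset_L2_closure[OF S_L2] zero S_lincomb)+
qed

text \<open>The projection \<open>proj\<close> is given by the defining formula of \<open>chaos_projection_L2\<close>, so it is one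
  admissible extension to \<open>L\<^sup>p\<close>. Hence \<open>chaos_projection\<close>, being a choice among the admissible extensions,
  is one of them, and all of them vanish on functions orthogonal to the chaos.\<close>

lemma orthogonal_span_imp_chaos_projection_zero:
  assumes p: "p > 1" and f: "f \<in> Lp_space \<mu> p"
    and S: "\<And>G. G \<in> S \<Longrightarrow> all_moments \<mu> G"
    and chaos: "hypercontractive_subspace \<mu> (wiener_chaos \<iota> \<mu> n) C"
    and closure: "hypercontractive_subspace \<mu> (L2_closure \<mu> S) C"
    and sub: "wiener_chaos \<iota> \<mu> n \<subseteq> L2_closure \<mu> S"
    and orth: "\<And>G. G \<in> S \<Longrightarrow> (LINT w|\<mu>. f w * G w) = 0"
  shows "AE w in \<mu>. chaos_projection \<iota> \<mu> n p f w = 0"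
proof -
  interpret V: hypercontractive_subspace \<mu> "wiener_chaos \<iota> \<mu> n" C
    by fact
  have proj: "V.proj = chaos_projection_L2 \<iota> \<mu> n"
    by (intro ext) (simp add: V.proj_def chaos_projection_L2_def)
  have "is_chaos_extension \<iota> \<mu> n p V.proj"
    unfolding is_chaos_extension_def
  proof (intro conjI ballI allI)
    show "V.proj g \<in> Lp_space \<mu> p" if "g \<in> Lp_space \<mu> p" for g
      using V.in_Lp[OF V.proj_in[OF p that], of p] p by simp
    show "AE w in \<mu>. V.proj (\<lambda>x. a * g x + b * k x) w = a * V.proj g w + b * V.proj k w"
      if "g \<in> Lp_space \<mu> p" "k \<in> Lp_space \<mu> p" for g k a b
      using that by (rule V.proj_lincomb[OF p])
    show "\<exists>C. \<forall>g\<in>Lp_space \<mu> p. Lp_norm \<mu> p (V.proj g) \<le> C * Lp_norm \<mu> p g"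
      by (rule V.proj_bounded[OF p])
  qed (simp add: proj)
  then have ext: "is_chaos_extension \<iota> \<mu> n p (chaos_projection \<iota> \<mu> n p)"
    unfolding chaos_projection_def by (rule someI[of "is_chaos_extension \<iota> \<mu> n p"])
  then obtain C' where C': "\<And>g. g \<in> Lp_space \<mu> p \<Longrightarrow>
      Lp_norm \<mu> p (chaos_projection \<iota> \<mu> n p g) \<le> C' * Lp_norm \<mu> p g"
    unfolding is_chaos_extension_def by blast
  show ?thesis
  proof (rule V.extension_unique_zero[OF p f _ _ _ C'])
    have "S \<subseteq> Lp_space \<mu> 2"
      using S all_moments_L2 by blast
    then show "(LINT w|\<mu>. f w * F w) = 0" if "F \<in> wiener_chaos \<iota> \<mu> n" for F
      using orthogonal_L2_closure[OF closure _ p f orth] that sub by blast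
    show "AE w in \<mu>. chaos_projection \<iota> \<mu> n p g w = V.proj g w"
      if "g \<in> Lp_space \<mu> p" "g \<in> Lp_space \<mu> 2" for g
      using ext that unfolding is_chaos_extension_def proj by blast
  qed (use ext in \<open>unfold is_chaos_extension_def, blast+\<close>)
qed

lemma chaos_projection_1_zero:
  assumes "p > 1" "f \<in> Lp_space \<mu> p"
    and "\<And>\<phi> :: 'w \<Rightarrow>\<^sub>L real. (LINT w|\<mu>. f w * \<phi> w) = 0"
  shows "AE w in \<mu>. chaos_projection \<iota> \<mu> 1 p f w = 0"
proof -
  define S :: "('w \<Rightarrow> real) set" where "S = range blinfun_apply"
  have S: "all_moments \<mu> G" if "G \<in> S" for G
    using that functional_all_moments by (auto simp: S_def)
  have zero: "(\<lambda>_. 0) \<in> S"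
    unfolding S_def by (rule range_eqI[of _ _ 0]) auto
  have lincomb: "(\<lambda>w. a * F w + b * G w) \<in> S" if FG: "F \<in> S" "G \<in> S" for F G a b
  proof -
    obtain \<phi> \<psi> where "F = blinfun_apply \<phi>" "G = blinfun_apply \<psi>"
      using FG by (auto simp: S_def)
    then have "(\<lambda>w. a * F w + b * G w) = blinfun_apply (a *\<^sub>R \<phi> + b *\<^sub>R \<psi>)"
      by (auto simp: blinfun.add_left blinfun.scaleR_left)
    then show ?thesis by (simp add: S_def)
  qed
  have moment: "(LINT w|\<mu>. G w ^ (2 * k)) \<le> gaussian_moment (2 * k) * (LINT w|\<mu>. (G w)\<^sup>2) ^ k"
    if "G \<in> S" for G k
    using that
    by (auto simp: S_def functional_second_moment functional_moment[of _ "2 * k"] power_mult[of "norm _" 2 k])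
  have approx: "multiple_integral \<iota> \<mu> 1 h \<in> L2_closure \<mu> S" for h
    unfolding S_def by (rule multiple_integral_1_closure)
  note hyper = wiener_chaos_hypercontractive[where S = S and n = 1 and C = "\<lambda>k. gaussian_moment (2 * k)",
      OF S zero lincomb moment gaussian_moment_even_nonneg approx]
  show ?thesis
    by (rule orthogonal_span_imp_chaos_projection_zero[OF assms(1,2) S hyper])
      (use assms(3) in \<open>auto simp: S_def\<close>)
qed

lemma chaos_projection_2_zero:
  assumes "p > 1" "f \<in> Lp_space \<mu> p"
    and "\<And>m c \<phi>. (LINT w|\<mu>. f w * quad m c \<phi> w) = 0"
  shows "AE w in \<mu>. chaos_projection \<iota> \<mu> 2 p f w = 0"
proof -
  define S where "S = {quad m c \<phi> |m c \<phi>. True}"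
  have S: "all_moments \<mu> G" if "G \<in> S" for G
    using that quad_all_moments by (auto simp: S_def)
  have zero: "(\<lambda>_. 0) \<in> S"
    unfolding S_def by (rule CollectI, rule exI[of _ 0]) (auto simp: quad_def fun_eq_iff)
  have lincomb: "(\<lambda>w. a * F w + b * G w) \<in> S" if "F \<in> S" "G \<in> S" for F G a b
    using that quad_lincomb unfolding S_def by blast
  have moment: "(LINT w|\<mu>. G w ^ (2 * k))
      \<le> 2 * (4 * real k) ^ k * gaussian_moment (2 * k) * (LINT w|\<mu>. (G w)\<^sup>2) ^ k"
    if "G \<in> S" for G k
    using that quad_moment_le unfolding S_def by blast
  have C: "2 * (4 * real k) ^ k * gaussian_moment (2 * k) \<ge> 0" for k
    using gaussian_moment_even_nonneg by simp
  have approx: "multiple_integral \<iota> \<mu> 2 h \<in> L2_closure \<mu> S" for h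
    unfolding S_def by (rule multiple_integral_2_closure)
  note hyper = wiener_chaos_hypercontractive[where S = S and n = 2
      and C = "\<lambda>k. 2 * (4 * real k) ^ k * gaussian_moment (2 * k)", OF S zero lincomb moment C approx]
  show ?thesis
    by (rule orthogonal_span_imp_chaos_projection_zero[OF assms(1,2) S hyper])
      (use assms(3) in \<open>auto simp: S_def\<close>)
qed

end

section \<open>Consequences of convergence in total variation\<close>

lemma (in prob_space) char_shift:
  assumes [measurable]: "Z \<in> borel_measurable M"
  shows "char (distr M borel (\<lambda>\<omega>. Z \<omega> + c)) t = iexp (t * c) * char (distr M borel Z) t"
proof -
  have "char (distr M borel (\<lambda>\<omega>. Z \<omega> + c)) t = (CLINT \<omega>|M. iexp (t * c) * iexp (t * Z \<omega>))"
    by (simp add: char_def integral_distr distrib_left exp_add mult.commute)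
  then show ?thesis
    by (simp add: char_def integral_distr)
qed

lemma (in prob_space) char_scale:
  assumes [measurable]: "Z \<in> borel_measurable M"
  shows "char (distr M borel (\<lambda>\<omega>. Z \<omega> / c)) (t * c) = (if c = 0 then 1 else char (distr M borel Z) t)"
  by (simp add: char_def integral_distr prob_space)

text \<open>If the normalised sums of i.i.d. variables converge to a centred normal law without having been
  centred, then the variables have mean \<open>0\<close> and the variance of the limit. By the central limit theorem the centred
  sums have a Gaussian limit; a nonzero mean would contribute a phase that oscillates.\<close>

lemma (in prob_space) gaussian_limit_moments:
  fixes Y :: "nat \<Rightarrow> 'a \<Rightarrow> real"
  assumes indep: "indep_vars (\<lambda>_. borel) Y UNIV"
    and ident: "\<And>n. distr M borel (Y n) = \<nu>"
    and sq_int: "\<And>n. integrable M (\<lambda>\<omega>. (Y n \<omega>)\<^sup>2)"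
    and lim: "\<And>t. (\<lambda>n. char (distr M borel (\<lambda>\<omega>. (\<Sum>i<n. Y i \<omega>) / sqrt (real n))) t)
      \<longlonglongrightarrow> complex_of_real (exp (- (t\<^sup>2 * v) / 2))"
  shows "expectation (Y 0) = 0" "expectation (\<lambda>\<omega>. (Y 0 \<omega>)\<^sup>2) = v"
proof -
  have Y_meas [measurable]: "Y n \<in> borel_measurable M" for n
    using indep unfolding indep_vars_def by auto
  have Y_int: "integrable M (Y n)" for n
    using L2_integrable[of "Y n"] sq_int[of n] by (simp add: Lp_space_2_iff)
  have same: "expectation (\<lambda>\<omega>. g (Y n \<omega>)) = (LINT x|\<nu>. g x)" if [measurable]: "g \<in> borel_measurable borel"
    for g :: "real \<Rightarrow> real" and n
    unfolding ident[of n, symmetric] by (simp add: integral_distr)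
  define m where "m = expectation (Y 0)"
  define s where "s = variance (Y 0)"
  have mean: "expectation (Y n) = m" for n
    using same[of "\<lambda>x. x"] by (simp add: m_def)
  have var: "variance (Y n) = s" for n
    unfolding mean s_def using same[of "\<lambda>x. (x - m)\<^sup>2"] by (simp add: m_def)
  have s_eq: "s = expectation (\<lambda>\<omega>. (Y 0 \<omega>)\<^sup>2) - m\<^sup>2"
    unfolding s_def m_def by (rule variance_eq[OF Y_int sq_int])
  define Z where "Z n \<omega> = (\<Sum>i<n. Y i \<omega> - m) / sqrt (real n)" for n \<omega>
  have Z_meas [measurable]: "Z n \<in> borel_measurable M" for n
    unfolding Z_def[abs_def] by measurable
  define \<zeta> where "\<zeta> n = char (distr M borel (Z n))" for n
  \<comment> \<open>The central limit theorem requires a positive variance, hence the case distinction on \<open>s\<close>.\<close>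
  have centred: "(\<lambda>n. \<zeta> n t) \<longlonglongrightarrow> complex_of_real (exp (- (t\<^sup>2 * s) / 2))" for t
  proof (cases "s = 0")
    case True
    have "AE \<omega> in M. Y n \<omega> - m = 0" for n
    proof -
      have L2: "(\<lambda>\<omega>. Y n \<omega> - m) \<in> Lp_space M 2"
        using L2_diff[of "Y n" M "\<lambda>_. m"] sq_int[of n] by (simp add: Lp_space_2_iff)
      show ?thesis
        using var[of n] True mean[of n] by (intro L2_null_AE[OF L2]) simp
    qed
    then have "AE \<omega> in M. \<forall>n. Y n \<omega> - m = 0"
      by (simp add: AE_all_countable)
    then have "AE \<omega> in M. iexp (t * Z n \<omega>) = 1" for n
      by eventually_elim (simp add: Z_def)
    then have "(CLINT \<omega>|M. iexp (t * Z n \<omega>)) = (CLINT \<omega>|M. 1)" for n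
      by (intro integral_cong_AE) auto
    then have "\<zeta> n t = 1" for n
      by (simp add: \<zeta>_def char_def integral_distr prob_space)
    then show ?thesis
      using True by simp
  next
    case False
    define \<sigma> where "\<sigma> = sqrt s"
    have "s \<ge> 0"
      unfolding s_def by (rule variance_positive)
    then have \<sigma>: "\<sigma> > 0" "\<sigma>\<^sup>2 = s"
      using False by (auto simp: \<sigma>_def)
    have "weak_conv_m (\<lambda>n. distr M borel (\<lambda>x. (\<Sum>i<n. Y i x - m) / sqrt (real n * \<sigma>\<^sup>2))) std_normal_distribution"
      using central_limit_theorem[OF indep mean \<sigma>(1) sq_int _ ident] var \<sigma>(2) by blast
    then have "(\<lambda>n. char (distr M borel (\<lambda>x. (\<Sum>i<n. Y i x - m) / sqrt (real n * \<sigma>\<^sup>2))) (t * \<sigma>))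
        \<longlonglongrightarrow> char std_normal_distribution (t * \<sigma>)"
      by (intro levy_continuity1 real_distribution_distr real_dist_normal_dist) measurable
    moreover have "char (distr M borel (\<lambda>x. (\<Sum>i<n. Y i x - m) / sqrt (real n * \<sigma>\<^sup>2))) (t * \<sigma>) = \<zeta> n t" for n
    proof -
      have "(\<lambda>x. (\<Sum>i<n. Y i x - m) / sqrt (real n * \<sigma>\<^sup>2)) = (\<lambda>x. Z n x / \<sigma>)"
        using \<sigma>(1) by (simp add: Z_def real_sqrt_mult fun_eq_iff)
      then show ?thesis
        using char_scale[OF Z_meas[of n], of \<sigma> t] \<sigma>(1) by (simp add: \<zeta>_def)
    qed
    ultimately show ?thesis
      using \<sigma>(2) by (simp add: char_std_normal_distribution power_mult_distrib)
  qed
  have shift: "char (distr M borel (\<lambda>\<omega>. (\<Sum>i<n. Y i \<omega>) / sqrt (real n))) t = iexp (t * (m * sqrt (real n))) * \<zeta> n t" for n t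
  proof -
    have "(\<lambda>\<omega>. (\<Sum>i<n. Y i \<omega>) / sqrt (real n)) = (\<lambda>\<omega>. Z n \<omega> + m * sqrt (real n))"
      by (intro ext, cases "n = 0")
        (simp_all add: Z_def sum_subtractf diff_divide_distrib real_div_sqrt flip: times_divide_eq_left)
    then show ?thesis
      using char_shift[OF Z_meas] by (simp add: \<zeta>_def)
  qed
  have limit: "(\<lambda>n. iexp (t * (m * sqrt (real n))) * \<zeta> n t) \<longlonglongrightarrow> complex_of_real (exp (- (t\<^sup>2 * v) / 2))" for t
    using lim[of t] unfolding shift .
  \<comment> \<open>The mean only contributes a phase, so moduli determine the variance.\<close>
  have "v = s"
  proof -
    have "(\<lambda>n. norm (\<zeta> n 1)) \<longlonglongrightarrow> exp (- v / 2)"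
      using tendsto_norm[OF limit[of 1]] by (simp add: norm_mult)
    moreover have "(\<lambda>n. norm (\<zeta> n 1)) \<longlonglongrightarrow> exp (- s / 2)"
      using tendsto_norm[OF centred[of 1]] by simp
    ultimately have "exp (- v / 2) = exp (- s / 2)"
      by (rule LIMSEQ_unique)
    then show ?thesis by simp
  qed
  have phase: "(\<lambda>n. iexp (t * (m * sqrt (real n)))) \<longlonglongrightarrow> 1" for t
  proof -
    have nz: "\<forall>\<^sub>F n in sequentially. \<zeta> n t \<noteq> 0"
      using centred[of t] by (rule tendsto_imp_eventually_ne) simp
    have "(\<lambda>n. iexp (t * (m * sqrt (real n))) * \<zeta> n t / \<zeta> n t) \<longlonglongrightarrow> 1"
      using tendsto_divide[OF limit[of t] centred[of t]] \<open>v = s\<close> by simp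
    then show ?thesis
      by (rule Lim_transform_eventually) (use nz in eventually_elim, simp)
  qed
  \<comment> \<open>Along odd squares \<open>n = (2k+1)^2\<close> and for \<open>t = \<pi> / m\<close> the phase equals \<open>-1\<close>.\<close>
  have "m = 0"
  proof (rule ccontr)
    assume "m \<noteq> 0"
    have odd_phase: "iexp (pi * real j) = - 1" if "odd j" for j
      using that cos_npi2[of j] sin_npi2[of j] by (simp add: complex_eq_iff Re_exp Im_exp)
    have "strict_mono (\<lambda>k::nat. (2 * k + 1)\<^sup>2)"
      by (intro strict_monoI power_strict_mono) auto
    from LIMSEQ_subseq_LIMSEQ[OF phase[of "pi / m"] this]
    have "(\<lambda>k. iexp (pi * real (2 * k + 1))) \<longlonglongrightarrow> 1"
      using \<open>m \<noteq> 0\<close> by (simp add: o_def real_sqrt_abs)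
    moreover have "iexp (pi * real (2 * k + 1)) = - 1" for k
      by (rule odd_phase) simp
    ultimately have "(\<lambda>k::nat. - 1 :: complex) \<longlonglongrightarrow> 1"
      by simp
    then have "(- 1 :: complex) = 1"
      by (simp add: LIMSEQ_const_iff)
    then show False by simp
  qed
  then show "expectation (Y 0) = 0" "expectation (\<lambda>\<omega>. (Y 0 \<omega>)\<^sup>2) = v"
    using \<open>v = s\<close> s_eq by (simp_all add: m_def)
qed

lemma (in prob_space) indep_vars_shift_index:
  assumes "indep_vars (\<lambda>_. N) X {1..}"
  shows "indep_vars (\<lambda>_. N) (\<lambda>i. X (Suc i)) (UNIV :: nat set)"
proof -
  have "indep_vars (\<lambda>j. PiM {Suc j} (\<lambda>_. N)) (\<lambda>j \<omega>. restrict (\<lambda>i. X i \<omega>) {Suc j}) UNIV"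
    using assms by (rule indep_vars_restrict) (auto simp: disjoint_family_on_def)
  then have "indep_vars (\<lambda>_. N) (\<lambda>j \<omega>. (restrict (\<lambda>i. X i \<omega>) {Suc j}) (Suc j)) (UNIV :: nat set)"
    by (rule indep_vars_compose2[where Y = "\<lambda>j g. g (Suc j)"]) (simp add: measurable_component_singleton)
  then show ?thesis by simp
qed

text \<open>\<^const>\<open>RN_deriv\<close> is constantly \<open>0\<close> when there is no density, and the distance of \<open>0\<close> to \<open>1\<close> is
  \<open>1\<close>. Closeness to \<open>1\<close> thus guarantees that the density exists.\<close>

lemma (in prob_space) RN_deriv_close_imp_density:
  assumes "Lp_norm M 1 (\<lambda>x. enn2real (RN_deriv M N x) - 1) < 1"
  shows "density M (RN_deriv M N) = N"
proof (rule ccontr)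
  assume "density M (RN_deriv M N) \<noteq> N"
  then have "\<nexists>g. g \<in> borel_measurable M \<and> density M g = N"
    using RN_derivI by blast
  then have "RN_deriv M N = (\<lambda>_. 0)"
    unfolding RN_deriv_def by (simp only: if_False)
  then show False
    using assms by (simp add: Lp_norm_def prob_space)
qed

text \<open>The distance of the densities in \<open>L\<^sup>1\<close> controls the total variation distance of the laws.\<close>

lemma (in prob_space) density_integral_close:
  fixes g :: "'a \<Rightarrow> complex"
  assumes \<rho> [measurable]: "\<rho> \<in> borel_measurable M" and N: "prob_space (density M \<rho>)"
    and g [measurable]: "g \<in> borel_measurable M" and g_le: "\<And>x. norm (g x) \<le> 1"
  shows "norm ((CLINT x|density M \<rho>. g x) - (CLINT x|M. g x)) \<le> Lp_norm M 1 (\<lambda>x. enn2real (\<rho> x) - 1)"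
proof -
  define r where "r x = enn2real (\<rho> x)" for x
  have [measurable]: "r \<in> borel_measurable M"
    unfolding r_def[abs_def] by measurable
  have total: "(\<integral>\<^sup>+x. \<rho> x \<partial>M) = 1"
    using prob_space.emeasure_space_1[OF N] by (simp add: emeasure_density cong: nn_integral_cong)
  then have "AE x in M. \<rho> x \<noteq> \<infinity>"
    by (intro nn_integral_PInf_AE) auto
  then have eq: "AE x in M. \<rho> x = ennreal (r x)"
    by eventually_elim (simp add: r_def less_top)
  have r_int: "integrable M r"
  proof (rule integrableI_nonneg)
    have "(\<integral>\<^sup>+x. ennreal (r x) \<partial>M) = (\<integral>\<^sup>+x. \<rho> x \<partial>M)"
      by (rule nn_integral_cong_AE) (use eq in eventually_elim, simp)
    then show "(\<integral>\<^sup>+x. ennreal (r x) \<partial>M) < \<infinity>"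
      by (simp add: total)
  qed (auto simp: r_def)
  have g_int: "integrable M g"
    using g_le by (intro integrable_const_bound[of _ 1]) auto
  have rg_int: "integrable M (\<lambda>x. r x *\<^sub>R g x)"
    by (rule Bochner_Integration.integrable_bound[OF r_int])
      (auto intro!: AE_I2 mult_left_le g_le simp: r_def)
  have "density M \<rho> = density M (\<lambda>x. ennreal (r x))"
    by (rule density_cong) (use eq in auto)
  then have "(CLINT x|density M \<rho>. g x) = (CLINT x|M. r x *\<^sub>R g x)"
    by (simp add: integral_density r_def)
  then have "(CLINT x|density M \<rho>. g x) - (CLINT x|M. g x) = (CLINT x|M. r x *\<^sub>R g x - g x)"
    using g_int rg_int by simp
  also have "norm \<dots> \<le> (LINT x|M. norm (r x *\<^sub>R g x - g x))"
    by (rule integral_norm_bound)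
  also have "\<dots> \<le> (LINT x|M. \<bar>r x - 1\<bar>)"
  proof (rule integral_mono)
    show "norm (r x *\<^sub>R g x - g x) \<le> \<bar>r x - 1\<bar>" for x
    proof -
      have "r x *\<^sub>R g x - g x = (r x - 1) *\<^sub>R g x"
        by (simp add: scaleR_left_diff_distrib)
      then show ?thesis
        using mult_left_mono[OF g_le[of x], of "\<bar>r x - 1\<bar>"] by simp
    qed
  qed (use g_int rg_int r_int in auto)
  also have "\<dots> = Lp_norm M 1 (\<lambda>x. enn2real (\<rho> x) - 1)"
    by (simp add: Lp_norm_def r_def)
  finally show ?thesis .
qed

theorem proposition3p2:
  fixes \<iota> :: "'h::{real_inner, complete_space, second_countable_topology}
                \<Rightarrow> 'w::{banach, second_countable_topology}"
    and \<mu> :: "'w measure"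
    and P :: "'o measure"
    and X :: "nat \<Rightarrow> 'o \<Rightarrow> 'w"
    and f :: "'w \<Rightarrow> real"
    and p :: real
  assumes wiener: "abstract_wiener_space \<iota> \<mu>"
    and prob: "prob_space P"
    and indep: "prob_space.indep_vars P (\<lambda>_. borel) X {1..}"
    and f_nonneg: "AE w in \<mu>. 0 \<le> f w"
    and density: "\<And>n. n \<ge> 1 \<Longrightarrow> distributed P \<mu> (X n) (\<lambda>w. ennreal (f w))"
    and p: "p > 1"
    and f_Lp: "f \<in> Lp_space \<mu> p"
    and conv: "(\<lambda>n. Lp_norm \<mu> 1 (\<lambda>w. enn2real
        (RN_deriv \<mu> (distr P \<mu> (\<lambda>\<omega>. (\<Sum>k=1..n. X k \<omega>) /\<^sub>R sqrt (real n))) w) - 1)) \<longlonglongrightarrow> 0"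
  shows "(AE w in \<mu>. chaos_projection \<iota> \<mu> 1 p f w = 0) \<and>
         (AE w in \<mu>. chaos_projection \<iota> \<mu> 2 p f w = 0)"
proof -
  interpret W: abstract_wiener_space \<iota> \<mu> by fact
  interpret P: prob_space P by fact
  have [measurable]: "f \<in> borel_measurable \<mu>"
    using f_Lp by (simp add: Lp_space_def)
  have X_meas: "X n \<in> P \<rightarrow>\<^sub>M \<mu>" if "n \<ge> 1" for n
    using density[OF that] by (simp add: distributed_def)
  have pos_density: "distributed P \<mu> (X n) (\<lambda>w. ennreal (max 0 (f w)))" if "n \<ge> 1" for n
  proof -
    have "ennreal (max 0 x) = ennreal x" for x
      by (cases "0 \<le> x") (simp_all add: ennreal_neg)
    then show ?thesis
      using density[OF that] by simp
  qed
  \<comment> \<open>The transfer rules for densities ask for nonnegativity everywhere.\<close>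
  have f_max: "(LINT w|\<mu>. max 0 (f w) * g w) = (LINT w|\<mu>. f w * g w)"
    if [measurable]: "g \<in> borel_measurable \<mu>" for g
    using f_nonneg by (intro integral_cong_AE) (auto simp: max_def)
  have f_integral: "(LINT w|\<mu>. f w * g w) = P.expectation (\<lambda>\<omega>. g (X n \<omega>))"
    if "n \<ge> 1" "g \<in> borel_measurable \<mu>" for n g
    using distributed_integral[OF pos_density[OF that(1)] that(2)] f_max[OF that(2)] by simp
  have f_integrable: "integrable \<mu> (\<lambda>w. f w * G w)" if "all_moments \<mu> G" for G
    using p by (intro Lp_mult_integrable(1)[OF p f_Lp] W.all_moments_Lp[OF that]) auto
  define S where "S n \<omega> = (\<Sum>k=1..n. X k \<omega>) /\<^sub>R sqrt (real n)" for n \<omega>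
  define \<rho> where "\<rho> n = RN_deriv \<mu> (distr P \<mu> (S n))" for n
  have S_meas: "S n \<in> P \<rightarrow>\<^sub>M \<mu>" for n
  proof -
    have "X k \<in> borel_measurable P" if "k \<in> {1..n}" for k
      using X_meas[of k] that measurable_cong_sets[OF refl W.sets_eq_borel, of P] by auto
    then have "S n \<in> borel_measurable P"
      unfolding S_def[abs_def] by (intro borel_measurable_scaleR borel_measurable_sum) auto
    then show ?thesis
      using measurable_cong_sets[OF refl W.sets_eq_borel, of P] by auto
  qed
  have conv': "(\<lambda>n. Lp_norm \<mu> 1 (\<lambda>w. enn2real (\<rho> n w) - 1)) \<longlonglongrightarrow> 0"
    using conv by (simp add: \<rho>_def S_def[abs_def])
  have moments: "(LINT w|\<mu>. f w * \<phi> w) = 0 \<and> (LINT w|\<mu>. f w * (\<phi> w)\<^sup>2) = (norm (W.e \<phi>))\<^sup>2"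
    for \<phi> :: "'w \<Rightarrow>\<^sub>L real"
  proof -
    define Y where "Y i \<omega> = \<phi> (X (Suc i) \<omega>)" for i \<omega>
    have indep_Y: "P.indep_vars (\<lambda>_. borel) Y UNIV"
      unfolding Y_def[abs_def]
      by (rule P.indep_vars_compose2[OF P.indep_vars_shift_index[OF indep]])
        (intro borel_measurable_continuous_onI continuous_intros)
    have ident: "distr P borel (Y i) = distr (density \<mu> (\<lambda>w. ennreal (f w))) borel (blinfun_apply \<phi>)" for i
    proof -
      have "distr P \<mu> (X (Suc i)) = density \<mu> (\<lambda>w. ennreal (f w))"
        using density[of "Suc i"] by (simp add: distributed_def)
      then have "distr (density \<mu> (\<lambda>w. ennreal (f w))) borel (blinfun_apply \<phi>)
          = distr (distr P \<mu> (X (Suc i))) borel (blinfun_apply \<phi>)"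
        by simp
      also have "\<dots> = distr P borel (Y i)"
        by (subst distr_distr) (auto simp: X_meas Y_def[abs_def] o_def)
      finally show ?thesis by simp
    qed
    have sq_int: "integrable P (\<lambda>\<omega>. (Y i \<omega>)\<^sup>2)" for i
    proof -
      have "integrable \<mu> (\<lambda>w. f w * (\<phi> w)\<^sup>2)"
        by (intro f_integrable W.moment_intros)
      then have "integrable \<mu> (\<lambda>w. max 0 (f w) * (\<phi> w)\<^sup>2)"
        by (rule integrable_cong_AE_imp) (use f_nonneg in \<open>auto simp: max_def\<close>)
      then show ?thesis
        using distributed_integrable[OF pos_density[of "Suc i"], of "\<lambda>w. (\<phi> w)\<^sup>2"]
        by (simp add: Y_def)
    qed
    have sum_eq: "(\<Sum>i<n. Y i \<omega>) / sqrt (real n) = \<phi> (S n \<omega>)" for n \<omega>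
    proof -
      have "(\<Sum>i<n. Y i \<omega>) = (\<Sum>k=1..n. \<phi> (X k \<omega>))"
        unfolding Y_def by (rule sum.reindex_bij_witness[of _ "\<lambda>k. k - 1" Suc]) auto
      then show ?thesis
        by (simp add: S_def blinfun.scaleR_right blinfun.sum_right divide_inverse mult.commute)
    qed
    have char_lim: "(\<lambda>n. char (distr P borel (\<lambda>\<omega>. (\<Sum>i<n. Y i \<omega>) / sqrt (real n))) t)
        \<longlonglongrightarrow> complex_of_real (exp (- (t\<^sup>2 * (norm (W.e \<phi>))\<^sup>2) / 2))" for t
    proof -
      define L where "L = complex_of_real (exp (- (t\<^sup>2 * (norm (W.e \<phi>))\<^sup>2) / 2))"
      have L: "(CLINT w|\<mu>. iexp (t * \<phi> w)) = L"
        using W.characteristic_functional[of "t *\<^sub>R \<phi>"]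
        by (simp add: blinfun.scaleR_left W.dual_embedding_simps power_mult_distrib L_def)
      have close: "norm (char (distr P borel (\<lambda>\<omega>. \<phi> (S n \<omega>))) t - L)
          \<le> Lp_norm \<mu> 1 (\<lambda>w. enn2real (\<rho> n w) - 1)"
        if "Lp_norm \<mu> 1 (\<lambda>w. enn2real (\<rho> n w) - 1) < 1" for n
      proof -
        have dens: "density \<mu> (\<rho> n) = distr P \<mu> (S n)"
          using W.RN_deriv_close_imp_density that unfolding \<rho>_def by blast
        have "char (distr P borel (\<lambda>\<omega>. \<phi> (S n \<omega>))) t = (CLINT \<omega>|P. iexp (t * \<phi> (S n \<omega>)))"
          using measurable_compose[OF S_meas W.functional_measurable, of \<phi> n]
          by (simp add: char_def integral_distr)
        also have "\<dots> = (CLINT w|density \<mu> (\<rho> n). iexp (t * \<phi> w))"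
          unfolding dens by (subst integral_distr[OF S_meas]) auto
        finally have "char (distr P borel (\<lambda>\<omega>. \<phi> (S n \<omega>))) t = (CLINT w|density \<mu> (\<rho> n). iexp (t * \<phi> w))" .
        moreover have "prob_space (density \<mu> (\<rho> n))"
          unfolding dens by (rule P.prob_space_distr[OF S_meas])
        ultimately show ?thesis
          using W.density_integral_close[of "\<rho> n" "\<lambda>w. iexp (t * \<phi> w)"] L
          by (simp add: \<rho>_def)
      qed
      have "\<forall>\<^sub>F n in sequentially. Lp_norm \<mu> 1 (\<lambda>w. enn2real (\<rho> n w) - 1) < 1"
        by (rule order_tendstoD(2)[OF conv']) simp
      then have "\<forall>\<^sub>F n in sequentially. norm (char (distr P borel (\<lambda>\<omega>. \<phi> (S n \<omega>))) t - L)
          \<le> Lp_norm \<mu> 1 (\<lambda>w. enn2real (\<rho> n w) - 1)"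
        by eventually_elim (rule close)
      then have "(\<lambda>n. char (distr P borel (\<lambda>\<omega>. \<phi> (S n \<omega>))) t - L) \<longlonglongrightarrow> 0"
        by (rule Lim_null_comparison[OF _ conv'])
      then show ?thesis
        unfolding sum_eq L_def by (simp add: LIM_zero_iff)
    qed
    note Y_moments = P.gaussian_limit_moments[OF indep_Y ident sq_int char_lim]
    have "(LINT w|\<mu>. f w * \<phi> w) = P.expectation (Y 0)"
      "(LINT w|\<mu>. f w * (\<phi> w)\<^sup>2) = P.expectation (\<lambda>\<omega>. (Y 0 \<omega>)\<^sup>2)"
      using f_integral[of 1 "blinfun_apply \<phi>"] f_integral[of 1 "\<lambda>w. (\<phi> w)\<^sup>2"]
      by (simp_all add: Y_def[abs_def])
    then show ?thesis
      using Y_moments by simp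
  qed
  have total: "(LINT w|\<mu>. f w * 1) = 1"
    using f_integral[of 1 "\<lambda>_. 1"] by (simp add: P.prob_space)
  have quad: "(LINT w|\<mu>. f w * W.quad m c \<phi> w) = 0" for m c \<phi>
  proof -
    have int: "integrable \<mu> (\<lambda>w. f w * (\<phi> j w)\<^sup>2)" "integrable \<mu> (\<lambda>w. f w * 1)" for j
      by (intro f_integrable W.moment_intros)+
    have "(LINT w|\<mu>. f w * W.quad m c \<phi> w)
        = (LINT w|\<mu>. (\<Sum>j<m. c j * (f w * (\<phi> j w)\<^sup>2 - (norm (W.e (\<phi> j)))\<^sup>2 * (f w * 1))))"
      by (simp add: W.quad_def sum_distrib_left algebra_simps)
    also have "\<dots> = (\<Sum>j<m. c j * ((LINT w|\<mu>. f w * (\<phi> j w)\<^sup>2) - (norm (W.e (\<phi> j)))\<^sup>2 * (LINT w|\<mu>. f w * 1)))"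
      using int by (subst Bochner_Integration.integral_sum) auto
    also have "\<dots> = 0"
      unfolding total using moments by simp
    finally show ?thesis .
  qed
  show ?thesis
    using W.chaos_projection_1_zero[OF p f_Lp] W.chaos_projection_2_zero[OF p f_Lp] moments quad by blast
qed

end
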